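(* Let $G$ be a finite abelian group acting without inversion on a finite graph $Y$, let $H\le G$, let $V$ be an Artin representation of $H$ and $\mathrm{Ind}(V)=\mathbb{C}[G]\otimes_{\mathbb{C}[H]}V$ the induced representation of $G$. Then $c_{\mathrm{Ind}(V)}(u)=c_V(u)$ and $h_{\mathrm{Ind}(V)}(u)=h_V(u)$, so that also $L_{\mathrm{Ind}(V)}(u)=L_V(u)$, where the left-hand sides are formed with respect to the action of $G$ on $Y$ and the right-hand sides with respect to the restricted action of $H$ on $Y$.
   Context: Graphs in Serre's sense (vertices $V_Y$, directed edges $\mathbf{E}_Y$, maps $o,t$, fixed-point-free involution $\varepsilon\mapsto\bar\varepsilon$ with $o(\bar\varepsilon)=t(\varepsilon)$); $\mathrm{val}_Y(w)=|\{\varepsilon:o(\varepsilon)=w\}|$; without inversion: $\sigma\varepsilon\ne\bar\varepsilon$. For a finite abelian group $K$ acting without inversion: $C_0(Y)=\mathbb{C}V_Y$, $C_1(Y)=\mathbb{C}\mathbf{E}_Y/W$ ($W$ spanned by $\varepsilon+\bar\varepsilon$); $\chi_{\mathbb{C}[K]}(Y)=\mathrm{rank}_{\mathbb{C}[K]}C_0(Y)-\mathrm{rank}_{\mathbb{C}[K]}C_1(Y)$ (Hattori–Stallings ranks); $\gamma_Y(u)=\exp(-\chi_{\mathbb{C}[K]}(Y)\log(1-u^2))\in\mathbb{C}[K][[u]]$; $\eta_Y(u)=\det_{\mathbb{C}[K][u]}(\mathcal{I}-\mathcal{A}u+(\mathcal{D}-\mathcal{I})u^2)$ on $C_0(Y)[u]$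 with $\mathcal{D}(w)=\mathrm{val}_Y(w)w$, $\mathcal{A}(w)=\sum_{o(\varepsilon)=w}t(\varepsilon)$ (determinants of endomorphisms of finitely generated projective modules computed after adding the identity on a complement making the module free); $\theta_Y=(\gamma_Y\eta_Y)^{-1}$. For an Artin representation (finitely generated $\mathbb{C}[K]$-module) $V$, $\sigma_V:\mathbb{C}[K][[u]]\to\mathbb{C}[[u]]$ sends $\sum\lambda_iu^i$ to $\det_{\mathbb{C}[[u]]}$ of the endomorphism $\sum\rho_V(\lambda_i)u^i$ of $V[[u]]$ ($\rho_V$ the action on $V$), and $c_V=\sigma_V(\gamma_Y)$, $h_V=\sigma_V(\eta_Y)$, $L_V=\sigma_V(\theta_Y)$. *)

theory Defs
  imports
    "Jordan_Normal_Form.VS_Connect"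
    "HOL-Algebra.AbelCoset"
    "HOL-Algebra.Group_Action"
    "HOL-Library.Poly_Mapping"
    "HOL-Computational_Algebra.Group_Closure"
    "HOL-Computational_Algebra.Formal_Power_Series"
    "HOL-Computational_Algebra.Polynomial_FPS"
begin

hide_const (open) Multiset.mult Polynomial.smult Modules.module Modules.module_hom

section \<open>Rings and modules\<close>

text \<open>
  Rings are subrings \<open>R\<close> of a commutative ring type, with the operations of that type;
  modules over them are those of \<open>HOL-Algebra\<close>.
\<close>

abbreviation ring_on :: "'r::comm_ring_1 set \<Rightarrow> 'r ring" where
  "ring_on R \<equiv> class_ring\<lparr>carrier := R\<rparr>"

definition free_module :: "'r::comm_ring_1 set \<Rightarrow> nat \<Rightarrow> ('r, 'r vec) module" where
  "free_module R n =
     (module_vec TYPE('r) n)\<lparr>carrier := {v \<in> carrier_vec n. \<forall>i<n. vec_index v i \<in> R}\<rparr>"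

definition finitely_generated :: "'r::comm_ring_1 set \<Rightarrow> ('r, 'm) module \<Rightarrow> bool" where
  "finitely_generated R M \<longleftrightarrow>
     (\<exists>S. finite S \<and> S \<subseteq> carrier M \<and>
          LinearCombinations.module.span (ring_on R) M S = carrier M)"

definition quotient_module :: "('r, 'm) module \<Rightarrow> 'm set \<Rightarrow> ('r, 'm set) module" where
  "quotient_module M N =
     \<lparr>carrier = a_rcosets\<^bsub>M\<^esub> N, mult = undefined, one = undefined,
      zero = N, add = set_add M,
      smult = (\<lambda>r X. \<Union>x\<in>X. N +>\<^bsub>M\<^esub> (r \<odot>\<^bsub>M\<^esub> x))\<rparr>"

subsection \<open>Trace and determinant of endomorphisms of finitely generated projective modules\<close>

text \<open>
  \<open>\<theta>\<close> is an isomorphism from \<open>M \<oplus> Q\<close> onto \<open>R\<close>\<open>^n\<close>. In HOL the type of the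
  complement \<open>Q\<close> must be fixed; as \<open>Q\<close> embeds into \<open>R\<close>\<open>^n\<close>,
  modules of vectors over \<open>R\<close> suffice.
\<close>

definition free_completion ::
  "'r::comm_ring_1 set \<Rightarrow> ('r, 'm) module \<Rightarrow> ('r, 'r vec) module \<Rightarrow> nat \<Rightarrow>
     ('m \<times> 'r vec \<Rightarrow> 'r vec) \<Rightarrow> bool" where
  "free_completion R M Q n \<theta> \<longleftrightarrow>
     module (ring_on R) M \<and> module (ring_on R) Q \<and>
     \<theta> \<in> module_hom (ring_on R) (direct_sum M Q) (free_module R n) \<and>
     bij_betw \<theta> (carrier (direct_sum M Q)) (carrier (free_module R n))"

text \<open>\<open>A\<close> is the matrix of \<open>\<theta> \<circ> \<psi> \<circ> \<theta>\<close>\<open>^(-1)\<close> for an endomorphism \<open>\<psi>\<close> of \<open>M \<oplus> Q\<close>.\<close>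

definition matrix_of_endo ::
  "'r::comm_ring_1 set \<Rightarrow> ('r, 'm) module \<Rightarrow> ('r, 'r vec) module \<Rightarrow> nat \<Rightarrow>
     ('m \<times> 'r vec \<Rightarrow> 'r vec) \<Rightarrow> ('m \<times> 'r vec \<Rightarrow> 'm \<times> 'r vec) \<Rightarrow> 'r mat \<Rightarrow> bool" where
  "matrix_of_endo R M Q n \<theta> \<psi> A \<longleftrightarrow>
     A \<in> carrier_mat n n \<and> elements_mat A \<subseteq> R \<and>
     (\<forall>z \<in> carrier (direct_sum M Q). \<theta> (\<psi> z) = A *\<^sub>v \<theta> z)"

definition proj_det :: "'r::comm_ring_1 set \<Rightarrow> ('r, 'm) module \<Rightarrow> ('m \<Rightarrow> 'm) \<Rightarrow> 'r" where
  "proj_det R M \<phi> =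
     (THE d. \<exists>Q n \<theta> A. free_completion R M Q n \<theta> \<and>
        matrix_of_endo R M Q n \<theta> (\<lambda>(x, q). (\<phi> x, q)) A \<and> d = det A)"

definition proj_trace :: "'r::comm_ring_1 set \<Rightarrow> ('r, 'm) module \<Rightarrow> ('m \<Rightarrow> 'm) \<Rightarrow> 'r" where
  "proj_trace R M \<phi> =
     (THE d. \<exists>Q n \<theta> A. free_completion R M Q n \<theta> \<and>
        matrix_of_endo R M Q n \<theta> (\<lambda>(x, q). (\<phi> x, \<zero>\<^bsub>Q\<^esub>)) A \<and> d = (\<Sum>i<n. A $$ (i, i)))"

text \<open>
  The Hattori--Stallings rank is the trace of the identity. It lives in \<open>R / [R, R]\<close>, which is
  \<open>R\<close> here.
\<close>

definition hs_rank :: "'r::comm_ring_1 set \<Rightarrow> ('r, 'm) module \<Rightarrow> 'r" where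
  "hs_rank R M = proj_trace R M (\<lambda>x. x)"

subsection \<open>Extension of scalars\<close>

text \<open>
  \<open>S \<otimes>\<^sub>R M\<close> for a subring \<open>R\<close> of \<open>S\<close>: the free abelian group on \<open>S \<times> M\<close> modulo the
  bilinearity and balancing relations, with \<open>S\<close> acting on the left factor. The scalar
  multiplication on the free group is not additive in \<open>S\<close>; it becomes so on the quotient.
\<close>

definition tensor_generators ::
  "'r::comm_ring_1 set \<Rightarrow> ('r, 'm) module \<Rightarrow> ('r, ('r \<times> 'm) \<Rightarrow>\<^sub>0 int) module" where
  "tensor_generators S M =
     \<lparr>carrier = {c. Poly_Mapping.keys c \<subseteq> S \<times> carrier M},
      mult = undefined, one = undefined, zero = 0, add = (+),
      smult = (\<lambda>r c. \<Sum>(s, x)\<in>Poly_Mapping.keys c.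
                 Poly_Mapping.single (r * s, x) (Poly_Mapping.lookup c (s, x)))\<rparr>"

definition tensor_relations ::
  "'r::comm_ring_1 set \<Rightarrow> 'r set \<Rightarrow> ('r, 'm) module \<Rightarrow> (('r \<times> 'm) \<Rightarrow>\<^sub>0 int) set" where
  "tensor_relations S R M =
     (let g = (\<lambda>s x. Poly_Mapping.single (s, x) 1) in
      {g (s + s') x - g s x - g s' x | s s' x. s \<in> S \<and> s' \<in> S \<and> x \<in> carrier M} \<union>
      {g s (x \<oplus>\<^bsub>M\<^esub> x') - g s x - g s x' | s x x'. s \<in> S \<and> x \<in> carrier M \<and> x' \<in> carrier M} \<union>
      {g (s * r) x - g s (r \<odot>\<^bsub>M\<^esub> x) | s r x. s \<in> S \<and> r \<in> R \<and> x \<in> carrier M})"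

definition extend_scalars ::
  "'r::comm_ring_1 set \<Rightarrow> 'r set \<Rightarrow> ('r, 'm) module \<Rightarrow>
     ('r, (('r \<times> 'm) \<Rightarrow>\<^sub>0 int) set) module" where
  "extend_scalars S R M =
     quotient_module (tensor_generators S M) (group_closure (tensor_relations S R M))"

subsection \<open>Polynomials and power series with coefficients in a module\<close>

text \<open>
  An element \<open>\<Sum> x\<^sub>i u\<close>\<open>^i\<close> of \<open>M[u]\<close> or \<open>M[[u]]\<close> is the sequence of its coefficients.
  \<open>series_endo M \<Phi>\<close> is the map \<open>\<Sum> \<Phi>\<^sub>i u\<close>\<open>^i\<close> on such elements, for maps \<open>\<Phi>\<^sub>i\<close> on \<open>M\<close>.
\<close>

definition series_endo ::
  "('r, 'm) module \<Rightarrow> (nat \<Rightarrow> 'm \<Rightarrow> 'm) \<Rightarrow> (nat \<Rightarrow> 'm) \<Rightarrow> (nat \<Rightarrow> 'm)" where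
  "series_endo M \<Phi> f = (\<lambda>n. \<Oplus>\<^bsub>M\<^esub> i\<in>{..n}. \<Phi> i (f (n - i)))"

definition poly_module :: "('r::comm_ring_1, 'm) module \<Rightarrow> ('r poly, nat \<Rightarrow> 'm) module" where
  "poly_module M =
     \<lparr>carrier = {f. (\<forall>n. f n \<in> carrier M) \<and> finite {n. f n \<noteq> \<zero>\<^bsub>M\<^esub>}},
      mult = undefined, one = undefined,
      zero = (\<lambda>_. \<zero>\<^bsub>M\<^esub>), add = (\<lambda>f g n. f n \<oplus>\<^bsub>M\<^esub> g n),
      smult = (\<lambda>p. series_endo M (\<lambda>i x. Polynomial.coeff p i \<odot>\<^bsub>M\<^esub> x))\<rparr>"

section \<open>Group algebras of finite abelian groups\<close>

definition additive_group :: "'g::ab_group_add set \<Rightarrow> 'g monoid" where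
  "additive_group K = \<lparr>carrier = K, mult = (+), one = 0\<rparr>"

text \<open>
  With the convolution product of \<open>HOL-Library.Poly_Mapping\<close>, the type \<open>'g \<Rightarrow>\<^sub>0 complex\<close> is the
  complex group algebra of the additive group \<open>'g\<close>; \<open>group_alg K\<close> is the group algebra of \<open>K\<close>.
\<close>

definition group_alg :: "'g::ab_group_add set \<Rightarrow> ('g \<Rightarrow>\<^sub>0 complex) set" where
  "group_alg K = {a. Poly_Mapping.keys a \<subseteq> K}"

definition group_alg_poly :: "'g::ab_group_add set \<Rightarrow> ('g \<Rightarrow>\<^sub>0 complex) poly set" where
  "group_alg_poly K = {p. \<forall>i. Polynomial.coeff p i \<in> group_alg K}"

definition group_alg_fps :: "'g::ab_group_add set \<Rightarrow> ('g \<Rightarrow>\<^sub>0 complex) fps set" where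
  "group_alg_fps K = {F. \<forall>i. fps_nth F i \<in> group_alg K}"

abbreviation scalar :: "complex \<Rightarrow> ('g::ab_group_add \<Rightarrow>\<^sub>0 complex)" where
  "scalar z \<equiv> Poly_Mapping.single 0 z"

definition scalar_fps :: "complex fps \<Rightarrow> ('g::ab_group_add \<Rightarrow>\<^sub>0 complex) fps" where
  "scalar_fps F = Abs_fps (\<lambda>i. scalar (fps_nth F i))"

definition artin_rep ::
  "'g::ab_group_add set \<Rightarrow> ('g \<Rightarrow>\<^sub>0 complex, 'm) module \<Rightarrow> bool" where
  "artin_rep K V \<longleftrightarrow>
     module (ring_on (group_alg K)) V \<and> finitely_generated (group_alg K) V"

definition induced_rep ::
  "'g::ab_group_add set \<Rightarrow> 'g set \<Rightarrow> ('g \<Rightarrow>\<^sub>0 complex, 'm) module \<Rightarrow>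
     ('g \<Rightarrow>\<^sub>0 complex, ((('g \<Rightarrow>\<^sub>0 complex) \<times> 'm) \<Rightarrow>\<^sub>0 int) set) module" where
  "induced_rep G H V = extend_scalars (group_alg G) (group_alg H) V"

definition fps_module ::
  "('g::ab_group_add \<Rightarrow>\<^sub>0 complex, 'm) module \<Rightarrow> (complex fps, nat \<Rightarrow> 'm) module" where
  "fps_module V =
     \<lparr>carrier = {f. \<forall>n. f n \<in> carrier V}, mult = undefined, one = undefined,
      zero = (\<lambda>_. \<zero>\<^bsub>V\<^esub>), add = (\<lambda>f g n. f n \<oplus>\<^bsub>V\<^esub> g n),
      smult = (\<lambda>c. series_endo V (\<lambda>i x. scalar (fps_nth c i) \<odot>\<^bsub>V\<^esub> x))\<rparr>"

definition sigma_rep ::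
  "('g::ab_group_add \<Rightarrow>\<^sub>0 complex, 'm) module \<Rightarrow> ('g \<Rightarrow>\<^sub>0 complex) fps \<Rightarrow> complex fps" where
  "sigma_rep V \<Lambda> =
     proj_det UNIV (fps_module V) (series_endo V (\<lambda>i x. fps_nth \<Lambda> i \<odot>\<^bsub>V\<^esub> x))"

definition perm_module ::
  "'x set \<Rightarrow> ('g::ab_group_add \<Rightarrow> 'x \<Rightarrow> 'x) \<Rightarrow> ('g \<Rightarrow>\<^sub>0 complex, 'x \<Rightarrow>\<^sub>0 complex) module" where
  "perm_module X \<sigma> =
     \<lparr>carrier = {c. Poly_Mapping.keys c \<subseteq> X}, mult = undefined, one = undefined,
      zero = 0, add = (+),
      smult = (\<lambda>a c. \<Sum>k\<in>Poly_Mapping.keys a. \<Sum>x\<in>Poly_Mapping.keys c.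
                 Poly_Mapping.single (\<sigma> k x) (Poly_Mapping.lookup a k * Poly_Mapping.lookup c x))\<rparr>"

section \<open>Graphs in the sense of Serre\<close>

record ('v, 'e) serre_graph =
  verts :: "'v set"
  edges :: "'e set"
  org :: "'e \<Rightarrow> 'v"
  ter :: "'e \<Rightarrow> 'v"
  opp :: "'e \<Rightarrow> 'e"

locale finite_serre_graph =
  fixes Y :: "('v, 'e) serre_graph"
  assumes finite_verts: "finite (verts Y)"
    and finite_edges: "finite (edges Y)"
    and org_closed: "e \<in> edges Y \<Longrightarrow> org Y e \<in> verts Y"
    and ter_closed: "e \<in> edges Y \<Longrightarrow> ter Y e \<in> verts Y"
    and opp_closed: "e \<in> edges Y \<Longrightarrow> opp Y e \<in> edges Y"
    and opp_opp: "e \<in> edges Y \<Longrightarrow> opp Y (opp Y e) = e"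
    and opp_neq: "e \<in> edges Y \<Longrightarrow> opp Y e \<noteq> e"
    and org_opp: "e \<in> edges Y \<Longrightarrow> org Y (opp Y e) = ter Y e"

definition valency :: "('v, 'e) serre_graph \<Rightarrow> 'v \<Rightarrow> nat" where
  "valency Y w = card {e \<in> edges Y. org Y e = w}"

locale action_without_inversion = finite_serre_graph Y
  for Y :: "('v, 'e) serre_graph" +
  fixes K :: "'g::ab_group_add set"
    and \<sigma>V :: "'g \<Rightarrow> 'v \<Rightarrow> 'v" and \<sigma>E :: "'g \<Rightarrow> 'e \<Rightarrow> 'e"
  assumes action_verts: "group_action (additive_group K) (verts Y) \<sigma>V"
    and action_edges: "group_action (additive_group K) (edges Y) \<sigma>E"
    and org_equivariant: "k \<in> K \<Longrightarrow> e \<in> edges Y \<Longrightarrow> org Y (\<sigma>E k e) = \<sigma>V k (org Y e)"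
    and ter_equivariant: "k \<in> K \<Longrightarrow> e \<in> edges Y \<Longrightarrow> ter Y (\<sigma>E k e) = \<sigma>V k (ter Y e)"
    and opp_equivariant: "k \<in> K \<Longrightarrow> e \<in> edges Y \<Longrightarrow> opp Y (\<sigma>E k e) = \<sigma>E k (opp Y e)"
    and no_inversion: "k \<in> K \<Longrightarrow> e \<in> edges Y \<Longrightarrow> \<sigma>E k e \<noteq> opp Y e"

definition chains0 ::
  "('v, 'e) serre_graph \<Rightarrow> ('g::ab_group_add \<Rightarrow> 'v \<Rightarrow> 'v) \<Rightarrow>
     ('g \<Rightarrow>\<^sub>0 complex, 'v \<Rightarrow>\<^sub>0 complex) module" where
  "chains0 Y \<sigma>V = perm_module (verts Y) \<sigma>V"

definition orientation_relations :: "('v, 'e) serre_graph \<Rightarrow> ('e \<Rightarrow>\<^sub>0 complex) set" where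
  "orientation_relations Y =
     {\<Sum>e\<in>edges Y. Poly_Mapping.single e (z e) + Poly_Mapping.single (opp Y e) (z e) | z. True}"

definition chains1 ::
  "('v, 'e) serre_graph \<Rightarrow> ('g::ab_group_add \<Rightarrow> 'e \<Rightarrow> 'e) \<Rightarrow>
     ('g \<Rightarrow>\<^sub>0 complex, ('e \<Rightarrow>\<^sub>0 complex) set) module" where
  "chains1 Y \<sigma>E = quotient_module (perm_module (edges Y) \<sigma>E) (orientation_relations Y)"

definition adjacency_op ::
  "('v, 'e) serre_graph \<Rightarrow> ('v \<Rightarrow>\<^sub>0 complex) \<Rightarrow> ('v \<Rightarrow>\<^sub>0 complex)" where
  "adjacency_op Y c =
     (\<Sum>w\<in>Poly_Mapping.keys c. \<Sum>e\<in>{e \<in> edges Y. org Y e = w}.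
        Poly_Mapping.single (ter Y e) (Poly_Mapping.lookup c w))"

definition valency_op ::
  "('v, 'e) serre_graph \<Rightarrow> ('v \<Rightarrow>\<^sub>0 complex) \<Rightarrow> ('v \<Rightarrow>\<^sub>0 complex)" where
  "valency_op Y c =
     (\<Sum>w\<in>Poly_Mapping.keys c.
        Poly_Mapping.single w (of_nat (valency Y w) * Poly_Mapping.lookup c w))"

text \<open>The coefficients of \<open>I - A u + (D - I) u\<^sup>2\<close>.\<close>

definition ihara_coeff ::
  "('v, 'e) serre_graph \<Rightarrow> nat \<Rightarrow> ('v \<Rightarrow>\<^sub>0 complex) \<Rightarrow> ('v \<Rightarrow>\<^sub>0 complex)" where
  "ihara_coeff Y i c =
     (if i = 0 then c
      else if i = 1 then - adjacency_op Y c
      else if i = 2 then valency_op Y c - c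
      else 0)"

section \<open>Equivariant Ihara functions and Artin--Ihara L-functions\<close>

definition equiv_euler_char ::
  "'g::ab_group_add set \<Rightarrow> ('v, 'e) serre_graph \<Rightarrow> ('g \<Rightarrow> 'v \<Rightarrow> 'v) \<Rightarrow> ('g \<Rightarrow> 'e \<Rightarrow> 'e) \<Rightarrow>
     ('g \<Rightarrow>\<^sub>0 complex)" where
  "equiv_euler_char K Y \<sigma>V \<sigma>E =
     hs_rank (group_alg K) (chains0 Y \<sigma>V) - hs_rank (group_alg K) (chains1 Y \<sigma>E)"

text \<open>
  The library's \<open>fps_exp 1\<close> and \<open>fps_ln 1\<close>, the series of \<open>exp u\<close> and \<open>log (1 + u)\<close>, are available
  over fields only, hence the passage through \<open>scalar_fps\<close>.
\<close>

definition equiv_gamma ::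
  "'g::ab_group_add set \<Rightarrow> ('v, 'e) serre_graph \<Rightarrow> ('g \<Rightarrow> 'v \<Rightarrow> 'v) \<Rightarrow> ('g \<Rightarrow> 'e \<Rightarrow> 'e) \<Rightarrow>
     ('g \<Rightarrow>\<^sub>0 complex) fps" where
  "equiv_gamma K Y \<sigma>V \<sigma>E =
     fps_compose (scalar_fps (fps_exp 1))
       (- fps_const (equiv_euler_char K Y \<sigma>V \<sigma>E) *
          scalar_fps (fps_compose (fps_ln 1) (- (fps_X ^ 2))))"

definition equiv_eta ::
  "'g::ab_group_add set \<Rightarrow> ('v, 'e) serre_graph \<Rightarrow> ('g \<Rightarrow> 'v \<Rightarrow> 'v) \<Rightarrow>
     ('g \<Rightarrow>\<^sub>0 complex) poly" where
  "equiv_eta K Y \<sigma>V =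
     proj_det (group_alg_poly K) (poly_module (chains0 Y \<sigma>V))
       (series_endo (chains0 Y \<sigma>V) (ihara_coeff Y))"

definition equiv_theta ::
  "'g::ab_group_add set \<Rightarrow> ('v, 'e) serre_graph \<Rightarrow> ('g \<Rightarrow> 'v \<Rightarrow> 'v) \<Rightarrow> ('g \<Rightarrow> 'e \<Rightarrow> 'e) \<Rightarrow>
     ('g \<Rightarrow>\<^sub>0 complex) fps" where
  "equiv_theta K Y \<sigma>V \<sigma>E =
     inv\<^bsub>ring_on (group_alg_fps K)\<^esub>
       (equiv_gamma K Y \<sigma>V \<sigma>E * fps_of_poly (equiv_eta K Y \<sigma>V))"

definition c_fun ::
  "'g::ab_group_add set \<Rightarrow> ('v, 'e) serre_graph \<Rightarrow> ('g \<Rightarrow> 'v \<Rightarrow> 'v) \<Rightarrow> ('g \<Rightarrow> 'e \<Rightarrow> 'e) \<Rightarrow>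
     ('g \<Rightarrow>\<^sub>0 complex, 'm) module \<Rightarrow> complex fps" where
  "c_fun K Y \<sigma>V \<sigma>E V = sigma_rep V (equiv_gamma K Y \<sigma>V \<sigma>E)"

definition h_fun ::
  "'g::ab_group_add set \<Rightarrow> ('v, 'e) serre_graph \<Rightarrow> ('g \<Rightarrow> 'v \<Rightarrow> 'v) \<Rightarrow>
     ('g \<Rightarrow>\<^sub>0 complex, 'm) module \<Rightarrow> complex fps" where
  "h_fun K Y \<sigma>V V = sigma_rep V (fps_of_poly (equiv_eta K Y \<sigma>V))"

definition L_fun ::
  "'g::ab_group_add set \<Rightarrow> ('v, 'e) serre_graph \<Rightarrow> ('g \<Rightarrow> 'v \<Rightarrow> 'v) \<Rightarrow> ('g \<Rightarrow> 'e \<Rightarrow> 'e) \<Rightarrow>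
     ('g \<Rightarrow>\<^sub>0 complex, 'm) module \<Rightarrow> complex fps" where
  "L_fun K Y \<sigma>V \<sigma>E V = sigma_rep V (equiv_theta K Y \<sigma>V \<sigma>E)"

end

theory Submission
  imports Defs
begin

text \<open>
  Characters of the finite abelian groups diagonalise everything. A representation of \<open>K\<close> has a basis
  of simultaneous eigenvectors, so \<open>\<sigma>\<^sub>V(\<Lambda>)\<close> is the product of the values \<open>\<chi>\<^sub>j(\<Lambda>)\<close> at their
  characters, and inducing from \<open>H\<close> to \<open>G\<close> replaces each \<open>\<chi>\<^sub>j\<close> by all its extensions to \<open>G\<close>. It
  therefore suffices that for each character \<open>\<chi>\<close> of \<open>H\<close> the product of \<open>\<psi>(\<gamma>\<^sub>G)\<close>, and of \<open>\<psi>(\<eta>\<^sub>G)\<close>,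
  over the extensions \<open>\<psi>\<close> of \<open>\<chi>\<close> is \<open>\<chi>(\<gamma>\<^sub>H)\<close>, respectively \<open>\<chi>(\<eta>\<^sub>H)\<close>. The chain modules are images
  of explicit idempotent matrices over \<open>\<complex>[K]\<close>. Hence the Euler characteristic at \<open>\<psi>\<close> is the average
  over \<open>K\<close> of \<open>\<psi>\<close> times a fixed point count that does not depend on \<open>K\<close>, while \<open>\<psi>(\<eta>\<^sub>K)\<close> is
  \<open>det (1 + N P\<^sub>\<psi>)\<close>, where \<open>1 + N\<close> is the matrix of the Ihara operator and \<open>P\<^sub>\<psi>\<close> is the isotypic
  projection, which commutes with \<open>N\<close>. The projections of the extensions of \<open>\<chi>\<close> are orthogonal and
  add up to \<open>P\<^sub>\<chi>\<close>.
\<close>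

text \<open>Rank and determinant are definite descriptions over all completions to a free module, so
  a value can be read off only once it is known not to depend on the completion. Two completions
  yield matrices of the shapes PS and SP, or 1 + PS and 1 + SP, and det (1 + PS) = det (1 + SP)
  holds over every commutative ring, in particular over \<complex>[K][u], which in general has zero
  divisors. Averaging is possible because the order of K is invertible in \<complex>; it splits the
  surjection from a free module onto a chain module, and this splitting is the origin of the
  idempotent matrices. Both product formulas rest on one identity: the extensions of \<chi> to G sum
  to |G|/|H| times \<chi> on H and to 0 off H, which turns averages over G into averages over H. For
  \<eta> one also needs (1 + NP)(1 + NQ) = 1 + N(P + Q) when P commutes with N and PQ = 0. The
  series \<gamma>\<eta> is invertible because both factors have constant coefficient 1, and the
  formula for \<theta> follows by cancelling in the domain \<complex>[[u]].\<close>

abbreviation lookup :: "('a \<Rightarrow>\<^sub>0 'b::zero) \<Rightarrow> 'a \<Rightarrow> 'b" where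
  "lookup \<equiv> Poly_Mapping.lookup"

abbreviation single :: "'a \<Rightarrow> 'b::zero \<Rightarrow> 'a \<Rightarrow>\<^sub>0 'b" where
  "single \<equiv> Poly_Mapping.single"

abbreviation keys :: "('a \<Rightarrow>\<^sub>0 'b::zero) \<Rightarrow> 'a set" where
  "keys \<equiv> Poly_Mapping.keys"

section \<open>Determinants and traces over subrings\<close>

text \<open>Expanding along the last row leaves the corner term only. Together with its mirror image
  for columns, this evaluates block triangular determinants with an identity block.\<close>

lemma det_identity_rows:
  fixes A :: "'a::comm_ring_1 mat"
  assumes "A \<in> carrier_mat (n + m) (n + m)"
    and "\<And>i j. n \<le> i \<Longrightarrow> i < n + m \<Longrightarrow> j < n + m \<Longrightarrow> A $$ (i, j) = (if i = j then 1 else 0)"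
  shows "det A = det (mat n n (\<lambda>ij. A $$ ij))"
  using assms
proof (induction m arbitrary: A)
  case 0
  then have "A = mat n n (\<lambda>ij. A $$ ij)" by (intro eq_matI) auto
  then show ?case by simp
next
  case (Suc m)
  let ?k = "n + m"
  have A: "A \<in> carrier_mat (Suc ?k) (Suc ?k)" using Suc.prems(1) by simp
  have "det A = (\<Sum>j<Suc ?k. A $$ (?k, j) * cofactor A ?k j)"
    by (rule laplace_expansion_row[OF A]) simp
  also have "\<dots> = (\<Sum>j<Suc ?k. if j = ?k then cofactor A ?k ?k else 0)"
    using Suc.prems(2)[of ?k] by (intro sum.cong) auto
  also have "\<dots> = cofactor A ?k ?k" by simp
  also have "\<dots> = det (mat_delete A ?k ?k)" by (simp add: cofactor_def)
  also have "\<dots> = det (mat n n (\<lambda>ij. mat_delete A ?k ?k $$ ij))"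
    using A Suc.prems(2)
    by (intro Suc.IH) (auto simp: mat_delete_def)
  also have "mat n n (\<lambda>ij. mat_delete A ?k ?k $$ ij) = mat n n (\<lambda>ij. A $$ ij)"
    using A by (intro eq_matI) (auto simp: mat_delete_def)
  finally show ?case .
qed

lemma det_identity_columns:
  fixes A :: "'a::comm_ring_1 mat"
  assumes "A \<in> carrier_mat (n + m) (n + m)"
    and "\<And>i j. j < n \<Longrightarrow> i < n + m \<Longrightarrow> A $$ (i, j) = (if i = j then 1 else 0)"
  shows "det A = det (mat m m (\<lambda>(i, j). A $$ (n + i, n + j)))"
  using assms
proof (induction n arbitrary: A)
  case 0
  then have "A = mat m m (\<lambda>(i, j). A $$ (0 + i, 0 + j))" by (intro eq_matI) auto
  then show ?case by simp
next
  case (Suc n)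
  have A: "A \<in> carrier_mat (Suc (n + m)) (Suc (n + m))" using Suc.prems(1) by simp
  have "det A = (\<Sum>i<Suc (n + m). A $$ (i, 0) * cofactor A i 0)"
    by (rule laplace_expansion_column[OF A]) simp
  also have "\<dots> = (\<Sum>i<Suc (n + m). if i = 0 then cofactor A 0 0 else 0)"
    using Suc.prems(2)[of 0] by (intro sum.cong) auto
  also have "\<dots> = det (mat_delete A 0 0)" by (simp add: cofactor_def)
  also have "\<dots> = det (mat m m (\<lambda>(i, j). mat_delete A 0 0 $$ (n + i, n + j)))"
    using A Suc.prems(2)
    by (intro Suc.IH) (auto simp: mat_delete_def)
  also have "mat m m (\<lambda>(i, j). mat_delete A 0 0 $$ (n + i, n + j)) =
      mat m m (\<lambda>(i, j). A $$ (Suc n + i, Suc n + j))"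
    using A by (intro eq_matI) (auto simp: mat_delete_def)
  finally show ?case .
qed

text \<open>Sylvester's identity. The blocks are chosen so that \<open>M * L\<close> is block
  triangular with diagonal blocks \<open>1 + P * S\<close> and 1, while \<open>L * M\<close> has
  diagonal blocks 1 and \<open>1 + S * P\<close>; the two products have the same determinant.
  Nothing is inverted.\<close>

lemma det_one_plus_mult_commute:
  fixes P S :: "'a::comm_ring_1 mat"
  assumes P: "P \<in> carrier_mat n m" and S: "S \<in> carrier_mat m n"
  shows "det (1\<^sub>m n + P * S) = det (1\<^sub>m m + S * P)"
proof -
  define M where "M = four_block_mat (1\<^sub>m n) P (- S) (1\<^sub>m m)"
  define L where "L = four_block_mat (1\<^sub>m n) (0\<^sub>m n m) S (1\<^sub>m m)"
  have M: "M \<in> carrier_mat (n + m) (n + m)" and L: "L \<in> carrier_mat (n + m) (n + m)"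
    using P S by (auto simp: M_def L_def)
  have "M * L = four_block_mat (1\<^sub>m n * 1\<^sub>m n + P * S) (1\<^sub>m n * 0\<^sub>m n m + P * 1\<^sub>m m)
      (- S * 1\<^sub>m n + 1\<^sub>m m * S) (- S * 0\<^sub>m n m + 1\<^sub>m m * 1\<^sub>m m)"
    unfolding M_def L_def using P S by (intro mult_four_block_mat) auto
  also have "\<dots> = four_block_mat (1\<^sub>m n + P * S) P (0\<^sub>m m n) (1\<^sub>m m)"
    using P S by (intro cong_four_block_mat) (auto simp: uminus_l_inv_mat)
  finally have prod1: "M * L = \<dots>" .
  have "L * M = four_block_mat (1\<^sub>m n * 1\<^sub>m n + 0\<^sub>m n m * (- S)) (1\<^sub>m n * P + 0\<^sub>m n m * 1\<^sub>m m)
      (S * 1\<^sub>m n + 1\<^sub>m m * (- S)) (S * P + 1\<^sub>m m * 1\<^sub>m m)"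
    unfolding M_def L_def using P S by (intro mult_four_block_mat) auto
  also have "\<dots> = four_block_mat (1\<^sub>m n) P (0\<^sub>m m n) (1\<^sub>m m + S * P)"
    using P S by (intro cong_four_block_mat) (auto simp: comm_add_mat[of "S * P" m m])
  finally have prod2: "L * M = \<dots>" .
  have "det (M * L) = det (mat n n (\<lambda>ij. (M * L) $$ ij))"
    unfolding prod1 using P S by (intro det_identity_rows[where m = m]) auto
  also have "mat n n (\<lambda>ij. (M * L) $$ ij) = 1\<^sub>m n + P * S"
    unfolding prod1 using P S by (intro eq_matI) auto
  finally have 1: "det (M * L) = det (1\<^sub>m n + P * S)" .
  have "det (L * M) = det (mat m m (\<lambda>(i, j). (L * M) $$ (n + i, n + j)))"
    unfolding prod2 using P S by (intro det_identity_columns) auto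
  also have "mat m m (\<lambda>(i, j). (L * M) $$ (n + i, n + j)) = 1\<^sub>m m + S * P"
    unfolding prod2 using P S by (intro eq_matI) auto
  finally have 2: "det (L * M) = det (1\<^sub>m m + S * P)" .
  have "det (M * L) = det (L * M)"
    using M L by (simp add: det_mult mult.commute)
  with 1 2 show ?thesis by simp
qed

lemma trace_mult_commute:
  fixes P S :: "'a::comm_ring_1 mat"
  assumes "P \<in> carrier_mat n m" and "S \<in> carrier_mat m n"
  shows "(\<Sum>i<n. (P * S) $$ (i, i)) = (\<Sum>j<m. (S * P) $$ (j, j))"
proof -
  have "(\<Sum>i<n. (P * S) $$ (i, i)) = (\<Sum>i<n. \<Sum>j<m. P $$ (i, j) * S $$ (j, i))"
    using assms by (intro sum.cong) (auto simp: scalar_prod_def atLeast0LessThan)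
  also have "\<dots> = (\<Sum>j<m. \<Sum>i<n. S $$ (j, i) * P $$ (i, j))"
    by (subst sum.swap) (simp add: mult.commute)
  also have "\<dots> = (\<Sum>j<m. (S * P) $$ (j, j))"
    using assms by (intro sum.cong) (auto simp: scalar_prod_def atLeast0LessThan)
  finally show ?thesis .
qed

text \<open>A ring is a subset of a ring type, so matrices and determinants are computed in the
  type, and what remains to be tracked is that entries stay in \<open>R\<close>. These are the
  closure facts for that.\<close>

locale subring_set =
  fixes R :: "'r::comm_ring_1 set"
  assumes zero_mem [simp, intro]: "0 \<in> R" and one_mem [simp, intro]: "1 \<in> R"
    and add_mem [intro]: "a \<in> R \<Longrightarrow> b \<in> R \<Longrightarrow> a + b \<in> R"
    and mult_mem [intro]: "a \<in> R \<Longrightarrow> b \<in> R \<Longrightarrow> a * b \<in> R"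
    and uminus_mem [intro]: "a \<in> R \<Longrightarrow> - a \<in> R"
begin

lemma diff_mem [intro]: "a \<in> R \<Longrightarrow> b \<in> R \<Longrightarrow> a - b \<in> R"
  using add_mem[of a "- b"] by auto

lemma sum_mem [intro]: "(\<And>i. i \<in> I \<Longrightarrow> f i \<in> R) \<Longrightarrow> sum f I \<in> R"
  by (induction I rule: infinite_finite_induct) auto

lemma prod_mem [intro]: "(\<And>i. i \<in> I \<Longrightarrow> f i \<in> R) \<Longrightarrow> prod f I \<in> R"
  by (induction I rule: infinite_finite_induct) auto

lemma power_mem [intro]: "a \<in> R \<Longrightarrow> a ^ n \<in> R"
  by (induction n) auto

lemma cring_ring_on: "cring (ring_on R)"
proof (rule cringI)
  show "abelian_group (ring_on R)"
  proof (rule abelian_groupI)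
    show "\<exists>y\<in>carrier (ring_on R). y \<oplus>\<^bsub>ring_on R\<^esub> x = \<zero>\<^bsub>ring_on R\<^esub>"
      if "x \<in> carrier (ring_on R)" for x
      using that by (intro bexI[of _ "- x"]) auto
  qed (auto simp: algebra_simps)
  show "comm_monoid (ring_on R)"
    by (rule comm_monoidI) (auto simp: algebra_simps)
qed (auto simp: algebra_simps)

end

lemma subring_set_if_cring:
  assumes "cring (ring_on R)"
  shows "subring_set R"
proof -
  interpret cring "ring_on R" by fact
  show ?thesis
  proof
    show "- a \<in> R" if "a \<in> R" for a
    proof -
      have "\<exists>y\<in>R. a + y = 0"
        using a_inv_closed[of a] r_neg[of a] that by auto
      then show ?thesis by (metis add_eq_0_iff)
    qed
  qed (use a_closed m_closed zero_closed one_closed in auto)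
qed

section \<open>Vectors and matrices with entries in a subring\<close>

definition rvecs :: "'r::comm_ring_1 set \<Rightarrow> nat \<Rightarrow> 'r vec set" where
  "rvecs R n = {v \<in> carrier_vec n. \<forall>i<n. v $ i \<in> R}"

definition rmats :: "'r::comm_ring_1 set \<Rightarrow> nat \<Rightarrow> nat \<Rightarrow> 'r mat set" where
  "rmats R n m = {A \<in> carrier_mat n m. \<forall>i<n. \<forall>j<m. A $$ (i, j) \<in> R}"

lemma rmats_iff_elements:
  "A \<in> rmats R n m \<longleftrightarrow> A \<in> carrier_mat n m \<and> elements_mat A \<subseteq> R"
  by (fastforce simp: rmats_def elements_mat_def subset_iff)

lemma free_module_simps [simp]:
  "carrier (free_module R n) = rvecs R n"
  "zero (free_module R n) = 0\<^sub>v n"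
  "add (free_module R n) = (+)"
  "smult (free_module R n) = (\<cdot>\<^sub>v)"
  by (simp_all add: free_module_def rvecs_def module_vec_def)

lemma direct_sum_simps [simp]:
  "carrier (direct_sum M Q) = carrier M \<times> carrier Q"
  "add (direct_sum M Q) (x, q) (x', q') = (x \<oplus>\<^bsub>M\<^esub> x', q \<oplus>\<^bsub>Q\<^esub> q')"
  "smult (direct_sum M Q) r (x, q) = (r \<odot>\<^bsub>M\<^esub> x, r \<odot>\<^bsub>Q\<^esub> q)"
  by (simp_all add: direct_sum_def)

context subring_set
begin

lemma mult_mat_vec_mem [intro]: "A \<in> rmats R n m \<Longrightarrow> v \<in> rvecs R m \<Longrightarrow> A *\<^sub>v v \<in> rvecs R n"
  by (auto simp: rmats_def rvecs_def scalar_prod_def intro!: sum_mem mult_mem)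

lemma mult_mat_mem [intro]: "A \<in> rmats R n m \<Longrightarrow> B \<in> rmats R m l \<Longrightarrow> A * B \<in> rmats R n l"
  by (auto simp: rmats_def scalar_prod_def intro!: sum_mem mult_mem)

lemma add_vec_mem [intro]: "v \<in> rvecs R n \<Longrightarrow> w \<in> rvecs R n \<Longrightarrow> v + w \<in> rvecs R n"
  by (auto simp: rvecs_def intro!: add_mem)

lemma minus_vec_mem [intro]: "v \<in> rvecs R n \<Longrightarrow> w \<in> rvecs R n \<Longrightarrow> v - w \<in> rvecs R n"
  by (auto simp: rvecs_def intro!: diff_mem)

lemma smult_vec_mem [intro]: "r \<in> R \<Longrightarrow> w \<in> rvecs R n \<Longrightarrow> r \<cdot>\<^sub>v w \<in> rvecs R n"
  by (auto simp: rvecs_def intro!: mult_mem)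

lemma zero_vec_mem [intro, simp]: "0\<^sub>v n \<in> rvecs R n"
  by (auto simp: rvecs_def)

lemma unit_vec_mem [intro]: "i < n \<Longrightarrow> unit_vec n i \<in> rvecs R n"
  by (auto simp: rvecs_def unit_vec_def)

lemma matrix_of_linear_map:
  fixes T :: "'r vec \<Rightarrow> 'r vec"
  assumes T: "\<And>v. v \<in> rvecs R m \<Longrightarrow> T v \<in> rvecs R n"
    and add: "\<And>v w. v \<in> rvecs R m \<Longrightarrow> w \<in> rvecs R m \<Longrightarrow> T (v + w) = T v + T w"
    and smult: "\<And>r v. r \<in> R \<Longrightarrow> v \<in> rvecs R m \<Longrightarrow> T (r \<cdot>\<^sub>v v) = r \<cdot>\<^sub>v T v"
  obtains A where "A \<in> rmats R n m" and "\<And>v. v \<in> rvecs R m \<Longrightarrow> T v = A *\<^sub>v v"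
proof
  define A where "A = mat n m (\<lambda>(i, j). T (unit_vec m j) $ i)"
  show "A \<in> rmats R n m"
    using T[OF unit_vec_mem] by (auto simp: A_def rmats_def rvecs_def)
  fix v assume v: "v \<in> rvecs R m"
  \<comment> \<open>\<open>T\<close> is linear only on vectors over \<open>R\<close>. Truncations of
    \<open>v\<close> are such vectors, so additivity may be applied one coordinate at a
    time.\<close>
  have partial: "T (vec m (\<lambda>i. if i < k then v $ i else 0)) =
      vec n (\<lambda>i. \<Sum>j<k. v $ j * T (unit_vec m j) $ i)" if "k \<le> m" for k
    using that
  proof (induction k)
    case 0
    have zero: "0 \<cdot>\<^sub>v w = 0\<^sub>v k" if "w \<in> rvecs R k" for w k
      using that by (intro eq_vecI) (auto simp: rvecs_def)
    have "T (0 \<cdot>\<^sub>v 0\<^sub>v m) = 0 \<cdot>\<^sub>v T (0\<^sub>v m)" by (rule smult) auto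
    then have "T (0\<^sub>v m) = 0\<^sub>v n"
      using zero[of "0\<^sub>v m" m] zero[OF T[of "0\<^sub>v m"]] by simp
    moreover have "vec m (\<lambda>i. if i < 0 then v $ i else 0) = 0\<^sub>v m" by auto
    ultimately show ?case by auto
  next
    case (Suc k)
    let ?w = "vec m (\<lambda>i. if i < k then v $ i else 0)"
    have w: "?w \<in> rvecs R m" using v by (auto simp: rvecs_def)
    have e: "unit_vec m k \<in> rvecs R m" using Suc.prems by auto
    have vk: "v $ k \<in> R" using v Suc.prems by (auto simp: rvecs_def)
    have "vec m (\<lambda>i. if i < Suc k then v $ i else 0) = ?w + v $ k \<cdot>\<^sub>v unit_vec m k"
      using Suc.prems by (intro eq_vecI) (auto simp: unit_vec_def less_Suc_eq)
    then have "T (vec m (\<lambda>i. if i < Suc k then v $ i else 0)) = T ?w + v $ k \<cdot>\<^sub>v T (unit_vec m k)"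
      using w e vk by (simp add: add smult smult_vec_mem)
    also have "\<dots> = vec n (\<lambda>i. \<Sum>j<Suc k. v $ j * T (unit_vec m j) $ i)"
      using Suc T[OF e] by (intro eq_vecI) (auto simp: rvecs_def)
    finally show ?case .
  qed
  have "vec m (\<lambda>i. if i < m then v $ i else 0) = v"
    using v by (intro eq_vecI) (auto simp: rvecs_def)
  then have "T v = vec n (\<lambda>i. \<Sum>j<m. v $ j * T (unit_vec m j) $ i)"
    using partial[of m] by simp
  also have "\<dots> = A *\<^sub>v v"
    using v by (intro eq_vecI)
      (auto simp: A_def rvecs_def scalar_prod_def mult.commute atLeast0LessThan)
  finally show "T v = A *\<^sub>v v" .
qed

lemma mat_eq_if_mult_vec_eq:
  assumes A: "A \<in> carrier_mat n m" and B: "B \<in> carrier_mat n m"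
    and eq: "\<And>v. v \<in> rvecs R m \<Longrightarrow> A *\<^sub>v v = B *\<^sub>v v"
  shows "A = B"
proof (rule eq_matI)
  fix i j assume "i < dim_row B" "j < dim_col B"
  then have "i < n" "j < m" using B by auto
  have "(A *\<^sub>v unit_vec m j) $ i = (B *\<^sub>v unit_vec m j) $ i"
    using eq[OF unit_vec_mem[OF \<open>j < m\<close>]] by simp
  then show "A $$ (i, j) = B $$ (i, j)"
    using A B \<open>i < n\<close> \<open>j < m\<close> by simp
qed (use A B in auto)

end

context subring_set
begin

lemma minus_one_mat_mem: "A \<in> rmats R n n \<Longrightarrow> A - 1\<^sub>m n \<in> rmats R n n"
  by (auto simp: rmats_def intro!: diff_mem)

lemma one_mat_add_mem: "A \<in> rmats R n n \<Longrightarrow> 1\<^sub>m n + A \<in> rmats R n n"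
  by (auto simp: rmats_def intro!: add_mem)

end

section \<open>Independence of trace and determinant from the free completion\<close>

lemma mult_mat_smult_vec:
  fixes A :: "'a::comm_ring_1 mat"
  assumes "A \<in> carrier_mat n m" and "v \<in> carrier_vec m"
  shows "A *\<^sub>v (r \<cdot>\<^sub>v v) = r \<cdot>\<^sub>v (A *\<^sub>v v)"
  using assms by (intro eq_vecI) (auto simp: scalar_prod_def sum_distrib_left algebra_simps)

lemma mult_mat3_vec:
  fixes A B C :: "'a::comm_ring_1 mat"
  assumes "A \<in> carrier_mat a b" "B \<in> carrier_mat b c" "C \<in> carrier_mat c d" "v \<in> carrier_vec d"
  shows "(A * (B * C)) *\<^sub>v v = A *\<^sub>v (B *\<^sub>v (C *\<^sub>v v))"
  using assms assoc_mult_mat_vec[of A a b "B * C" d v] assoc_mult_mat_vec[of B b c C d v] by simp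

lemma free_completion_subring:
  assumes "free_completion R M Q n \<theta>"
  shows "subring_set R"
proof -
  interpret M: Module.module "ring_on R" M using assms by (simp add: free_completion_def)
  show ?thesis by (rule subring_set_if_cring) (rule M.R.cring_axioms)
qed

text \<open>
  Two completions \<open>M \<oplus> Q \<cong> R\<close>\<open>^n\<close> and \<open>M \<oplus> Q' \<cong> R\<close>\<open>^m\<close> yield matrices \<open>B\<close> and \<open>C\<close> of the maps
  between \<open>R\<close>\<open>^n\<close> and \<open>R\<close>\<open>^m\<close> that are the identity on \<open>M\<close> and vanish on the complements.
  If \<open>D\<close> and \<open>D'\<close> are the matrices of \<open>\<delta>\<close> extended by zero, then \<open>D = (C D') B\<close> and
  \<open>D' = B (C D')\<close>.
\<close>

lemma completion_factorisation:
  fixes R :: "'r::comm_ring_1 set"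
  assumes c: "free_completion R M Q n \<theta>" and c': "free_completion R M Q' m \<theta>'"
    and \<delta>: "\<And>x. x \<in> carrier M \<Longrightarrow> \<delta> x \<in> carrier M"
    and D: "D \<in> rmats R n n" and D': "D' \<in> rmats R m m"
    and eq: "\<And>x q. x \<in> carrier M \<Longrightarrow> q \<in> carrier Q \<Longrightarrow> D *\<^sub>v \<theta> (x, q) = \<theta> (\<delta> x, \<zero>\<^bsub>Q\<^esub>)"
    and eq': "\<And>x q. x \<in> carrier M \<Longrightarrow> q \<in> carrier Q' \<Longrightarrow> D' *\<^sub>v \<theta>' (x, q) = \<theta>' (\<delta> x, \<zero>\<^bsub>Q'\<^esub>)"
  obtains P S where "P \<in> carrier_mat n m" and "S \<in> carrier_mat m n" and "D = P * S" and "D' = S * P"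
proof -
  interpret subring_set R by (rule free_completion_subring[OF c])
  have mat_of_comparison: "\<exists>B \<in> rmats R k l. \<forall>x \<in> carrier M. \<forall>q \<in> carrier Q1. B *\<^sub>v \<eta> (x, q) = \<zeta> (x, \<zero>\<^bsub>Q2\<^esub>)"
    if c1: "free_completion R M Q1 l \<eta>" and c2: "free_completion R M Q2 k \<zeta>" for Q1 l \<eta> Q2 k \<zeta>
  proof -
    interpret M: Module.module "ring_on R" M using c1 by (simp add: free_completion_def)
    interpret Q1: Module.module "ring_on R" Q1 using c1 by (simp add: free_completion_def)
    interpret Q2: Module.module "ring_on R" Q2 using c2 by (simp add: free_completion_def)
    have hom1: "\<eta> \<in> module_hom (ring_on R) (direct_sum M Q1) (free_module R l)"
      and bij1: "bij_betw \<eta> (carrier M \<times> carrier Q1) (rvecs R l)"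
      and hom2: "\<zeta> \<in> module_hom (ring_on R) (direct_sum M Q2) (free_module R k)"
      using c1 c2 by (simp_all add: free_completion_def)
    have \<eta>_add: "\<eta> (x \<oplus>\<^bsub>M\<^esub> x', q \<oplus>\<^bsub>Q1\<^esub> q') = \<eta> (x, q) + \<eta> (x', q')"
      if "x \<in> carrier M" "x' \<in> carrier M" "q \<in> carrier Q1" "q' \<in> carrier Q1" for x x' q q'
      using hom1 that by (auto simp: LinearCombinations.module_hom_def)
    have \<eta>_smult: "\<eta> (r \<odot>\<^bsub>M\<^esub> x, r \<odot>\<^bsub>Q1\<^esub> q) = r \<cdot>\<^sub>v \<eta> (x, q)"
      if "x \<in> carrier M" "q \<in> carrier Q1" "r \<in> R" for x q r
      using hom1 that by (auto simp: LinearCombinations.module_hom_def)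
    have \<zeta>_add: "\<zeta> (x \<oplus>\<^bsub>M\<^esub> x', q \<oplus>\<^bsub>Q2\<^esub> q') = \<zeta> (x, q) + \<zeta> (x', q')"
      if "x \<in> carrier M" "x' \<in> carrier M" "q \<in> carrier Q2" "q' \<in> carrier Q2" for x x' q q'
      using hom2 that by (auto simp: LinearCombinations.module_hom_def)
    have \<zeta>_smult: "\<zeta> (r \<odot>\<^bsub>M\<^esub> x, r \<odot>\<^bsub>Q2\<^esub> q) = r \<cdot>\<^sub>v \<zeta> (x, q)"
      if "x \<in> carrier M" "q \<in> carrier Q2" "r \<in> R" for x q r
      using hom2 that by (auto simp: LinearCombinations.module_hom_def)
    \<comment> \<open>The projection of the free module onto \<open>M\<close> along the complement
      \<open>Q1\<close>.\<close>
    define \<pi> where "\<pi> v = fst (inv_into (carrier M \<times> carrier Q1) \<eta> v)" for v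
    have \<pi>: "\<pi> (\<eta> (x, q)) = x" if "x \<in> carrier M" "q \<in> carrier Q1" for x q
      using bij1 that by (simp add: \<pi>_def bij_betw_def inv_into_f_f)
    have cases: "\<exists>x q. x \<in> carrier M \<and> q \<in> carrier Q1 \<and> v = \<eta> (x, q)" if "v \<in> rvecs R l" for v
      using that unfolding bij_betw_imp_surj_on[OF bij1, symmetric] by auto
    define T where "T v = \<zeta> (\<pi> v, \<zero>\<^bsub>Q2\<^esub>)" for v
    have T: "T (\<eta> (x, q)) = \<zeta> (x, \<zero>\<^bsub>Q2\<^esub>)" if "x \<in> carrier M" "q \<in> carrier Q1" for x q
      using that by (simp add: T_def \<pi>)
    obtain B where B: "B \<in> rmats R k l" "\<And>v. v \<in> rvecs R l \<Longrightarrow> T v = B *\<^sub>v v"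
    proof (rule matrix_of_linear_map[of l T k])
      show "T v \<in> rvecs R k" if v: "v \<in> rvecs R l" for v
      proof -
        from cases[OF v] obtain x q where xq: "x \<in> carrier M" "q \<in> carrier Q1" "v = \<eta> (x, q)" by blast
        have "\<zeta> \<in> carrier M \<times> carrier Q2 \<rightarrow> rvecs R k" using hom2 by (simp add: LinearCombinations.module_hom_def)
        with xq T show ?thesis by (auto simp: Pi_iff)
      qed
      show "T (v + w) = T v + T w" if v: "v \<in> rvecs R l" and w: "w \<in> rvecs R l" for v w
      proof -
        from cases[OF v] obtain x q where xq: "x \<in> carrier M" "q \<in> carrier Q1" "v = \<eta> (x, q)" by blast
        from cases[OF w] obtain y p where yp: "y \<in> carrier M" "p \<in> carrier Q1" "w = \<eta> (y, p)" by blast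
        have "T (v + w) = \<zeta> (x \<oplus>\<^bsub>M\<^esub> y, \<zero>\<^bsub>Q2\<^esub>)"
          using xq yp by (simp add: \<eta>_add[symmetric] T)
        also have "\<dots> = \<zeta> (x, \<zero>\<^bsub>Q2\<^esub>) + \<zeta> (y, \<zero>\<^bsub>Q2\<^esub>)"
          using \<zeta>_add[of x y "\<zero>\<^bsub>Q2\<^esub>" "\<zero>\<^bsub>Q2\<^esub>"] xq yp by simp
        also have "\<dots> = T v + T w" using xq yp by (simp add: T)
        finally show ?thesis .
      qed
      show "T (r \<cdot>\<^sub>v v) = r \<cdot>\<^sub>v T v" if r: "r \<in> R" and v: "v \<in> rvecs R l" for r v
      proof -
        from cases[OF v] obtain x q where xq: "x \<in> carrier M" "q \<in> carrier Q1" "v = \<eta> (x, q)" by blast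
        have "T (r \<cdot>\<^sub>v v) = \<zeta> (r \<odot>\<^bsub>M\<^esub> x, \<zero>\<^bsub>Q2\<^esub>)"
          using xq r M.smult_closed[of r x] Q1.smult_closed[of r q]
          by (simp add: \<eta>_smult[symmetric] T)
        also have "\<dots> = r \<cdot>\<^sub>v \<zeta> (x, \<zero>\<^bsub>Q2\<^esub>)"
          using \<zeta>_smult[of x "\<zero>\<^bsub>Q2\<^esub>" r] xq r Q2.smult_r_null[of r] by simp
        finally show ?thesis using xq by (simp add: T)
      qed
    qed blast
    have "\<eta> (x, q) \<in> rvecs R l" if "x \<in> carrier M" "q \<in> carrier Q1" for x q
      using bij1 that by (auto simp: bij_betw_def)
    then have "B *\<^sub>v \<eta> (x, q) = \<zeta> (x, \<zero>\<^bsub>Q2\<^esub>)" if "x \<in> carrier M" "q \<in> carrier Q1" for x q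
      using B(2)[of "\<eta> (x, q)"] T[OF that] that by simp
    with B(1) show ?thesis by blast
  qed
  have cases: "\<exists>x q. x \<in> carrier M \<and> q \<in> carrier Q1 \<and> v = \<eta> (x, q)"
    if "free_completion R M Q1 l \<eta>" "v \<in> rvecs R l" for Q1 l \<eta> v
  proof -
    have im: "\<eta> ` (carrier M \<times> carrier Q1) = rvecs R l"
      using that(1) by (simp add: free_completion_def bij_betw_def)
    show ?thesis using that(2) unfolding im[symmetric] by auto
  qed
  have zQ: "\<zero>\<^bsub>Q1\<^esub> \<in> carrier Q1" if "free_completion R M Q1 l \<eta>" for Q1 l \<eta>
  proof -
    interpret Q1: Module.module "ring_on R" Q1 using that by (simp add: free_completion_def)
    show ?thesis by simp
  qed
  obtain B where B: "B \<in> rmats R m n"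
    and B_eq: "\<And>x q. x \<in> carrier M \<Longrightarrow> q \<in> carrier Q \<Longrightarrow> B *\<^sub>v \<theta> (x, q) = \<theta>' (x, \<zero>\<^bsub>Q'\<^esub>)"
    using mat_of_comparison[OF c c'] by blast
  obtain C where C: "C \<in> rmats R n m"
    and C_eq: "\<And>x q. x \<in> carrier M \<Longrightarrow> q \<in> carrier Q' \<Longrightarrow> C *\<^sub>v \<theta>' (x, q) = \<theta> (x, \<zero>\<^bsub>Q\<^esub>)"
    using mat_of_comparison[OF c' c] by blast
  have carr: "B \<in> carrier_mat m n" "C \<in> carrier_mat n m" "D \<in> carrier_mat n n" "D' \<in> carrier_mat m m"
    using B C D D' by (auto simp: rmats_def)
  show thesis
  proof (rule that[of "C * D'" B])
    show "D = (C * D') * B"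
    proof (rule mat_eq_if_mult_vec_eq)
      fix v assume v: "v \<in> rvecs R n"
      from cases[OF c this] obtain x q where xq: "x \<in> carrier M" "q \<in> carrier Q" "v = \<theta> (x, q)"
        by blast
      have "v \<in> carrier_vec n" using v by (simp add: rvecs_def)
      then have "(C * D') * B *\<^sub>v v = C *\<^sub>v (D' *\<^sub>v (B *\<^sub>v v))"
        using carr mult_mat3_vec[of C n m D' m B n v] by simp
      also have "\<dots> = \<theta> (\<delta> x, \<zero>\<^bsub>Q\<^esub>)"
        using xq \<delta> zQ[OF c'] by (simp add: B_eq C_eq eq')
      finally show "D *\<^sub>v v = (C * D') * B *\<^sub>v v" using xq eq by simp
    qed (use carr in auto)
    \<comment> \<open>\<open>B * C\<close> need not be the identity matrix, but it fixes every
      \<theta>'(x, 0), and \<open>D'\<close> takes values in this part only.\<close>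
    show "D' = B * (C * D')"
    proof (rule mat_eq_if_mult_vec_eq)
      fix v assume v: "v \<in> rvecs R m"
      from cases[OF c' this] obtain x q where xq: "x \<in> carrier M" "q \<in> carrier Q'" "v = \<theta>' (x, q)"
        by blast
      have "v \<in> carrier_vec m" using v by (simp add: rvecs_def)
      then have "B * (C * D') *\<^sub>v v = B *\<^sub>v (C *\<^sub>v (D' *\<^sub>v v))"
        using carr mult_mat3_vec[of B m n C m D' m v] by simp
      also have "\<dots> = \<theta>' (\<delta> x, \<zero>\<^bsub>Q'\<^esub>)"
        using xq \<delta> zQ[OF c'] zQ[OF c] by (simp add: B_eq C_eq eq')
      finally show "D' *\<^sub>v v = B * (C * D') *\<^sub>v v" using xq eq' by simp
    qed (use carr in auto)
  qed (use carr in auto)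
qed

text \<open>Resolves the definite description: the matrices from two completions are
  \<open>P * S\<close> and \<open>S * P\<close>, which have the same trace, so one explicit
  completion suffices.\<close>

lemma proj_trace_eqI:
  assumes c: "free_completion R M Q n \<theta>"
    and A: "matrix_of_endo R M Q n \<theta> (\<lambda>(x, q). (\<phi> x, \<zero>\<^bsub>Q\<^esub>)) A"
    and \<phi>: "\<And>x. x \<in> carrier M \<Longrightarrow> \<phi> x \<in> carrier M"
  shows "proj_trace R M \<phi> = (\<Sum>i<n. A $$ (i, i))"
  unfolding proj_trace_def
proof (rule the_equality)
  show "\<exists>Q k \<theta> A'. free_completion R M Q k \<theta> \<and>
      matrix_of_endo R M Q k \<theta> (\<lambda>(x, q). (\<phi> x, \<zero>\<^bsub>Q\<^esub>)) A' \<and>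
      (\<Sum>i<n. A $$ (i, i)) = (\<Sum>i<k. A' $$ (i, i))"
    using c A by blast
next
  fix d
  assume "\<exists>Q n \<theta> A. free_completion R M Q n \<theta> \<and>
      matrix_of_endo R M Q n \<theta> (\<lambda>(x, q). (\<phi> x, \<zero>\<^bsub>Q\<^esub>)) A \<and> d = (\<Sum>i<n. A $$ (i, i))"
  then obtain Q' m \<theta>' A' where c': "free_completion R M Q' m \<theta>'"
    and A': "matrix_of_endo R M Q' m \<theta>' (\<lambda>(x, q). (\<phi> x, \<zero>\<^bsub>Q'\<^esub>)) A'"
    and d: "d = (\<Sum>i<m. A' $$ (i, i))" by blast
  obtain P S where "P \<in> carrier_mat n m" "S \<in> carrier_mat m n" "A = P * S" "A' = S * P"
  proof (rule completion_factorisation[OF c c', of \<phi> A A'])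
    show "A *\<^sub>v \<theta> (x, q) = \<theta> (\<phi> x, \<zero>\<^bsub>Q\<^esub>)" if "x \<in> carrier M" "q \<in> carrier Q" for x q
      using A that by (force simp: matrix_of_endo_def)
    show "A' *\<^sub>v \<theta>' (x, q) = \<theta>' (\<phi> x, \<zero>\<^bsub>Q'\<^esub>)" if "x \<in> carrier M" "q \<in> carrier Q'" for x q
      using A' that by (force simp: matrix_of_endo_def)
  qed (use A A' \<phi> in \<open>simp_all add: matrix_of_endo_def rmats_iff_elements\<close>)
  then show "d = (\<Sum>i<n. A $$ (i, i))" using trace_mult_commute[of P n m S] d by metis
qed

text \<open>The factorisation concerns maps extended by zero, whereas the determinant extends \<phi>
  by the identity. Hence it is applied to \<phi> - id with the matrices \<open>A - 1\<close> and
  \<open>A' - 1\<close>, and Sylvester's identity compares the determinants.\<close>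

lemma proj_det_eqI:
  assumes c: "free_completion R M Q n \<theta>"
    and A: "matrix_of_endo R M Q n \<theta> (\<lambda>(x, q). (\<phi> x, q)) A"
    and \<phi>: "\<And>x. x \<in> carrier M \<Longrightarrow> \<phi> x \<in> carrier M"
  shows "proj_det R M \<phi> = det A"
  unfolding proj_det_def
proof (rule the_equality)
  show "\<exists>Q n \<theta> A'. free_completion R M Q n \<theta> \<and>
      matrix_of_endo R M Q n \<theta> (\<lambda>(x, q). (\<phi> x, q)) A' \<and> det A = det A'"
    using c A by blast
next
  interpret subring_set R by (rule free_completion_subring[OF c])
  interpret M: Module.module "ring_on R" M using c by (simp add: free_completion_def)
  fix d
  assume "\<exists>Q n \<theta> A. free_completion R M Q n \<theta> \<and>
      matrix_of_endo R M Q n \<theta> (\<lambda>(x, q). (\<phi> x, q)) A \<and> d = det A"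
  then obtain Q' m \<theta>' A' where c': "free_completion R M Q' m \<theta>'"
    and A': "matrix_of_endo R M Q' m \<theta>' (\<lambda>(x, q). (\<phi> x, q)) A'"
    and d: "d = det A'" by blast
  have mem: "B - 1\<^sub>m k \<in> rmats R k k" if "matrix_of_endo R M Q1 k \<eta> \<psi> B" for Q1 k \<eta> \<psi> B
    using that by (intro minus_one_mat_mem) (simp add: matrix_of_endo_def rmats_iff_elements)
  have eq: "(B - 1\<^sub>m k) *\<^sub>v \<eta> (x, q) = \<eta> (\<phi> x \<ominus>\<^bsub>M\<^esub> x, \<zero>\<^bsub>Q1\<^esub>)"
    if c1: "free_completion R M Q1 k \<eta>"
      and B: "matrix_of_endo R M Q1 k \<eta> (\<lambda>(x, q). (\<phi> x, q)) B"
      and x: "x \<in> carrier M" and q: "q \<in> carrier Q1" for Q1 k \<eta> B x q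
  proof -
    interpret Q1: Module.module "ring_on R" Q1 using c1 by (simp add: free_completion_def)
    have hom: "\<eta> \<in> module_hom (ring_on R) (direct_sum M Q1) (free_module R k)"
      using c1 by (simp add: free_completion_def)
    have "\<eta> (\<phi> x \<ominus>\<^bsub>M\<^esub> x, \<zero>\<^bsub>Q1\<^esub>) + \<eta> (x, q) =
        \<eta> ((\<phi> x \<ominus>\<^bsub>M\<^esub> x) \<oplus>\<^bsub>M\<^esub> x, \<zero>\<^bsub>Q1\<^esub> \<oplus>\<^bsub>Q1\<^esub> q)"
      using LinearCombinations.module_hom_add[OF hom, of "(\<phi> x \<ominus>\<^bsub>M\<^esub> x, \<zero>\<^bsub>Q1\<^esub>)" "(x, q)"] x q \<phi> by simp
    also have "(\<phi> x \<ominus>\<^bsub>M\<^esub> x) \<oplus>\<^bsub>M\<^esub> x = \<phi> x"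
      using x \<phi> by (simp add: M.minus_eq M.a_assoc M.l_neg)
    finally have sum: "\<eta> (\<phi> x \<ominus>\<^bsub>M\<^esub> x, \<zero>\<^bsub>Q1\<^esub>) + \<eta> (x, q) = B *\<^sub>v \<eta> (x, q)"
      using B x q by (auto simp: matrix_of_endo_def)
    have v: "\<eta> (\<phi> x \<ominus>\<^bsub>M\<^esub> x, \<zero>\<^bsub>Q1\<^esub>) \<in> carrier_vec k" "\<eta> (x, q) \<in> carrier_vec k"
      using hom x q \<phi> by (auto simp: LinearCombinations.module_hom_def Pi_iff rvecs_def)
    have "(B - 1\<^sub>m k) *\<^sub>v \<eta> (x, q) = B *\<^sub>v \<eta> (x, q) - \<eta> (x, q)"
      using B v by (subst minus_mult_distrib_mat_vec) (auto simp: matrix_of_endo_def)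
    also have "\<dots> = \<eta> (\<phi> x \<ominus>\<^bsub>M\<^esub> x, \<zero>\<^bsub>Q1\<^esub>)"
      unfolding sum[symmetric] using v by (intro eq_vecI) auto
    finally show ?thesis .
  qed
  obtain P S where PS: "P \<in> carrier_mat n m" "S \<in> carrier_mat m n"
      "A - 1\<^sub>m n = P * S" "A' - 1\<^sub>m m = S * P"
  proof (rule completion_factorisation[OF c c', of "\<lambda>x. \<phi> x \<ominus>\<^bsub>M\<^esub> x"])
    show "\<phi> x \<ominus>\<^bsub>M\<^esub> x \<in> carrier M" if "x \<in> carrier M" for x
      using that \<phi> by simp
  qed (rule mem[OF A] mem[OF A'] eq[OF c A] eq[OF c' A']; assumption)+
  have "A = 1\<^sub>m n + (A - 1\<^sub>m n)" "A' = 1\<^sub>m m + (A' - 1\<^sub>m m)"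
    using A A' by (auto simp: matrix_of_endo_def intro!: eq_matI)
  then have "A = 1\<^sub>m n + P * S" "A' = 1\<^sub>m m + S * P"
    using PS by simp_all
  then show "d = det A" using det_one_plus_mult_commute[OF PS(1,2)] d by simp
qed

text \<open>
  Presents \<open>M\<close> as the image of the idempotent matrix \<open>E\<close>; the operations of \<open>M\<close> inherit the module
  axioms from those of vectors, so these need not be assumed.
\<close>

locale projective_embedding = subring_set R
  for R :: "'r::comm_ring_1 set" +
  fixes M :: "('r, 'm) module" and n :: nat and i :: "'m \<Rightarrow> 'r vec" and E :: "'r mat"
  assumes zero_carrier: "\<zero>\<^bsub>M\<^esub> \<in> carrier M"
    and add_carrier: "x \<in> carrier M \<Longrightarrow> y \<in> carrier M \<Longrightarrow> x \<oplus>\<^bsub>M\<^esub> y \<in> carrier M"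
    and smult_carrier: "r \<in> R \<Longrightarrow> x \<in> carrier M \<Longrightarrow> r \<odot>\<^bsub>M\<^esub> x \<in> carrier M"
    and emb_mem: "x \<in> carrier M \<Longrightarrow> i x \<in> rvecs R n"
    and emb_inj: "x \<in> carrier M \<Longrightarrow> y \<in> carrier M \<Longrightarrow> i x = i y \<Longrightarrow> x = y"
    and emb_add: "x \<in> carrier M \<Longrightarrow> y \<in> carrier M \<Longrightarrow> i (x \<oplus>\<^bsub>M\<^esub> y) = i x + i y"
    and emb_zero: "i \<zero>\<^bsub>M\<^esub> = 0\<^sub>v n"
    and emb_smult: "r \<in> R \<Longrightarrow> x \<in> carrier M \<Longrightarrow> i (r \<odot>\<^bsub>M\<^esub> x) = r \<cdot>\<^sub>v i x"
    and E_mem: "E \<in> rmats R n n"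
    and E_emb: "x \<in> carrier M \<Longrightarrow> E *\<^sub>v i x = i x"
    and E_image: "v \<in> rvecs R n \<Longrightarrow> E *\<^sub>v v \<in> i ` carrier M"
begin

lemma emb_carrier_vec: "x \<in> carrier M \<Longrightarrow> i x \<in> carrier_vec n"
  using emb_mem by (simp add: rvecs_def)

lemma module_of_emb: "module (ring_on R) M"
proof (rule moduleI)
  show "cring (ring_on R)" by (rule cring_ring_on)
  have neg: "\<exists>y\<in>carrier M. y \<oplus>\<^bsub>M\<^esub> x = \<zero>\<^bsub>M\<^esub>" if x: "x \<in> carrier M" for x
  proof (rule bexI[of _ "(-1) \<odot>\<^bsub>M\<^esub> x"], rule emb_inj)
    show "i ((-1) \<odot>\<^bsub>M\<^esub> x \<oplus>\<^bsub>M\<^esub> x) = i \<zero>\<^bsub>M\<^esub>"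
      using x emb_carrier_vec[OF x]
      by (auto simp: emb_add emb_smult smult_carrier uminus_mem emb_zero intro!: eq_vecI)
  qed (use x in \<open>auto intro!: add_carrier smult_carrier zero_carrier\<close>)
  show "abelian_group M"
  proof (rule abelian_groupI)
    fix x y z assume xyz: "x \<in> carrier M" "y \<in> carrier M" "z \<in> carrier M"
    show "x \<oplus>\<^bsub>M\<^esub> y \<oplus>\<^bsub>M\<^esub> z = x \<oplus>\<^bsub>M\<^esub> (y \<oplus>\<^bsub>M\<^esub> z)"
      using xyz emb_carrier_vec[OF xyz(1)] emb_carrier_vec[OF xyz(2)] emb_carrier_vec[OF xyz(3)]
      by (intro emb_inj) (auto simp: emb_add add_carrier)
  next
    fix x y assume xy: "x \<in> carrier M" "y \<in> carrier M"
    show "x \<oplus>\<^bsub>M\<^esub> y = y \<oplus>\<^bsub>M\<^esub> x"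
      using xy emb_carrier_vec[OF xy(1)] emb_carrier_vec[OF xy(2)]
      by (intro emb_inj) (auto simp: emb_add add_carrier comm_add_vec[of "i x" n])
  next
    fix x assume x: "x \<in> carrier M"
    show "\<zero>\<^bsub>M\<^esub> \<oplus>\<^bsub>M\<^esub> x = x"
      using x emb_carrier_vec[OF x]
      by (intro emb_inj) (auto simp: emb_add add_carrier zero_carrier emb_zero)
  qed (use neg in \<open>auto intro: add_carrier zero_carrier\<close>)
  fix r x assume r: "r \<in> carrier (ring_on R)" and x: "x \<in> carrier M"
  from r have r': "r \<in> R" by simp
  note v = emb_carrier_vec[OF x]
  show "r \<odot>\<^bsub>M\<^esub> x \<in> carrier M" using r' x by (rule smult_carrier)
  show "r \<odot>\<^bsub>M\<^esub> (x \<oplus>\<^bsub>M\<^esub> y) = r \<odot>\<^bsub>M\<^esub> x \<oplus>\<^bsub>M\<^esub> r \<odot>\<^bsub>M\<^esub> y" if y: "y \<in> carrier M" for y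
    using r' x y v emb_carrier_vec[OF y]
    by (intro emb_inj) (auto simp: emb_add emb_smult add_carrier smult_carrier smult_add_distrib_vec)
  fix s assume s: "s \<in> carrier (ring_on R)"
  then have s': "s \<in> R" by simp
  show "(r \<oplus>\<^bsub>ring_on R\<^esub> s) \<odot>\<^bsub>M\<^esub> x = r \<odot>\<^bsub>M\<^esub> x \<oplus>\<^bsub>M\<^esub> s \<odot>\<^bsub>M\<^esub> x"
    using r' s' x v
    by (intro emb_inj) (auto simp: emb_add emb_smult add_carrier smult_carrier add_mem add_smult_distrib_vec)
  show "(r \<otimes>\<^bsub>ring_on R\<^esub> s) \<odot>\<^bsub>M\<^esub> x = r \<odot>\<^bsub>M\<^esub> (s \<odot>\<^bsub>M\<^esub> x)"
    using r' s' x v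
    by (intro emb_inj) (auto simp: emb_add emb_smult add_carrier smult_carrier mult_mem smult_smult_assoc)
next
  fix x assume x: "x \<in> carrier M"
  show "\<one>\<^bsub>ring_on R\<^esub> \<odot>\<^bsub>M\<^esub> x = x"
    using x emb_carrier_vec[OF x]
    by (intro emb_inj) (auto simp: emb_smult smult_carrier)
qed

text \<open>The complement of \<open>M\<close> in the free module: \<open>E\<close> is a projection
  onto the embedded \<open>M\<close>, so its kernel completes it. It consists of vectors over
  \<open>R\<close>, the kind of complement that a completion asks for.\<close>

definition ker_E :: "('r, 'r vec) module" where
  "ker_E = (free_module R n)\<lparr>carrier := {v \<in> rvecs R n. E *\<^sub>v v = 0\<^sub>v n}\<rparr>"

lemma ker_E_simps [simp]:
  "carrier ker_E = {v \<in> rvecs R n. E *\<^sub>v v = 0\<^sub>v n}"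
  "zero ker_E = 0\<^sub>v n" "add ker_E = (+)" "smult ker_E = (\<cdot>\<^sub>v)"
  by (simp_all add: ker_E_def)

lemma E_carrier: "E \<in> carrier_mat n n"
  using E_mem by (simp add: rmats_def)

lemma module_ker_E: "module (ring_on R) ker_E"
proof -
  have carr: "v \<in> carrier_vec n" if "v \<in> rvecs R n" for v using that by (simp add: rvecs_def)
  have add: "v + w \<in> carrier ker_E" if "v \<in> carrier ker_E" "w \<in> carrier ker_E" for v w
    using that E_carrier carr by (auto simp: mult_add_distrib_mat_vec[OF E_carrier])
  have smult: "r \<cdot>\<^sub>v v \<in> carrier ker_E" if "r \<in> R" "v \<in> carrier ker_E" for r v
    using that E_carrier carr by (auto simp: mult_mat_smult_vec[OF E_carrier] smult_vec_mem)
  have neg: "\<exists>w\<in>carrier ker_E. w + v = 0\<^sub>v n" if "v \<in> carrier ker_E" for v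
  proof (rule bexI)
    show "(-1) \<cdot>\<^sub>v v + v = 0\<^sub>v n" using that carr[of v] by (intro eq_vecI) auto
  qed (rule smult[OF uminus_mem[OF one_mem] that])
  show ?thesis
  proof (rule moduleI)
    show "cring (ring_on R)" by (rule cring_ring_on)
    show "abelian_group ker_E"
    proof (rule abelian_groupI)
      fix v w assume vw: "v \<in> carrier ker_E" "w \<in> carrier ker_E"
      have v: "v \<in> carrier_vec n" and w: "w \<in> carrier_vec n" using vw carr by auto
      show "v \<oplus>\<^bsub>ker_E\<^esub> w \<in> carrier ker_E" using add[OF vw] by simp
      show "v \<oplus>\<^bsub>ker_E\<^esub> w = w \<oplus>\<^bsub>ker_E\<^esub> v" using comm_add_vec[OF v w] by simp
      show "v \<oplus>\<^bsub>ker_E\<^esub> w \<oplus>\<^bsub>ker_E\<^esub> u = v \<oplus>\<^bsub>ker_E\<^esub> (w \<oplus>\<^bsub>ker_E\<^esub> u)" if "u \<in> carrier ker_E" for u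
        using assoc_add_vec[OF v w, of u] that carr[of u] by simp
    next
      fix v assume "v \<in> carrier ker_E"
      then show "\<zero>\<^bsub>ker_E\<^esub> \<oplus>\<^bsub>ker_E\<^esub> v = v" using carr[of v] by simp
    next
      show "\<zero>\<^bsub>ker_E\<^esub> \<in> carrier ker_E" using E_carrier by (auto intro!: eq_vecI)
    next
      fix v assume "v \<in> carrier ker_E"
      then show "\<exists>w\<in>carrier ker_E. w \<oplus>\<^bsub>ker_E\<^esub> v = \<zero>\<^bsub>ker_E\<^esub>"
        using neg[of v] by simp
    qed
    fix r v assume "r \<in> carrier (ring_on R)" "v \<in> carrier ker_E"
    with smult show "r \<odot>\<^bsub>ker_E\<^esub> v \<in> carrier ker_E" by auto
  qed (auto simp: carr smult_add_distrib_vec[of _ n] add_smult_distrib_vec smult_smult_assoc)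
qed

definition \<Theta> :: "'m \<times> 'r vec \<Rightarrow> 'r vec" where
  "\<Theta> = (\<lambda>(x, q). i x + q)"

text \<open>\<open>E\<close> recovers \<open>i x\<close> from \<open>i x + q\<close>, which gives
  injectivity; surjectivity is the decomposition v = Ev + (v - Ev).\<close>

lemma completion: "free_completion R M ker_E n \<Theta>"
proof -
  have carr: "v \<in> carrier_vec n" if "v \<in> rvecs R n" for v using that by (simp add: rvecs_def)
  have E_\<Theta>: "E *\<^sub>v (i x + q) = i x" if "x \<in> carrier M" "q \<in> carrier ker_E" for x q
    using that E_carrier emb_carrier_vec[of x] carr
    by (simp add: mult_add_distrib_mat_vec[OF E_carrier] E_emb)
  have "inj_on \<Theta> (carrier M \<times> carrier ker_E)"
  proof (rule inj_onI, clarsimp simp only: \<Theta>_def mem_Sigma_iff case_prod_conv)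
    fix x q y p
    assume h: "x \<in> carrier M" "q \<in> carrier ker_E" "y \<in> carrier M" "p \<in> carrier ker_E"
      "i x + q = i y + p"
    have "i x = i y" using E_\<Theta>[OF h(1,2)] E_\<Theta>[OF h(3,4)] h(5) by simp
    then have "x = y" using h emb_inj by blast
    moreover have "q = p"
    proof (rule eq_vecI)
      fix j assume "j < dim_vec p"
      then have "j < n" using h by (auto simp: rvecs_def)
      have "(i x + q) $ j = (i x + p) $ j" using h(5) \<open>x = y\<close> by simp
      moreover have "q \<in> carrier_vec n" "p \<in> carrier_vec n" using h by (auto simp: rvecs_def)
      ultimately show "q $ j = p $ j" using \<open>j < n\<close> emb_carrier_vec[OF h(1)] by simp
    qed (use h in \<open>auto simp: rvecs_def\<close>)
    ultimately show "x = y \<and> q = p" by simp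
  qed
  moreover have "\<Theta> ` (carrier M \<times> carrier ker_E) = rvecs R n"
  proof
    show "\<Theta> ` (carrier M \<times> carrier ker_E) \<subseteq> rvecs R n"
      using emb_mem by (auto simp: \<Theta>_def)
    show "rvecs R n \<subseteq> \<Theta> ` (carrier M \<times> carrier ker_E)"
    proof
      fix v assume v: "v \<in> rvecs R n"
      from E_image[OF v] obtain x where x: "x \<in> carrier M" "E *\<^sub>v v = i x" by auto
      have "E *\<^sub>v (v - i x) = 0\<^sub>v n"
        using x v carr emb_carrier_vec[OF x(1)]
        by (simp add: mult_minus_distrib_mat_vec[OF E_carrier] E_emb)
      then have "v - i x \<in> carrier ker_E" using v x emb_mem by auto
      moreover have "\<Theta> (x, v - i x) = v"
        using carr[OF v] emb_carrier_vec[OF x(1)] by (auto simp: \<Theta>_def intro!: eq_vecI)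
      ultimately show "v \<in> \<Theta> ` (carrier M \<times> carrier ker_E)"
        using x by (metis SigmaI image_eqI)
    qed
  qed
  ultimately have bij: "bij_betw \<Theta> (carrier (direct_sum M ker_E)) (carrier (free_module R n))"
    by (simp add: bij_betw_def)
  have "\<Theta> \<in> module_hom (ring_on R) (direct_sum M ker_E) (free_module R n)"
    unfolding LinearCombinations.module_hom_def
  proof (safe, goal_cases)
    case (1 z)
    then show ?case using bij by (auto simp: bij_betw_def)
  next
    case (2 x q x' q')
    then have "i x \<in> carrier_vec n" "i x' \<in> carrier_vec n" "q \<in> carrier_vec n" "q' \<in> carrier_vec n"
      using emb_carrier_vec carr by auto
    with 2 show ?case by (auto simp: \<Theta>_def emb_add intro!: eq_vecI)
  next
    case (3 r x q)
    then have "i x \<in> carrier_vec n" "q \<in> carrier_vec n"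
      using emb_carrier_vec carr by auto
    with 3 show ?case by (auto simp: \<Theta>_def emb_smult smult_add_distrib_vec)
  qed
  with bij show ?thesis
    unfolding free_completion_def using module_of_emb module_ker_E by blast
qed

context
  fixes \<phi> :: "'m \<Rightarrow> 'm" and B :: "'r mat"
  assumes \<phi>_mem: "\<And>x. x \<in> carrier M \<Longrightarrow> \<phi> x \<in> carrier M"
    and B_mem: "B \<in> rmats R n n"
    and B_emb: "\<And>x. x \<in> carrier M \<Longrightarrow> B *\<^sub>v i x = i (\<phi> x)"
begin

lemma BE_\<Theta>:
  assumes x: "x \<in> carrier M" and q: "q \<in> carrier ker_E"
  shows "(B * E) *\<^sub>v (i x + q) = i (\<phi> x)"
proof -
  have B: "B \<in> carrier_mat n n" using B_mem by (simp add: rmats_def)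
  have q': "q \<in> carrier_vec n" using q by (simp add: rvecs_def)
  have "E *\<^sub>v (i x + q) = i x"
    using x q q' emb_carrier_vec[OF x] by (simp add: mult_add_distrib_mat_vec[OF E_carrier] E_emb)
  then show ?thesis
    using x B q' E_carrier emb_carrier_vec[OF x]
    by (simp add: assoc_mult_mat_vec[where n\<^sub>2 = n] B_emb)
qed

text \<open>\<open>B\<close> is pinned down on the image of \<open>M\<close> only. Composing with
  \<open>E\<close> removes the remaining freedom: \<open>B * E\<close> is \<phi> on that image and
  zero on the kernel of \<open>E\<close>.\<close>

lemma proj_trace_emb: "proj_trace R M \<phi> = (\<Sum>j<n. (B * E) $$ (j, j))"
proof (rule proj_trace_eqI[OF completion _ \<phi>_mem])
  have "B * E \<in> rmats R n n" using B_mem E_mem by auto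
  then show "matrix_of_endo R M ker_E n \<Theta> (\<lambda>(x, q). (\<phi> x, \<zero>\<^bsub>ker_E\<^esub>)) (B * E)"
    unfolding matrix_of_endo_def
    using BE_\<Theta> emb_carrier_vec[OF \<phi>_mem] by (auto simp: \<Theta>_def rmats_iff_elements)
qed

text \<open>The matrix on the right acts as \<phi> on the image of \<open>E\<close> and as the
  identity on its kernel.\<close>

lemma proj_det_emb: "proj_det R M \<phi> = det (1\<^sub>m n + (B - 1\<^sub>m n) * E)"
proof (rule proj_det_eqI[OF completion _ \<phi>_mem])
  have B: "B \<in> carrier_mat n n" using B_mem by (simp add: rmats_def)
  have BI: "B - 1\<^sub>m n \<in> rmats R n n" by (rule minus_one_mat_mem[OF B_mem])
  have mem: "1\<^sub>m n + (B - 1\<^sub>m n) * E \<in> rmats R n n"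
    by (rule one_mat_add_mem[OF mult_mat_mem[OF BI E_mem]])
  have "(1\<^sub>m n + (B - 1\<^sub>m n) * E) *\<^sub>v (i x + q) = i (\<phi> x) + q"
    if x: "x \<in> carrier M" and q: "q \<in> carrier ker_E" for x q
  proof -
    have q': "q \<in> carrier_vec n" using q by (simp add: rvecs_def)
    have E_eq: "E *\<^sub>v (i x + q) = i x"
      using x q q' emb_carrier_vec[OF x] by (simp add: mult_add_distrib_mat_vec[OF E_carrier] E_emb)
    have v: "i x + q \<in> carrier_vec n" using q' emb_carrier_vec[OF x] by simp
    have "(1\<^sub>m n + (B - 1\<^sub>m n) * E) *\<^sub>v (i x + q) = (i x + q) + ((B - 1\<^sub>m n) * E) *\<^sub>v (i x + q)"
      using v B E_carrier by (subst add_mult_distrib_mat_vec[where nr = n and nc = n]) auto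
    also have "((B - 1\<^sub>m n) * E) *\<^sub>v (i x + q) = (B - 1\<^sub>m n) *\<^sub>v (E *\<^sub>v (i x + q))"
      by (rule assoc_mult_mat_vec[of _ n n _ n]) (use v B E_carrier in auto)
    also have "\<dots> = (B - 1\<^sub>m n) *\<^sub>v i x" by (simp only: E_eq)
    also have "\<dots> = i (\<phi> x) - i x"
      using B emb_carrier_vec[OF x] x
      by (subst minus_mult_distrib_mat_vec[where nr = n and nc = n]) (auto simp: B_emb)
    also have "(i x + q) + (i (\<phi> x) - i x) = i (\<phi> x) + q"
      using q' emb_carrier_vec[OF x] emb_carrier_vec[OF \<phi>_mem[OF x]] by (intro eq_vecI) auto
    finally show ?thesis .
  qed
  then show "matrix_of_endo R M ker_E n \<Theta> (\<lambda>(x, q). (\<phi> x, q)) (1\<^sub>m n + (B - 1\<^sub>m n) * E)"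
    using mem by (auto simp: matrix_of_endo_def \<Theta>_def rmats_iff_elements)
qed

end

end

section \<open>Characters of finite abelian groups\<close>

locale finite_add_group =
  fixes K :: "'g::ab_group_add set"
  assumes finite_K [simp, intro]: "finite K" and zero_K [simp, intro]: "0 \<in> K"
    and add_K [intro]: "g \<in> K \<Longrightarrow> h \<in> K \<Longrightarrow> g + h \<in> K"
    and uminus_K [intro]: "g \<in> K \<Longrightarrow> - g \<in> K"
begin

lemma diff_K [intro]: "g \<in> K \<Longrightarrow> h \<in> K \<Longrightarrow> g - h \<in> K"
  using add_K[of g "- h"] by auto

lemma card_K_pos: "card K > 0"
  using zero_K by (auto simp: card_gt_0_iff)

lemma K_nonempty [simp]: "K \<noteq> {}"
  using zero_K by blast

lemma bij_betw_translate: "g \<in> K \<Longrightarrow> bij_betw (\<lambda>k. g + k) K K"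
  by (rule bij_betw_byWitness[where f' = "\<lambda>k. k - g"]) auto

end

text \<open>Extensionality makes a character determined by its values on \<open>K\<close>, so that
  the set is finite and a sum over it counts each character once.\<close>

definition chars :: "'g::ab_group_add set \<Rightarrow> ('g \<Rightarrow> complex) set" where
  "chars K = {\<psi> \<in> extensional K. \<psi> 0 = 1 \<and> (\<forall>g\<in>K. \<forall>h\<in>K. \<psi> (g + h) = \<psi> g * \<psi> h)}"

definition ev :: "'g::ab_group_add set \<Rightarrow> ('g \<Rightarrow> complex) \<Rightarrow> ('g \<Rightarrow>\<^sub>0 complex) \<Rightarrow> complex" where
  "ev K \<psi> a = (\<Sum>k\<in>K. lookup a k * \<psi> k)"

lemma lookup_single_mult:
  fixes b :: "'g::ab_group_add \<Rightarrow>\<^sub>0 'c::comm_ring_1"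
  shows "lookup (single g c * b) k = c * lookup b (k - g)"
proof -
  have "k = l + q \<longleftrightarrow> q = k - l" for l q :: 'g by (auto simp: algebra_simps)
  then have "lookup (single g c * b) k =
      (\<Sum>l. (c when g = l) * (\<Sum>q. lookup b q when q = k - l))"
    by (simp add: lookup_mult lookup_single)
  also have "\<dots> = (\<Sum>l. (c * lookup b (k - l) when g = l))"
    by (simp add: when_mult)
  also have "\<dots> = c * lookup b (k - g)"
    by simp
  finally show ?thesis .
qed

lemma group_alg_iff: "a \<in> group_alg K \<longleftrightarrow> (\<forall>k. k \<notin> K \<longrightarrow> lookup a k = 0)"
  by (auto simp: group_alg_def in_keys_iff)

lemma poly_mapping_expansion:
  assumes "finite K" and "a \<in> group_alg K"
  shows "a = (\<Sum>k\<in>K. single k (lookup a k))"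
proof (rule poly_mapping_eqI)
  fix x
  have "lookup (\<Sum>k\<in>K. single k (lookup a k)) x =
      (\<Sum>k\<in>K. if k = x then lookup a x else 0)"
    by (auto simp: lookup_sum lookup_single when_def intro!: sum.cong)
  also have "\<dots> = lookup a x"
    using assms by (auto simp: group_alg_iff)
  finally show "lookup a x =
      lookup (\<Sum>k\<in>K. single k (lookup a k)) x" ..
qed

context finite_add_group
begin

lemma lookup_group_alg_mult:
  assumes "a \<in> group_alg K"
  shows "lookup (a * b) k = (\<Sum>g\<in>K. lookup a g * lookup b (k - g))"
proof -
  have "lookup (a * b) k =
      lookup ((\<Sum>g\<in>K. single g (lookup a g)) * b) k"
    using poly_mapping_expansion[OF finite_K assms] by simp
  also have "\<dots> = (\<Sum>g\<in>K. lookup a g * lookup b (k - g))"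
    by (simp add: sum_distrib_right lookup_sum lookup_single_mult)
  finally show ?thesis .
qed

lemma group_alg_subring: "subring_set (group_alg K)"
proof
  fix a b assume a: "a \<in> group_alg K" and b: "b \<in> group_alg K"
  have "k - g \<notin> K" if "k \<notin> K" "g \<in> K" for k g
    using that add_K[of "k - g" g] by auto
  then show "a * b \<in> group_alg K"
    using a b by (auto simp: group_alg_iff lookup_group_alg_mult[OF a])
qed (auto simp: group_alg_iff lookup_one lookup_add when_def)

sublocale A: subring_set "group_alg K" by (rule group_alg_subring)

lemma single_mem [intro]: "k \<in> K \<Longrightarrow> single k c \<in> group_alg K"
  by (auto simp: group_alg_iff lookup_single when_def)

lemma scalar_mem [simp, intro]: "scalar c \<in> group_alg K"
  by (rule single_mem) simp

section \<open>Orthogonality of characters and existence of enough characters\<close>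

lemma char_mult: "\<psi> \<in> chars K \<Longrightarrow> g \<in> K \<Longrightarrow> h \<in> K \<Longrightarrow> \<psi> (g + h) = \<psi> g * \<psi> h"
  by (simp add: chars_def)

lemma char_zero: "\<psi> \<in> chars K \<Longrightarrow> \<psi> 0 = 1"
  by (simp add: chars_def)

lemma char_uminus: "\<psi> \<in> chars K \<Longrightarrow> g \<in> K \<Longrightarrow> \<psi> g * \<psi> (- g) = 1"
  using char_mult[of \<psi> g "- g"] uminus_K[of g] by (simp add: char_zero)

lemma char_nonzero: "\<psi> \<in> chars K \<Longrightarrow> g \<in> K \<Longrightarrow> \<psi> g \<noteq> 0"
  using char_uminus by force

lemma char_eqI:
  "\<psi> \<in> chars K \<Longrightarrow> \<phi> \<in> chars K \<Longrightarrow> (\<And>g. g \<in> K \<Longrightarrow> \<psi> g = \<phi> g) \<Longrightarrow> \<psi> = \<phi>"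
  by (auto simp: chars_def intro: extensionalityI)

lemma char_power_card:
  assumes \<psi>: "\<psi> \<in> chars K" and g: "g \<in> K"
  shows "\<psi> g ^ card K = 1"
proof -
  have "prod \<psi> K = (\<Prod>k\<in>K. \<psi> (g + k))"
    by (rule prod.reindex_bij_betw[OF bij_betw_translate[OF g], symmetric])
  also have "\<dots> = \<psi> g ^ card K * prod \<psi> K"
    using \<psi> g by (simp add: char_mult prod.distrib)
  finally show ?thesis using char_nonzero[OF \<psi>] by simp
qed

lemma chars_subset: "chars K \<subseteq> K \<rightarrow>\<^sub>E {z. z ^ card K = 1}"
  using char_power_card by (auto simp: PiE_def chars_def)

lemma finite_chars [simp, intro]: "finite (chars K)"
proof (rule finite_subset[OF chars_subset])
  show "finite (K \<rightarrow>\<^sub>E {z :: complex. z ^ card K = 1})"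
    using finite_roots_unity[of "card K"] card_K_pos by (intro finite_PiE) auto
qed

lemma char_orthogonality:
  assumes \<psi>: "\<psi> \<in> chars K" and \<phi>: "\<phi> \<in> chars K"
  shows "(\<Sum>g\<in>K. \<psi> g * \<phi> (- g)) = (if \<psi> = \<phi> then of_nat (card K) else 0)"
proof (cases "\<psi> = \<phi>")
  case True
  then show ?thesis using \<psi> by (simp add: char_uminus)
next
  case False
  then obtain h where h: "h \<in> K" "\<psi> h \<noteq> \<phi> h" using char_eqI[OF \<psi> \<phi>] by blast
  let ?S = "\<Sum>g\<in>K. \<psi> g * \<phi> (- g)"
  have "?S = (\<Sum>g\<in>K. \<psi> (h + g) * \<phi> (- (h + g)))"
    by (rule sum.reindex_bij_betw[OF bij_betw_translate[OF h(1)], symmetric])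
  also have "\<dots> = (\<Sum>g\<in>K. (\<psi> h * \<phi> (- h)) * (\<psi> g * \<phi> (- g)))"
  proof (rule sum.cong)
    fix g assume g: "g \<in> K"
    have "\<phi> (- (h + g)) = \<phi> (- h) * \<phi> (- g)"
      using char_mult[OF \<phi>, of "- h" "- g"] h(1) g by (auto simp: algebra_simps)
    then show "\<psi> (h + g) * \<phi> (- (h + g)) = (\<psi> h * \<phi> (- h)) * (\<psi> g * \<phi> (- g))"
      using char_mult[OF \<psi> h(1) g] by simp
  qed simp
  also have "\<dots> = (\<psi> h * \<phi> (- h)) * ?S" by (rule sum_distrib_left[symmetric])
  finally have "?S = (\<psi> h * \<phi> (- h)) * ?S" .
  moreover have "\<psi> h * \<phi> (- h) \<noteq> 1"
    using char_uminus[OF \<phi> h(1)] h(2) char_nonzero[OF \<phi> uminus_K[OF h(1)]] by (metis mult_right_cancel)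
  ultimately have "?S = 0" by simp
  then show ?thesis using False by simp
qed

text \<open>
  For each \<open>g\<close> the idempotents \<open>e g c\<close> of the cyclic group generated by \<open>g\<close> sum to \<open>1\<close>. Expanding
  the product over all \<open>g\<close> writes \<open>1\<close> as a sum of simultaneous eigenvectors, and a nonzero
  simultaneous eigenvector determines a character.
\<close>

lemma delta_combination_of_chars:
  "\<exists>\<alpha>. \<forall>g\<in>K. (\<Sum>\<psi>\<in>chars K. \<alpha> \<psi> * \<psi> g) = (if g = 0 then 1 else 0)"
proof -
  define N where "N = card K"
  have N: "N > 0" using card_K_pos by (simp add: N_def)
  define U where "U = {z :: complex. z ^ N = 1}"
  have fin_U: "finite U" using N finite_roots_unity[of N] by (simp add: U_def)
  \<comment> \<open>There are only \<open>j < N\<close> roots of unity of exponent \<open>j\<close>,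
    so some \<open>w\<close> in \<open>U\<close> has \<open>w ^ j \<noteq> 1\<close>. Multiplication
    by \<open>w\<close> permutes \<open>U\<close> and multiplies the sum by
    \<open>w ^ j\<close>.\<close>
  have sum_U: "(\<Sum>c\<in>U. c ^ j) = 0" if j: "0 < j" "j < N" for j
  proof -
    have "\<not> U \<subseteq> {z. z ^ j = 1}"
    proof
      assume "U \<subseteq> {z. z ^ j = 1}"
      then have "card U \<le> card {z :: complex. z ^ j = 1}"
        using j by (intro card_mono finite_roots_unity) auto
      then show False using card_roots_unity_eq[of N] card_roots_unity_eq[of j] j by (simp add: U_def)
    qed
    then obtain w where w: "w \<in> U" "w ^ j \<noteq> 1" by auto
    have "w \<noteq> 0" using w N by (auto simp: U_def power_0_left)
    have "bij_betw (\<lambda>c. w * c) U U"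
      by (rule bij_betw_byWitness[where f' = "\<lambda>c. c / w"])
        (use w \<open>w \<noteq> 0\<close> in \<open>auto simp: U_def power_mult_distrib power_divide\<close>)
    from sum.reindex_bij_betw[OF this, of "\<lambda>c. c ^ j"]
    have "(\<Sum>c\<in>U. c ^ j) = w ^ j * (\<Sum>c\<in>U. c ^ j)"
      by (simp add: power_mult_distrib sum_distrib_left)
    with w show ?thesis by simp
  qed
  define T :: "'g \<Rightarrow> 'g \<Rightarrow>\<^sub>0 complex" where "T g = single g 1" for g
  have T_mult: "T g * T h = T (g + h)" for g h by (simp add: T_def mult_single)
  have T_power_N: "T g ^ N = 1" if g: "g \<in> K" for g
  proof -
    have "prod T K = (\<Prod>k\<in>K. T (g + k))"
      by (rule prod.reindex_bij_betw[OF bij_betw_translate[OF g], symmetric])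
    also have "\<dots> = T g ^ N * prod T K"
      by (simp add: T_mult[symmetric] prod.distrib N_def)
    finally have eq: "prod T K = T g ^ N * prod T K" .
    \<comment> \<open>The group algebra can have zero divisors, so the product over \<open>K\<close>
      is cancelled by means of an explicit inverse.\<close>
    have inv: "prod T K * (\<Prod>k\<in>K. T (- k)) = 1"
      by (simp add: prod.distrib[symmetric] T_mult) (simp add: T_def)
    have "1 = T g ^ N * (prod T K * (\<Prod>k\<in>K. T (- k)))"
      using eq inv by (metis mult.assoc)
    with inv show ?thesis by simp
  qed
  \<comment> \<open>A geometric sum fixed by multiplication with \<open>scalar c * T g\<close>, that
    is, the projection onto the eigenspace of \<open>T g\<close> for 1/c. The inverse has the effect
    that the coefficient function of \<open>E c\<close> is multiplied by \<open>c g\<close> itself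
    under translation by \<open>g\<close>, see \<open>shift\<close>.\<close>
  define e where "e g c = scalar (1 / of_nat N) * (\<Sum>j<N. (scalar c * T g) ^ j)" for g :: 'g and c
  have sc_power: "(scalar c :: 'g \<Rightarrow>\<^sub>0 complex) ^ j = scalar (c ^ j)" for c j
    by (induction j) (auto simp: mult_single)
  have sc_sum: "(\<Sum>i\<in>I. (scalar (f i) :: 'g \<Rightarrow>\<^sub>0 complex)) = scalar (sum f I)" for f and I :: "'x set"
    by (induction I rule: infinite_finite_induct) (auto simp: single_add)
  have e_eigen: "scalar c * T g * e g c = e g c" if "g \<in> K" "c \<in> U" for g c
  proof -
    let ?X = "scalar c * T g"
    have "?X ^ N = 1"
      using that T_power_N[of g] by (simp add: power_mult_distrib sc_power U_def)
    then have "(?X - 1) * (\<Sum>j<N. ?X ^ j) = 0"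
      using power_diff_1_eq[of ?X N] by (simp add: mult.commute)
    then have "?X * (\<Sum>j<N. ?X ^ j) = (\<Sum>j<N. ?X ^ j)"
      by (simp add: algebra_simps)
    then show ?thesis unfolding e_def by (metis mult.left_commute)
  qed
  have e_sum: "(\<Sum>c\<in>U. e g c) = 1" for g
  proof -
    have "(\<Sum>c\<in>U. e g c) = scalar (1 / of_nat N) * (\<Sum>j<N. scalar (\<Sum>c\<in>U. c ^ j) * T g ^ j)"
      by (simp add: e_def sum_distrib_left[symmetric] power_mult_distrib sc_power
          sum_distrib_right sc_sum[symmetric] sum.swap[of _ _ U])
    also have "(\<Sum>j<N. scalar (\<Sum>c\<in>U. c ^ j) * T g ^ j) =
        (\<Sum>j<N. if j = 0 then scalar (of_nat N) else 0)"
    proof (rule sum.cong)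
      fix j assume "j \<in> {..<N}"
      then show "scalar (\<Sum>c\<in>U. c ^ j) * T g ^ j = (if j = 0 then scalar (of_nat N) else 0)"
        using sum_U[of j] N card_roots_unity_eq[of N] by (cases "j = 0") (auto simp: U_def)
    qed simp
    also have "\<dots> = scalar (of_nat N)" using N by simp
    also have "scalar (1 / of_nat N) * scalar (of_nat N) = (1 :: 'g \<Rightarrow>\<^sub>0 complex)"
      using N unfolding mult_single by simp
    finally show ?thesis .
  qed
  define E where "E c = (\<Prod>g\<in>K. e g (c g))" for c
  have E_sum: "(\<Sum>c\<in>K \<rightarrow>\<^sub>E U. E c) = 1"
    using prod_sum_PiE[of K "\<lambda>_. U" e] fin_U by (simp add: E_def e_sum)
  have E_eigen: "scalar (c g) * T g * E c = E c" if "c \<in> K \<rightarrow>\<^sub>E U" "g \<in> K" for c g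
  proof -
    have "E c = e g (c g) * (\<Prod>h\<in>K - {g}. e h (c h))"
      using that by (simp add: E_def prod.remove[of K g])
    moreover have "scalar (c g) * T g * e g (c g) = e g (c g)"
      using that by (intro e_eigen) auto
    ultimately show ?thesis by (metis mult.assoc)
  qed
  define \<alpha> where "\<alpha> c = lookup (E c) 0" for c
  have shift: "lookup (E c) (h + g) = c g * lookup (E c) h"
    if "c \<in> K \<rightarrow>\<^sub>E U" "g \<in> K" for c g h
  proof -
    have "lookup (E c) (h + g) =
        lookup (single g (c g) * E c) (h + g)"
      using E_eigen[OF that] by (simp add: T_def mult_single)
    then show ?thesis by (simp add: lookup_single_mult)
  qed
  have lookup_E: "lookup (E c) g = \<alpha> c * c g" if "c \<in> K \<rightarrow>\<^sub>E U" "g \<in> K" for c g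
    using shift[OF that, of 0] by (simp add: \<alpha>_def)
  \<comment> \<open>On \<open>K\<close> the coefficients of \<open>E c\<close> are
    \<open>\<alpha> c\<close> times \<open>c\<close>. If \<open>\<alpha> c \<noteq> 0\<close>,
    translating twice shows that \<open>c\<close> is multiplicative; all other families drop out of
    the sum.\<close>
  have \<alpha>_char: "c \<in> chars K" if c: "c \<in> K \<rightarrow>\<^sub>E U" and nz: "\<alpha> c \<noteq> 0" for c
  proof -
    have "c 0 = 1" using lookup_E[OF c zero_K] nz by (simp add: \<alpha>_def)
    moreover have "c (g + h) = c g * c h" if g: "g \<in> K" and h: "h \<in> K" for g h
      using shift[OF c h, of g] lookup_E[OF c g] lookup_E[OF c add_K[OF g h]] nz by simp
    ultimately show ?thesis using c by (auto simp: chars_def PiE_def)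
  qed
  have "(\<Sum>\<psi>\<in>chars K. \<alpha> \<psi> * \<psi> g) = (if g = 0 then 1 else 0)" if g: "g \<in> K" for g
  proof -
    have "(\<Sum>\<psi>\<in>chars K. \<alpha> \<psi> * \<psi> g) = (\<Sum>c\<in>K \<rightarrow>\<^sub>E U. \<alpha> c * c g)"
      using chars_subset fin_U \<alpha>_char
      by (intro sum.mono_neutral_left) (auto simp: U_def N_def finite_PiE)
    also have "\<dots> = lookup (\<Sum>c\<in>K \<rightarrow>\<^sub>E U. E c) g"
      using g by (simp add: lookup_sum lookup_E)
    also have "\<dots> = (if g = 0 then 1 else 0)" by (simp add: E_sum lookup_one when_def)
    finally show ?thesis .
  qed
  then show ?thesis by blast
qed

text \<open>Column orthogonality. Pairing the combination of characters that gives the delta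
  function with a character \<phi> forces the coefficient of \<phi> to be 1/|K|, so the delta
  function is the mean of all characters. At \<open>g = 0\<close> this says that there are exactly
  |K| of them.\<close>

lemma sum_chars:
  assumes "g \<in> K"
  shows "(\<Sum>\<psi>\<in>chars K. \<psi> g) = (if g = 0 then of_nat (card K) else 0)"
proof -
  obtain \<alpha> where \<alpha>: "\<And>g. g \<in> K \<Longrightarrow> (\<Sum>\<psi>\<in>chars K. \<alpha> \<psi> * \<psi> g) = (if g = 0 then 1 else 0)"
    using delta_combination_of_chars by blast
  have "\<alpha> \<phi> * of_nat (card K) = 1" if \<phi>: "\<phi> \<in> chars K" for \<phi>
  proof -
    have "1 = (\<Sum>g\<in>K. (if g = 0 then 1 else 0) * \<phi> (- g))"
      using char_zero[OF \<phi>] by (simp add: if_distrib[of "\<lambda>x. x * _"] cong: if_cong)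
    also have "\<dots> = (\<Sum>g\<in>K. \<Sum>\<psi>\<in>chars K. \<alpha> \<psi> * (\<psi> g * \<phi> (- g)))"
      using \<alpha> by (intro sum.cong) (auto simp: sum_distrib_right[symmetric] mult.assoc[symmetric])
    also have "\<dots> = (\<Sum>\<psi>\<in>chars K. \<alpha> \<psi> * (\<Sum>g\<in>K. \<psi> g * \<phi> (- g)))"
      by (subst sum.swap) (simp add: sum_distrib_left)
    also have "\<dots> = (\<Sum>\<psi>\<in>chars K. if \<psi> = \<phi> then \<alpha> \<phi> * of_nat (card K) else 0)"
      using \<phi> by (intro sum.cong) (auto simp: char_orthogonality)
    also have "\<dots> = \<alpha> \<phi> * of_nat (card K)" using \<phi> by simp
    finally show ?thesis ..
  qed
  then have "(\<Sum>\<psi>\<in>chars K. \<psi> g) = (\<Sum>\<psi>\<in>chars K. of_nat (card K) * (\<alpha> \<psi> * \<psi> g))"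
    by (intro sum.cong) (auto simp: mult.assoc[symmetric] mult.commute[of "of_nat _"])
  also have "\<dots> = of_nat (card K) * (\<Sum>\<psi>\<in>chars K. \<alpha> \<psi> * \<psi> g)"
    by (simp add: sum_distrib_left)
  finally show ?thesis using \<alpha>[OF assms] by simp
qed

subsection \<open>Evaluation of characters on group algebras\<close>

lemma ev_zero [simp]: "ev K \<psi> 0 = 0"
  by (simp add: ev_def)

lemma ev_add: "ev K \<psi> (a + b) = ev K \<psi> a + ev K \<psi> b"
  by (simp add: ev_def lookup_add algebra_simps sum.distrib)

lemma ev_uminus: "ev K \<psi> (- a) = - ev K \<psi> a"
  by (simp add: ev_def sum_negf)

lemma ev_diff: "ev K \<psi> (a - b) = ev K \<psi> a - ev K \<psi> b"
  by (simp add: ev_def lookup_minus algebra_simps sum_subtractf)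

lemma ev_sum: "ev K \<psi> (sum f I) = (\<Sum>i\<in>I. ev K \<psi> (f i))"
  by (induction I rule: infinite_finite_induct) (auto simp: ev_add)

lemma ev_single: "k \<in> K \<Longrightarrow> ev K \<psi> (single k c) = c * \<psi> k"
  by (simp add: ev_def lookup_single when_def if_distrib[of "\<lambda>x. x * _"] cong: if_cong)

lemma ev_scalar: "\<psi> \<in> chars K \<Longrightarrow> ev K \<psi> (scalar c) = c"
  by (simp add: ev_single char_zero)

lemma ev_one: "\<psi> \<in> chars K \<Longrightarrow> ev K \<psi> 1 = 1"
  using ev_scalar[of \<psi> 1] by simp

lemma ev_mult:
  assumes \<psi>: "\<psi> \<in> chars K" and a: "a \<in> group_alg K" and b: "b \<in> group_alg K"
  shows "ev K \<psi> (a * b) = ev K \<psi> a * ev K \<psi> b"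
proof -
  have shift: "(\<Sum>k\<in>K. lookup b (k - g) * \<psi> k) = \<psi> g * ev K \<psi> b" if g: "g \<in> K" for g
  proof -
    have "(\<Sum>k\<in>K. lookup b (k - g) * \<psi> k) =
        (\<Sum>k\<in>K. lookup b (g + k - g) * \<psi> (g + k))"
      by (rule sum.reindex_bij_betw[OF bij_betw_translate[OF g], symmetric])
    also have "\<dots> = \<psi> g * ev K \<psi> b"
      using g by (simp add: char_mult[OF \<psi>] ev_def sum_distrib_left mult_ac)
    finally show ?thesis .
  qed
  have "ev K \<psi> (a * b) =
      (\<Sum>g\<in>K. lookup a g * (\<Sum>k\<in>K. lookup b (k - g) * \<psi> k))"
    unfolding ev_def lookup_group_alg_mult[OF a]
    by (simp add: sum_distrib_right sum_distrib_left mult.assoc) (rule sum.swap)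
  also have "\<dots> = (\<Sum>g\<in>K. lookup a g * \<psi> g) * ev K \<psi> b"
    by (simp add: shift sum_distrib_right mult.assoc)
  finally show ?thesis by (simp add: ev_def)
qed

text \<open>The primitive idempotent of the group algebra belonging to \<psi>, with the inverse
  value \<open>\<psi> (- k)\<close> in the role of the complex conjugate.\<close>

definition idem :: "('g \<Rightarrow> complex) \<Rightarrow> 'g \<Rightarrow>\<^sub>0 complex" where
  "idem \<psi> = (\<Sum>k\<in>K. single k (\<psi> (- k) / of_nat (card K)))"

lemma idem_mem [intro]: "idem \<psi> \<in> group_alg K"
  unfolding idem_def by (intro A.sum_mem single_mem)

lemma lookup_idem: "k \<in> K \<Longrightarrow> lookup (idem \<psi>) k = \<psi> (- k) / of_nat (card K)"
  by (simp add: idem_def lookup_sum lookup_single when_def)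

lemma sum_idem: "(\<Sum>\<psi>\<in>chars K. idem \<psi>) = 1"
proof (rule poly_mapping_eqI)
  fix k
  have mem: "(\<Sum>\<psi>\<in>chars K. idem \<psi>) \<in> group_alg K" by (intro A.sum_mem idem_mem)
  show "lookup (\<Sum>\<psi>\<in>chars K. idem \<psi>) k = lookup 1 k"
  proof (cases "k \<in> K")
    case True
    then show ?thesis
      using sum_chars[OF uminus_K[OF True]]
      by (simp add: lookup_sum lookup_idem sum_divide_distrib[symmetric] lookup_one when_def)
  next
    case False
    then show ?thesis using mem zero_K by (auto simp: group_alg_iff lookup_one when_def)
  qed
qed

text \<open>The source of eigenvectors: on the component of a module cut out by
  \<open>idem \<psi>\<close>, every element of the group algebra acts through its value at
  \<psi>.\<close>

lemma mult_idem:
  assumes \<psi>: "\<psi> \<in> chars K" and a: "a \<in> group_alg K"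
  shows "a * idem \<psi> = scalar (ev K \<psi> a) * idem \<psi>"
proof (rule poly_mapping_eqI)
  fix k
  show "lookup (a * idem \<psi>) k = lookup (scalar (ev K \<psi> a) * idem \<psi>) k"
  proof (cases "k \<in> K")
    case k: True
    have "lookup (a * idem \<psi>) k =
        (\<Sum>g\<in>K. lookup a g * (\<psi> g * \<psi> (- k) / of_nat (card K)))"
      unfolding lookup_group_alg_mult[OF a]
    proof (rule sum.cong)
      fix g assume g: "g \<in> K"
      have "\<psi> (- (k - g)) = \<psi> g * \<psi> (- k)"
        using char_mult[OF \<psi> g uminus_K[OF k]] by (simp add: algebra_simps)
      then show "lookup a g * lookup (idem \<psi>) (k - g) =
          lookup a g * (\<psi> g * \<psi> (- k) / of_nat (card K))"
        using lookup_idem[OF diff_K[OF k g]] by simp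
    qed simp
    then show ?thesis
      using k by (simp add: lookup_single_mult lookup_idem ev_def sum_distrib_right sum_divide_distrib mult.assoc)
  next
    case False
    have "a * idem \<psi> \<in> group_alg K" "scalar (ev K \<psi> a) * idem \<psi> \<in> group_alg K"
      using a by auto
    then show ?thesis using False by (simp add: group_alg_iff)
  qed
qed

lemma ev_idem:
  "\<psi> \<in> chars K \<Longrightarrow> \<phi> \<in> chars K \<Longrightarrow> ev K \<psi> (idem \<phi>) = (if \<psi> = \<phi> then 1 else 0)"
  using char_orthogonality[of \<psi> \<phi>]
  by (simp add: ev_def lookup_idem sum_divide_distrib[symmetric] mult.commute split: if_splits)

end

subsection \<open>Extensions of characters\<close>

definition char_exts :: "'g::ab_group_add set \<Rightarrow> 'g set \<Rightarrow> ('g \<Rightarrow> complex) \<Rightarrow> ('g \<Rightarrow> complex) set" where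
  "char_exts G H \<chi> = {\<psi> \<in> chars G. \<forall>h\<in>H. \<psi> h = \<chi> h}"

locale add_group_pair = G: finite_add_group G + H: finite_add_group H
  for G H :: "'g::ab_group_add set" +
  assumes H_subset: "H \<subseteq> G"
begin

lemma finite_char_exts [simp, intro]: "finite (char_exts G H \<chi>)"
  by (simp add: char_exts_def)

text \<open>Orthogonality on \<open>H\<close> detects whether \<psi> extends \<chi>: the pairing of
  its restriction with \<chi> is |H| or 0. Inserting this pairing extends the sum to all characters
  of \<open>G\<close>, where column orthogonality leaves the single term
  \<open>h = - g\<close>.\<close>

lemma sum_char_exts:
  assumes \<chi>: "\<chi> \<in> chars H" and g: "g \<in> G"
  shows "(\<Sum>\<psi>\<in>char_exts G H \<chi>. \<psi> g) =
    (if g \<in> H then of_nat (card G) / of_nat (card H) * \<chi> g else 0)"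
proof -
  have res: "(\<Sum>h\<in>H. \<psi> h * \<chi> (- h)) = (if \<psi> \<in> char_exts G H \<chi> then of_nat (card H) else 0)"
    if \<psi>: "\<psi> \<in> chars G" for \<psi>
  proof -
    have r: "restrict \<psi> H \<in> chars H"
      using \<psi> H_subset by (auto simp: chars_def)
    have "(\<Sum>h\<in>H. \<psi> h * \<chi> (- h)) = (\<Sum>h\<in>H. restrict \<psi> H h * \<chi> (- h))" by simp
    also have "\<dots> = (if restrict \<psi> H = \<chi> then of_nat (card H) else 0)"
      by (rule H.char_orthogonality[OF r \<chi>])
    also have "restrict \<psi> H = \<chi> \<longleftrightarrow> \<psi> \<in> char_exts G H \<chi>"
      using \<psi> H.char_eqI[OF r \<chi>] by (auto simp: char_exts_def)
    finally show ?thesis .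
  qed
  have "of_nat (card H) * (\<Sum>\<psi>\<in>char_exts G H \<chi>. \<psi> g) =
      (\<Sum>\<psi>\<in>chars G. \<psi> g * (if \<psi> \<in> char_exts G H \<chi> then of_nat (card H) else 0))"
  proof -
    have "(\<Sum>\<psi>\<in>chars G. \<psi> g * (if \<psi> \<in> char_exts G H \<chi> then of_nat (card H) else 0)) =
        (\<Sum>\<psi>\<in>char_exts G H \<chi>. of_nat (card H) * \<psi> g)"
      by (rule sum.mono_neutral_cong_right) (auto simp: char_exts_def)
    then show ?thesis by (simp add: sum_distrib_left)
  qed
  also have "\<dots> = (\<Sum>\<psi>\<in>chars G. \<psi> g * (\<Sum>h\<in>H. \<psi> h * \<chi> (- h)))"
    by (intro sum.cong) (simp_all add: res)
  also have "\<dots> = (\<Sum>h\<in>H. \<chi> (- h) * (\<Sum>\<psi>\<in>chars G. \<psi> g * \<psi> h))"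
    by (simp add: sum_distrib_left mult_ac) (rule sum.swap)
  also have "\<dots> = (\<Sum>h\<in>H. if h = - g then \<chi> g * of_nat (card G) else 0)"
  proof (rule sum.cong)
    fix h assume h: "h \<in> H"
    then have hG: "h \<in> G" using H_subset by auto
    have "(\<Sum>\<psi>\<in>chars G. \<psi> g * \<psi> h) = (\<Sum>\<psi>\<in>chars G. \<psi> (g + h))"
      using g hG by (simp add: G.char_mult)
    also have "\<dots> = (if h = - g then of_nat (card G) else 0)"
      using G.sum_chars[OF G.add_K[OF g hG]] by (simp add: add_eq_0_iff)
    finally show "\<chi> (- h) * (\<Sum>\<psi>\<in>chars G. \<psi> g * \<psi> h) =
        (if h = - g then \<chi> g * of_nat (card G) else 0)" by simp
  qed simp
  also have "\<dots> = (if g \<in> H then \<chi> g * of_nat (card G) else 0)"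
  proof -
    have "- g \<in> H \<longleftrightarrow> g \<in> H" using H.uminus_K[of g] H.uminus_K[of "- g"] by auto
    then show ?thesis by simp
  qed
  finally show ?thesis by (simp add: field_simps split: if_splits)
qed

end

section \<open>Diagonalised representations\<close>

definition evs :: "'g::ab_group_add set \<Rightarrow> ('g \<Rightarrow> complex) \<Rightarrow> ('g \<Rightarrow>\<^sub>0 complex) fps \<Rightarrow> complex fps" where
  "evs K \<psi> F = Abs_fps (\<lambda>n. ev K \<psi> (fps_nth F n))"

lemma evs_nth [simp]: "fps_nth (evs K \<psi> F) n = ev K \<psi> (fps_nth F n)"
  by (simp add: evs_def)

lemma finsum_additive:
  fixes f :: "'m \<Rightarrow> 'u::comm_monoid_add"
  assumes "abelian_monoid V"
    and add: "\<And>x y. x \<in> carrier V \<Longrightarrow> y \<in> carrier V \<Longrightarrow> f (x \<oplus>\<^bsub>V\<^esub> y) = f x + f y"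
    and zero: "f \<zero>\<^bsub>V\<^esub> = 0"
    and fin: "finite I" and x: "\<And>i. i \<in> I \<Longrightarrow> x i \<in> carrier V"
  shows "f (\<Oplus>\<^bsub>V\<^esub>i\<in>I. x i) = (\<Sum>i\<in>I. f (x i))"
proof -
  interpret abelian_monoid V by fact
  from fin x show ?thesis
  proof (induction I)
    case (insert i I)
    then show ?case
      using finsum_closed[of x I] by (simp add: finsum_insert add Pi_iff)
  qed (simp add: zero)
qed

text \<open>\<open>f j\<close> are the coordinates with respect to a complex basis of simultaneous eigenvectors.\<close>

locale diagonalised = finite_add_group K
  for K :: "'g::ab_group_add set" +
  fixes V :: "('g \<Rightarrow>\<^sub>0 complex, 'm) module" and J :: "'j set"
    and \<chi> :: "'j \<Rightarrow> 'g \<Rightarrow> complex" and f :: "'j \<Rightarrow> 'm \<Rightarrow> complex"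
  assumes finite_J: "finite J"
    and zero_carrier: "\<zero>\<^bsub>V\<^esub> \<in> carrier V"
    and add_carrier: "x \<in> carrier V \<Longrightarrow> y \<in> carrier V \<Longrightarrow> x \<oplus>\<^bsub>V\<^esub> y \<in> carrier V"
    and smult_carrier: "a \<in> group_alg K \<Longrightarrow> x \<in> carrier V \<Longrightarrow> a \<odot>\<^bsub>V\<^esub> x \<in> carrier V"
    and chars: "j \<in> J \<Longrightarrow> \<chi> j \<in> chars K"
    and f_zero: "j \<in> J \<Longrightarrow> f j \<zero>\<^bsub>V\<^esub> = 0"
    and f_add: "j \<in> J \<Longrightarrow> x \<in> carrier V \<Longrightarrow> y \<in> carrier V \<Longrightarrow> f j (x \<oplus>\<^bsub>V\<^esub> y) = f j x + f j y"
    and f_smult: "j \<in> J \<Longrightarrow> a \<in> group_alg K \<Longrightarrow> x \<in> carrier V \<Longrightarrow>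
      f j (a \<odot>\<^bsub>V\<^esub> x) = ev K (\<chi> j) a * f j x"
    and f_inj: "x \<in> carrier V \<Longrightarrow> y \<in> carrier V \<Longrightarrow> (\<And>j. j \<in> J \<Longrightarrow> f j x = f j y) \<Longrightarrow> x = y"
    and f_surj: "\<exists>x\<in>carrier V. \<forall>j\<in>J. f j x = z j"
begin

text \<open>The laws hold because they hold in coordinates. For the induced representation this is
  how they are obtained, since only closure and the coordinates are established there.\<close>

lemma abelian_monoid_V: "abelian_monoid V"
proof (rule abelian_monoidI)
  fix x y z assume xyz: "x \<in> carrier V" "y \<in> carrier V" "z \<in> carrier V"
  show "x \<oplus>\<^bsub>V\<^esub> y \<oplus>\<^bsub>V\<^esub> z = x \<oplus>\<^bsub>V\<^esub> (y \<oplus>\<^bsub>V\<^esub> z)"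
    using xyz by (intro f_inj) (simp_all add: f_add add_carrier)
next
  fix x y assume xy: "x \<in> carrier V" "y \<in> carrier V"
  then show "x \<oplus>\<^bsub>V\<^esub> y = y \<oplus>\<^bsub>V\<^esub> x"
    by (intro f_inj) (simp_all add: f_add add_carrier)
next
  fix x assume "x \<in> carrier V"
  then show "\<zero>\<^bsub>V\<^esub> \<oplus>\<^bsub>V\<^esub> x = x"
    by (intro f_inj) (simp_all add: f_add f_zero add_carrier zero_carrier)
qed (auto intro: zero_carrier add_carrier)

lemma f_finsum:
  assumes "j \<in> J" "finite I" "\<And>i. i \<in> I \<Longrightarrow> x i \<in> carrier V"
  shows "f j (\<Oplus>\<^bsub>V\<^esub>i\<in>I. x i) = (\<Sum>i\<in>I. f j (x i))"
  using assms by (intro finsum_additive[OF abelian_monoid_V]) (auto simp: f_add f_zero)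

lemma finsum_carrier: "(\<And>i. i \<in> I \<Longrightarrow> x i \<in> carrier V) \<Longrightarrow> (\<Oplus>\<^bsub>V\<^esub>i\<in>I. x i) \<in> carrier V"
  by (rule abelian_monoid.finsum_closed[OF abelian_monoid_V]) auto

lemma series_endo_carrier:
  assumes "\<And>i. a i \<in> group_alg K" and "\<And>n. F n \<in> carrier V"
  shows "series_endo V (\<lambda>i x. a i \<odot>\<^bsub>V\<^esub> x) F n \<in> carrier V"
  unfolding series_endo_def using assms by (intro finsum_carrier smult_carrier)

lemma f_series_endo:
  assumes "j \<in> J" and "\<And>i. a i \<in> group_alg K" and "\<And>n. F n \<in> carrier V"
  shows "f j (series_endo V (\<lambda>i x. a i \<odot>\<^bsub>V\<^esub> x) F n) =
    (\<Sum>i\<le>n. ev K (\<chi> j) (a i) * f j (F (n - i)))"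
  unfolding series_endo_def using assms by (simp add: f_finsum f_smult smult_carrier)

text \<open>The eigenvectors form a basis of V[[u]] over \<complex>[[u]], so the module is already
  free: the idempotent of the embedding is the identity matrix. In this basis \<Lambda> acts by a
  diagonal matrix.\<close>

lemma sigma_rep_eq_prod:
  assumes \<Lambda>: "\<Lambda> \<in> group_alg_fps K"
  shows "sigma_rep V \<Lambda> = (\<Prod>j\<in>J. evs K (\<chi> j) \<Lambda>)"
proof -
  define d where "d = card J"
  obtain b where b: "bij_betw b {..<d} J"
    using ex_bij_betw_nat_finite[OF finite_J] by (auto simp: d_def atLeast0LessThan)
  have bJ: "b r \<in> J" if "r < d" for r using b that by (auto simp: bij_betw_def)
  have \<Lambda>': "fps_nth \<Lambda> i \<in> group_alg K" for i using \<Lambda> by (simp add: group_alg_fps_def)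
  define \<iota> where "\<iota> F = vec d (\<lambda>r. Abs_fps (\<lambda>n. f (b r) (F n)))" for F :: "nat \<Rightarrow> 'm"
  have carr: "carrier (fps_module V) = {F. \<forall>n. F n \<in> carrier V}" by (simp add: fps_module_def)
  have series: "f (b r) (series_endo V (\<lambda>i x. a i \<odot>\<^bsub>V\<^esub> x) F n) =
      fps_nth (Abs_fps (\<lambda>i. ev K (\<chi> (b r)) (a i)) * Abs_fps (\<lambda>n. f (b r) (F n))) n"
    if "r < d" "\<And>i. a i \<in> group_alg K" "F \<in> carrier (fps_module V)" for r a F n
    using that by (simp add: f_series_endo[OF bJ] carr fps_mult_nth atMost_atLeast0)
  interpret projective_embedding UNIV "fps_module V" d \<iota> "1\<^sub>m d"
  proof
    show "\<zero>\<^bsub>fps_module V\<^esub> \<in> carrier (fps_module V)"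
      by (simp add: fps_module_def zero_carrier)
    fix F assume F: "F \<in> carrier (fps_module V)"
    show "\<iota> F \<in> rvecs UNIV d" by (simp add: \<iota>_def rvecs_def)
    show "1\<^sub>m d *\<^sub>v \<iota> F = \<iota> F" by (simp add: \<iota>_def)
    {
      fix c :: "complex fps"
      show "c \<odot>\<^bsub>fps_module V\<^esub> F \<in> carrier (fps_module V)"
        using F by (auto simp: fps_module_def intro!: series_endo_carrier)
      show "\<iota> (c \<odot>\<^bsub>fps_module V\<^esub> F) = c \<cdot>\<^sub>v \<iota> F"
      proof (rule eq_vecI)
        fix r assume "r < dim_vec (c \<cdot>\<^sub>v \<iota> F)"
        then have r: "r < d" by (simp add: \<iota>_def)
        have c: "Abs_fps (\<lambda>i. ev K (\<chi> (b r)) (scalar (fps_nth c i))) = c"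
          using ev_scalar[OF chars[OF bJ[OF r]]] by (simp add: fps_eq_iff)
        show "\<iota> (c \<odot>\<^bsub>fps_module V\<^esub> F) $ r = (c \<cdot>\<^sub>v \<iota> F) $ r"
          using r series[OF r _ F, of "\<lambda>i. scalar (fps_nth c i)"] c
          by (simp add: \<iota>_def fps_eq_iff) (simp add: fps_module_def)
      qed (simp add: \<iota>_def)
    }
    fix F' assume F': "F' \<in> carrier (fps_module V)"
    show "F \<oplus>\<^bsub>fps_module V\<^esub> F' \<in> carrier (fps_module V)"
      using F F' by (simp add: fps_module_def add_carrier)
    show "\<iota> (F \<oplus>\<^bsub>fps_module V\<^esub> F') = \<iota> F + \<iota> F'"
      using F F' bJ by (intro eq_vecI) (auto simp: \<iota>_def fps_eq_iff fps_module_def f_add)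
    assume eq: "\<iota> F = \<iota> F'"
    show "F = F'"
    proof
      fix n
      have "f j (F n) = f j (F' n)" if j: "j \<in> J" for j
      proof -
        obtain r where r: "r < d" "j = b r" using b j by (auto simp: bij_betw_def)
        have "\<iota> F $ r = \<iota> F' $ r" using eq by simp
        then show ?thesis using r by (simp add: \<iota>_def fps_eq_iff)
      qed
      then show "F n = F' n" using F F' by (intro f_inj) (auto simp: carr)
    qed
  next
    show "\<iota> \<zero>\<^bsub>fps_module V\<^esub> = 0\<^sub>v d"
      using bJ by (intro eq_vecI) (auto simp: \<iota>_def fps_eq_iff fps_module_def f_zero)
    show "1\<^sub>m d \<in> rmats UNIV d d" by (simp add: rmats_def)
    fix v :: "complex fps vec" assume v: "v \<in> rvecs UNIV d"
    \<comment> \<open>A vector of power series is realised degree by degree: \<open>F n\<close> is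
      an element of \<open>V\<close> whose coordinates are the \<open>n\<close>-th
      coefficients.\<close>
    define F where "F n = (SOME x. x \<in> carrier V \<and> (\<forall>j\<in>J. f j x = fps_nth (v $ inv_into {..<d} b j) n))" for n
    have F: "F n \<in> carrier V \<and> (\<forall>j\<in>J. f j (F n) = fps_nth (v $ inv_into {..<d} b j) n)" for n
      unfolding F_def
      by (rule someI_ex) (use f_surj[of "\<lambda>j. fps_nth (v $ inv_into {..<d} b j) n"] in blast)
    have "\<iota> F = v"
      using v F bJ b by (intro eq_vecI) (auto simp: \<iota>_def rvecs_def fps_eq_iff bij_betw_def inv_into_f_f)
    moreover have "F \<in> carrier (fps_module V)" using F by (simp add: carr)
    ultimately show "1\<^sub>m d *\<^sub>v v \<in> \<iota> ` carrier (fps_module V)"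
      using v by (auto simp: rvecs_def)
  qed auto
  define B where "B = mat d d (\<lambda>(r, s). if r = s then evs K (\<chi> (b r)) \<Lambda> else 0)"
  have "sigma_rep V \<Lambda> = det (1\<^sub>m d + (B - 1\<^sub>m d) * 1\<^sub>m d)"
    unfolding sigma_rep_def
  proof (rule proj_det_emb)
    show "B \<in> rmats UNIV d d" by (simp add: B_def rmats_def)
    fix F assume F: "F \<in> carrier (fps_module V)"
    show "series_endo V (\<lambda>i x. fps_nth \<Lambda> i \<odot>\<^bsub>V\<^esub> x) F \<in> carrier (fps_module V)"
      using F \<Lambda>' by (auto simp: carr intro!: series_endo_carrier)
    show "B *\<^sub>v \<iota> F = \<iota> (series_endo V (\<lambda>i x. fps_nth \<Lambda> i \<odot>\<^bsub>V\<^esub> x) F)"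
    proof (rule eq_vecI)
      fix r assume "r < dim_vec (\<iota> (series_endo V (\<lambda>i x. fps_nth \<Lambda> i \<odot>\<^bsub>V\<^esub> x) F))"
      then have r: "r < d" by (simp add: \<iota>_def)
      have "(B *\<^sub>v \<iota> F) $ r = (\<Sum>s<d. B $$ (r, s) * \<iota> F $ s)"
        using r by (simp add: B_def scalar_prod_def \<iota>_def atLeast0LessThan)
      also have "\<dots> = (\<Sum>s<d. if s = r then evs K (\<chi> (b r)) \<Lambda> * \<iota> F $ r else 0)"
        using r by (intro sum.cong) (auto simp: B_def)
      also have "\<dots> = evs K (\<chi> (b r)) \<Lambda> * \<iota> F $ r" using r by simp
      also have "\<dots> = \<iota> (series_endo V (\<lambda>i x. fps_nth \<Lambda> i \<odot>\<^bsub>V\<^esub> x) F) $ r"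
        using r series[OF r \<Lambda>' F] by (simp add: \<iota>_def fps_eq_iff evs_def)
      finally show "(B *\<^sub>v \<iota> F) $ r = \<iota> (series_endo V (\<lambda>i x. fps_nth \<Lambda> i \<odot>\<^bsub>V\<^esub> x) F) $ r" .
    qed (simp add: B_def \<iota>_def)
  qed
  also have "1\<^sub>m d + (B - 1\<^sub>m d) * 1\<^sub>m d = B"
    by (intro eq_matI) (auto simp: B_def)
  also have "det B = prod_list (diag_mat B)"
    by (rule det_upper_triangular[where n = d]) (auto simp: B_def)
  also have "\<dots> = (\<Prod>r<d. evs K (\<chi> (b r)) \<Lambda>)"
    by (simp add: prod_list_diag_prod B_def atLeast0LessThan)
  also have "\<dots> = (\<Prod>j\<in>J. evs K (\<chi> j) \<Lambda>)"
    by (rule prod.reindex_bij_betw[OF b])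
  finally show ?thesis .
qed

end

text \<open>For a generator v, the components \<open>idem \<psi> \<odot> v\<close> are eigenvectors
  and add up to v, as the idempotents sum to 1. Being eigenvectors, they span \<open>V\<close>
  already over \<complex>; a spanning subfamily of least size is a basis. Its members are indexed by
  pairs of a generator and a character, so the eigencharacter is the second component.\<close>

lemma artin_rep_diagonalised:
  fixes V :: "('g::ab_group_add \<Rightarrow>\<^sub>0 complex, 'm) module"
  assumes "finite_add_group K" and rep: "artin_rep K V"
  shows "\<exists>(J :: ('m \<times> ('g \<Rightarrow> complex)) set) \<chi> f. diagonalised K V J \<chi> f"
proof -
  interpret finite_add_group K by fact
  interpret V: Module.module "ring_on (group_alg K)" V using rep by (simp add: artin_rep_def)
  note V_smult [simp] = V.smult_closed[simplified]
  note V_ldistr = V.smult_l_distr[simplified]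
  note V_rdistr = V.smult_r_distr[simplified]
  note V_assoc = V.smult_assoc1[simplified]
  note V_one = V.smult_one[simplified]
  note V_finsum_smult = V.finsum_smult[simplified]
  note V_rnull = V.smult_r_null[simplified]
  note V_lnull = V.smult_l_null[simplified]
  from rep obtain S where S: "finite S" "S \<subseteq> carrier V" "V.span S = carrier V"
    by (auto simp: artin_rep_def finitely_generated_def)
  define J0 where "J0 = S \<times> chars K"
  define w where "w = (\<lambda>(v, \<psi>). idem \<psi> \<odot>\<^bsub>V\<^esub> v)"
  define comb where "comb J z = (\<Oplus>\<^bsub>V\<^esub>j\<in>J. scalar (z j) \<odot>\<^bsub>V\<^esub> w j)" for J and z :: "'m \<times> ('g \<Rightarrow> complex) \<Rightarrow> complex"
  have fin_J0: "finite J0" using S by (simp add: J0_def)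
  have w_mem: "w j \<in> carrier V" if "j \<in> J0" for j
    using that S idem_mem by (auto simp: J0_def w_def)
  have w_eigen: "a \<odot>\<^bsub>V\<^esub> w j = scalar (ev K (snd j) a) \<odot>\<^bsub>V\<^esub> w j"
    if j0: "j \<in> J0" and a: "a \<in> group_alg K" for j a
  proof -
    obtain v \<psi> where j: "j = (v, \<psi>)" "v \<in> carrier V" "\<psi> \<in> chars K"
      using j0 S by (auto simp: J0_def)
    have "a \<odot>\<^bsub>V\<^esub> w j = (a * idem \<psi>) \<odot>\<^bsub>V\<^esub> v"
      using j a by (simp add: w_def V_assoc idem_mem)
    also have "\<dots> = scalar (ev K \<psi> a) \<odot>\<^bsub>V\<^esub> w j"
      using j by (simp add: w_def mult_idem[OF j(3) a] V_assoc idem_mem)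
    finally show ?thesis using j by simp
  qed
  have comb_mem: "comb J z \<in> carrier V" if "J \<subseteq> J0" for J z
    unfolding comb_def using that w_mem by (intro V.finsum_closed) auto
  have comb_add: "comb J z \<oplus>\<^bsub>V\<^esub> comb J z' = comb J (\<lambda>j. z j + z' j)" if J: "J \<subseteq> J0" for J z z'
  proof -
    have "comb J (\<lambda>j. z j + z' j) =
        (\<Oplus>\<^bsub>V\<^esub>j\<in>J. scalar (z j) \<odot>\<^bsub>V\<^esub> w j \<oplus>\<^bsub>V\<^esub> scalar (z' j) \<odot>\<^bsub>V\<^esub> w j)"
      unfolding comb_def using J w_mem by (intro V.finsum_cong') (auto simp: single_add V_ldistr)
    also have "\<dots> = comb J z \<oplus>\<^bsub>V\<^esub> comb J z'"
      unfolding comb_def using J w_mem by (intro V.finsum_addf) auto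
    finally show ?thesis ..
  qed
  have comb_smult: "a \<odot>\<^bsub>V\<^esub> comb J z = comb J (\<lambda>j. ev K (snd j) a * z j)"
    if J: "J \<subseteq> J0" and a: "a \<in> group_alg K" for J z a
  proof -
    have "a \<odot>\<^bsub>V\<^esub> comb J z = (\<Oplus>\<^bsub>V\<^esub>j\<in>J. a \<odot>\<^bsub>V\<^esub> (scalar (z j) \<odot>\<^bsub>V\<^esub> w j))"
      unfolding comb_def using J w_mem a by (intro V_finsum_smult) auto
    also have "\<dots> = comb J (\<lambda>j. ev K (snd j) a * z j)"
      unfolding comb_def
    proof (rule V.finsum_cong')
      fix j assume "j \<in> J"
      then have j: "j \<in> J0" using J by auto
      have "a \<odot>\<^bsub>V\<^esub> (scalar (z j) \<odot>\<^bsub>V\<^esub> w j) = scalar (z j) \<odot>\<^bsub>V\<^esub> (a \<odot>\<^bsub>V\<^esub> w j)"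
        using a w_mem[OF j] by (simp add: V_assoc[symmetric] mult.commute)
      also have "\<dots> = scalar (ev K (snd j) a * z j) \<odot>\<^bsub>V\<^esub> w j"
        using w_mem[OF j] by (simp add: w_eigen[OF j a] V_assoc[symmetric] mult_single mult.commute)
      finally show "a \<odot>\<^bsub>V\<^esub> (scalar (z j) \<odot>\<^bsub>V\<^esub> w j) = scalar (ev K (snd j) a * z j) \<odot>\<^bsub>V\<^esub> w j" .
    qed (use J w_mem in auto)
    finally show ?thesis .
  qed
  have comb_zero: "comb J (\<lambda>_. 0) = \<zero>\<^bsub>V\<^esub>" if J: "J \<subseteq> J0" for J
  proof -
    have "comb J (\<lambda>_. 0) = (\<Oplus>\<^bsub>V\<^esub>j\<in>J. \<zero>\<^bsub>V\<^esub>)"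
      unfolding comb_def using J w_mem by (intro V.finsum_cong') (auto simp: V_lnull)
    then show ?thesis by simp
  qed
  define L where "L J = range (comb J)" for J
  have L_add: "x \<oplus>\<^bsub>V\<^esub> y \<in> L J" if "J \<subseteq> J0" "x \<in> L J" "y \<in> L J" for J x y
    using that comb_add by (auto simp: L_def)
  have L_smult: "a \<odot>\<^bsub>V\<^esub> x \<in> L J" if "J \<subseteq> J0" "x \<in> L J" "a \<in> group_alg K" for J x a
    using that comb_smult by (auto simp: L_def)
  have L_zero: "\<zero>\<^bsub>V\<^esub> \<in> L J" if "J \<subseteq> J0" for J
    using comb_zero[OF that] by (metis L_def rangeI)
  have L_finsum: "(\<Oplus>\<^bsub>V\<^esub>i\<in>I. x i) \<in> L J"
    if J: "J \<subseteq> J0" and "finite I" "\<And>i. i \<in> I \<Longrightarrow> x i \<in> L J" for J and I :: "'i set" and x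
    using that(2,3)
  proof (induction I)
    case empty
    then show ?case using L_zero[OF J] by simp
  next
    case (insert i I)
    have mem: "x k \<in> carrier V" if "k \<in> insert i I" for k
      using insert.prems[OF that] comb_mem[OF J] by (auto simp: L_def)
    have "(\<Oplus>\<^bsub>V\<^esub>i\<in>insert i I. x i) = x i \<oplus>\<^bsub>V\<^esub> (\<Oplus>\<^bsub>V\<^esub>i\<in>I. x i)"
      using insert.hyps mem by (intro V.finsum_insert) auto
    then show ?case using L_add[OF J] insert by simp
  qed
  have L_w: "w j \<in> L J" if J: "J \<subseteq> J0" and j: "j \<in> J" for J j
  proof -
    have fin: "finite J" using J fin_J0 finite_subset by auto
    have wj: "w j \<in> carrier V" using J j w_mem by blast
    have "comb J (\<lambda>k. if k = j then 1 else 0) = (\<Oplus>\<^bsub>V\<^esub>k\<in>J. if j = k then w k else \<zero>\<^bsub>V\<^esub>)"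
      unfolding comb_def using J w_mem by (intro V.finsum_cong') (auto simp: V_lnull V_one)
    also have "\<dots> = w j"
      using J j fin w_mem by (intro V.finsum_singleton) auto
    finally show ?thesis by (metis L_def rangeI)
  qed
  have L_J0: "L J0 = carrier V"
  proof
    show "L J0 \<subseteq> carrier V" using comb_mem by (auto simp: L_def)
    have gen: "v \<in> L J0" if v: "v \<in> S" for v
    proof -
      have vV: "v \<in> carrier V" using v S by auto
      have "(\<Sum>\<psi>\<in>F. idem \<psi>) \<odot>\<^bsub>V\<^esub> v \<in> L J0" if "finite F" "F \<subseteq> chars K" for F
        using that
      proof (induction F)
        case empty
        then show ?case using L_zero[of J0] vV by (simp add: V_lnull)
      next
        case (insert \<psi> F)
        have "(\<Sum>\<psi>\<in>insert \<psi> F. idem \<psi>) \<odot>\<^bsub>V\<^esub> v = idem \<psi> \<odot>\<^bsub>V\<^esub> v \<oplus>\<^bsub>V\<^esub> (\<Sum>\<psi>\<in>F. idem \<psi>) \<odot>\<^bsub>V\<^esub> v"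
          using insert.hyps vV by (simp add: V_ldistr idem_mem A.sum_mem)
        moreover have "idem \<psi> \<odot>\<^bsub>V\<^esub> v \<in> L J0"
          using L_w[of J0 "(v, \<psi>)"] insert.prems v by (simp add: w_def J0_def)
        ultimately show ?case using L_add[of J0] insert by simp
      qed
      from this[of "chars K"] show ?thesis using vV by (simp add: sum_idem V_one)
    qed
    show "carrier V \<subseteq> L J0"
    proof
      fix x assume "x \<in> carrier V"
      then have "x \<in> V.span S" using S by simp
      then obtain a A' where x: "x = V.lincomb a A'" "finite A'" "A' \<subseteq> S" "a \<in> A' \<rightarrow> group_alg K"
        unfolding V.span_def by auto
      show "x \<in> L J0"
        unfolding x(1) V.lincomb_def using x gen
        by (intro L_finsum L_smult) auto
    qed
  qed
  \<comment> \<open>Least cardinality takes the place of an extraction of a basis by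
    dimension.\<close>
  obtain J where J: "J \<subseteq> J0" "L J = carrier V"
    and min: "\<And>J'. J' \<subseteq> J0 \<Longrightarrow> L J' = carrier V \<Longrightarrow> card J \<le> card J'"
    using ex_has_least_nat[of "\<lambda>J. J \<subseteq> J0 \<and> L J = carrier V" J0 card] L_J0 by auto
  have fin_J: "finite J" using J fin_J0 finite_subset by auto
  \<comment> \<open>A relation with \<open>z k \<noteq> 0\<close> expresses \<open>w k\<close>
    through the other vectors, so \<open>J - {k}\<close> would span as well, against
    minimality.\<close>
  have indep: "z k = 0" if "comb J z = \<zero>\<^bsub>V\<^esub>" "k \<in> J" for z k
  proof (rule ccontr)
    assume nz: "z k \<noteq> 0"
    let ?J' = "J - {k}"
    have J': "?J' \<subseteq> J0" using J by auto
    have wk: "w k \<in> carrier V" using w_mem J that by blast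
    have rest: "comb ?J' z \<in> carrier V" by (rule comb_mem[OF J'])
    have "comb J z = scalar (z k) \<odot>\<^bsub>V\<^esub> w k \<oplus>\<^bsub>V\<^esub> comb ?J' z"
    proof -
      have "J = insert k ?J'" using that by auto
      then have "comb J z = (\<Oplus>\<^bsub>V\<^esub>j\<in>insert k ?J'. scalar (z j) \<odot>\<^bsub>V\<^esub> w j)" by (simp add: comb_def)
      also have "\<dots> = scalar (z k) \<odot>\<^bsub>V\<^esub> w k \<oplus>\<^bsub>V\<^esub> (\<Oplus>\<^bsub>V\<^esub>j\<in>?J'. scalar (z j) \<odot>\<^bsub>V\<^esub> w j)"
        using fin_J wk w_mem J' by (intro V.finsum_insert) auto
      finally show ?thesis by (simp add: comb_def)
    qed
    then have eq: "scalar (z k) \<odot>\<^bsub>V\<^esub> w k \<oplus>\<^bsub>V\<^esub> comb ?J' z = \<zero>\<^bsub>V\<^esub>" using that by simp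
    have "w k = scalar (- 1 / z k) \<odot>\<^bsub>V\<^esub> comb ?J' z"
    proof -
      have "\<zero>\<^bsub>V\<^esub> = scalar (1 / z k) \<odot>\<^bsub>V\<^esub> (scalar (z k) \<odot>\<^bsub>V\<^esub> w k \<oplus>\<^bsub>V\<^esub> comb ?J' z)"
        using eq by (simp add: V_rnull)
      also have "\<dots> = w k \<oplus>\<^bsub>V\<^esub> scalar (1 / z k) \<odot>\<^bsub>V\<^esub> comb ?J' z"
        using wk rest nz by (simp add: V_rdistr V_assoc[symmetric] mult_single V_one)
      finally have 1: "w k \<oplus>\<^bsub>V\<^esub> scalar (1 / z k) \<odot>\<^bsub>V\<^esub> comb ?J' z = \<zero>\<^bsub>V\<^esub>" by simp
      have "scalar (1 / z k) \<odot>\<^bsub>V\<^esub> comb ?J' z \<oplus>\<^bsub>V\<^esub> scalar (- 1 / z k) \<odot>\<^bsub>V\<^esub> comb ?J' z = \<zero>\<^bsub>V\<^esub>"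
        using rest by (simp add: V_ldistr[symmetric] single_add[symmetric] V_lnull)
      then have "w k \<oplus>\<^bsub>V\<^esub> scalar (1 / z k) \<odot>\<^bsub>V\<^esub> comb ?J' z =
          scalar (- 1 / z k) \<odot>\<^bsub>V\<^esub> comb ?J' z \<oplus>\<^bsub>V\<^esub> scalar (1 / z k) \<odot>\<^bsub>V\<^esub> comb ?J' z"
        using 1 rest by (simp add: V.a_comm)
      then show ?thesis using wk rest by (simp add: V.M.add.right_cancel)
    qed
    then have "w k \<in> L ?J'" using L_smult[OF J', of "comb ?J' z"] by (simp add: L_def)
    then have w_J': "w j \<in> L ?J'" if "j \<in> J" for j using L_w[OF J', of j] that by (cases "j = k") auto
    have "L J \<subseteq> L ?J'"
    proof
      fix x assume "x \<in> L J"
      then obtain z where "x = comb J z" by (auto simp: L_def)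
      then show "x \<in> L ?J'"
        unfolding comb_def using w_J' fin_J by (auto intro!: L_finsum[OF J'] L_smult[OF J'])
    qed
    then have "L ?J' = carrier V" using J comb_mem[OF J'] by (auto simp: L_def)
    then have "card J \<le> card ?J'" by (rule min[OF J'])
    then show False using that fin_J by (metis card_Diff1_less not_less)
  qed
  have unique: "z k = z' k" if "comb J z = comb J z'" "k \<in> J" for z z' k
  proof -
    have "comb J (\<lambda>j. z j + - z' j) = comb J z \<oplus>\<^bsub>V\<^esub> comb J (\<lambda>j. - z' j)"
      using comb_add[OF J(1)] by simp
    also have "\<dots> = comb J (\<lambda>j. z' j + - z' j)" using comb_add[OF J(1)] that by simp
    also have "\<dots> = \<zero>\<^bsub>V\<^esub>" using comb_zero[OF J(1)] by simp
    finally show ?thesis using indep that by fastforce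
  qed
  define coords where "coords x = (SOME z. comb J z = x)" for x
  have coords: "comb J (coords x) = x" if "x \<in> carrier V" for x
  proof -
    have "\<exists>z. comb J z = x" using that unfolding J(2)[symmetric] L_def by auto
    then show ?thesis unfolding coords_def by (rule someI_ex)
  qed
  have coordsI: "coords x j = z j" if "comb J z = x" "j \<in> J" for x z j
    using that coords[of x] comb_mem[OF J(1)] unique by metis
  have "diagonalised K V J snd (\<lambda>j x. coords x j)"
  proof
    show "finite J" by (rule fin_J)
    show "\<zero>\<^bsub>V\<^esub> \<in> carrier V" by simp
    fix j assume j: "j \<in> J"
    show "snd j \<in> chars K" using J j by (auto simp: J0_def)
    show "coords \<zero>\<^bsub>V\<^esub> j = 0" by (rule coordsI[OF comb_zero[OF J(1)] j])
    fix x assume x: "x \<in> carrier V"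
    show "coords (a \<odot>\<^bsub>V\<^esub> x) j = ev K (snd j) a * coords x j" if "a \<in> group_alg K" for a
      using comb_smult[OF J(1) that, of "coords x"] coords[OF x] j by (intro coordsI) auto
    fix y assume y: "y \<in> carrier V"
    show "coords (x \<oplus>\<^bsub>V\<^esub> y) j = coords x j + coords y j"
      using comb_add[OF J(1), of "coords x" "coords y"] coords[OF x] coords[OF y] j
      by (intro coordsI) auto
  next
    fix x y assume x: "x \<in> carrier V" and y: "y \<in> carrier V"
      and eq: "\<And>j. j \<in> J \<Longrightarrow> coords x j = coords y j"
    have "comb J (coords x) = comb J (coords y)"
      unfolding comb_def using eq J w_mem by (intro V.finsum_cong') auto
    then show "x = y" using coords[OF x] coords[OF y] by simp
  next
    fix z
    show "\<exists>x\<in>carrier V. \<forall>j\<in>J. coords x j = z j"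
      using coordsI[of z "comb J z"] by (intro bexI[OF _ comb_mem[OF J(1), of z]]) simp
  qed auto
  then show ?thesis by blast
qed

section \<open>Quotients by the common kernel of functionals\<close>

lemma abelian_group_of_type:
  fixes M :: "('r, 'm::ab_group_add) module"
  assumes "add M = (+)" and "zero M = 0" and "0 \<in> carrier M"
    and "\<And>x y. x \<in> carrier M \<Longrightarrow> y \<in> carrier M \<Longrightarrow> x + y \<in> carrier M"
    and "\<And>x. x \<in> carrier M \<Longrightarrow> - x \<in> carrier M"
  shows "abelian_group M"
  by (rule abelian_groupI) (use assms in \<open>auto simp: add_ac intro: bexI[of _ "- _"]\<close>)

text \<open>When the submodule is the common kernel of functionals, its cosets are their joint level
  sets, and the quotient can be handled by functionals instead of representatives. The condition on
  scalars is \<open>smult_cong\<close> and not an eigenvalue equation, because it has to cover both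
  functionals that are eigenvectors (induced representations) and functionals that the group
  permutes (edge chains).\<close>

locale kernel_quotient = abelian_group M
  for M :: "('r, 'm) module" (structure) +
  fixes P :: "'p set" and L :: "'p \<Rightarrow> 'm \<Rightarrow> complex" and N :: "'m set" and R :: "'r set"
  assumes L_add: "p \<in> P \<Longrightarrow> x \<in> carrier M \<Longrightarrow> y \<in> carrier M \<Longrightarrow> L p (x \<oplus>\<^bsub>M\<^esub> y) = L p x + L p y"
    and N_eq: "N = {x \<in> carrier M. \<forall>p\<in>P. L p x = 0}"
    and smult_carrier: "r \<in> R \<Longrightarrow> x \<in> carrier M \<Longrightarrow> r \<odot>\<^bsub>M\<^esub> x \<in> carrier M"
    and smult_cong: "r \<in> R \<Longrightarrow> x \<in> carrier M \<Longrightarrow> y \<in> carrier M \<Longrightarrow>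
      (\<And>p. p \<in> P \<Longrightarrow> L p x = L p y) \<Longrightarrow> p \<in> P \<Longrightarrow> L p (r \<odot>\<^bsub>M\<^esub> x) = L p (r \<odot>\<^bsub>M\<^esub> y)"
begin

definition cls :: "'m \<Rightarrow> 'm set" where
  "cls x = {y \<in> carrier M. \<forall>p\<in>P. L p y = L p x}"

text \<open>Well defined on cosets, as \<open>L p\<close> is constant on each of them.\<close>

definition lift :: "'p \<Rightarrow> 'm set \<Rightarrow> complex" where
  "lift p X = L p (SOME x. x \<in> X)"

abbreviation "Quo \<equiv> quotient_module M N"

lemma L_zero: "p \<in> P \<Longrightarrow> L p \<zero>\<^bsub>M\<^esub> = 0"
  using L_add[of p "\<zero>\<^bsub>M\<^esub>" "\<zero>\<^bsub>M\<^esub>"] by simp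

lemma L_minus: "p \<in> P \<Longrightarrow> x \<in> carrier M \<Longrightarrow> L p (\<ominus>\<^bsub>M\<^esub> x) = - L p x"
  using L_add[of p x "\<ominus>\<^bsub>M\<^esub> x"] by (simp add: r_neg L_zero eq_neg_iff_add_eq_0 add.commute)

lemma cls_mem: "x \<in> carrier M \<Longrightarrow> x \<in> cls x"
  by (simp add: cls_def)

lemma coset_eq_cls:
  assumes x: "x \<in> carrier M"
  shows "N +>\<^bsub>M\<^esub> x = cls x"
proof
  show "N +>\<^bsub>M\<^esub> x \<subseteq> cls x"
    using x by (auto simp: a_r_coset_def' N_eq cls_def L_add)
  show "cls x \<subseteq> N +>\<^bsub>M\<^esub> x"
  proof
    fix y assume y: "y \<in> cls x"
    then have yM: "y \<in> carrier M" by (simp add: cls_def)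
    have "y \<oplus>\<^bsub>M\<^esub> (\<ominus>\<^bsub>M\<^esub> x) \<in> N"
      using x y yM by (auto simp: N_eq cls_def L_add L_minus)
    moreover have "y = (y \<oplus>\<^bsub>M\<^esub> (\<ominus>\<^bsub>M\<^esub> x)) \<oplus>\<^bsub>M\<^esub> x"
      using x yM by (simp add: a_assoc l_neg)
    ultimately show "y \<in> N +>\<^bsub>M\<^esub> x" unfolding a_r_coset_def' by blast
  qed
qed

lemma carrier_Quo: "carrier Quo = cls ` carrier M"
  by (auto simp: quotient_module_def A_RCOSETS_def' coset_eq_cls)

lemma zero_Quo: "\<zero>\<^bsub>Quo\<^esub> = cls \<zero>\<^bsub>M\<^esub>"
  by (auto simp: quotient_module_def N_eq cls_def L_zero)

lemma cls_eq_iff: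
  assumes "x \<in> carrier M" "y \<in> carrier M"
  shows "cls x = cls y \<longleftrightarrow> (\<forall>p\<in>P. L p x = L p y)"
  using assms by (fastforce simp: cls_def set_eq_iff)

lemma lift_cls:
  assumes "p \<in> P" "x \<in> carrier M"
  shows "lift p (cls x) = L p x"
  using someI[of "\<lambda>y. y \<in> cls x" x] assms by (auto simp: lift_def cls_def)

lemma add_Quo:
  assumes x: "x \<in> carrier M" and y: "y \<in> carrier M"
  shows "cls x \<oplus>\<^bsub>Quo\<^esub> cls y = cls (x \<oplus>\<^bsub>M\<^esub> y)"
proof -
  have "cls x \<oplus>\<^bsub>Quo\<^esub> cls y = (\<Union>u\<in>cls x. \<Union>v\<in>cls y. {u \<oplus>\<^bsub>M\<^esub> v})"
    by (simp add: quotient_module_def set_add_def')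
  also have "\<dots> = cls (x \<oplus>\<^bsub>M\<^esub> y)"
  proof
    show "(\<Union>u\<in>cls x. \<Union>v\<in>cls y. {u \<oplus>\<^bsub>M\<^esub> v}) \<subseteq> cls (x \<oplus>\<^bsub>M\<^esub> y)"
      using x y by (auto simp: cls_def L_add)
    show "cls (x \<oplus>\<^bsub>M\<^esub> y) \<subseteq> (\<Union>u\<in>cls x. \<Union>v\<in>cls y. {u \<oplus>\<^bsub>M\<^esub> v})"
    proof
      fix t assume t: "t \<in> cls (x \<oplus>\<^bsub>M\<^esub> y)"
      then have tM: "t \<in> carrier M" by (simp add: cls_def)
      have "t \<oplus>\<^bsub>M\<^esub> (\<ominus>\<^bsub>M\<^esub> y) \<in> cls x"
        using x y t tM by (auto simp: cls_def L_add L_minus)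
      moreover have "t = (t \<oplus>\<^bsub>M\<^esub> (\<ominus>\<^bsub>M\<^esub> y)) \<oplus>\<^bsub>M\<^esub> y"
        using y tM by (simp add: a_assoc l_neg)
      ultimately show "t \<in> (\<Union>u\<in>cls x. \<Union>v\<in>cls y. {u \<oplus>\<^bsub>M\<^esub> v})"
        using cls_mem[OF y] by blast
    qed
  qed
  finally show ?thesis .
qed

text \<open>The quotient multiplies a coset by taking the union over all its representatives; by
  \<open>smult_cong\<close> the cosets in this union coincide.\<close>

lemma smult_Quo:
  assumes r: "r \<in> R" and x: "x \<in> carrier M"
  shows "r \<odot>\<^bsub>Quo\<^esub> cls x = cls (r \<odot>\<^bsub>M\<^esub> x)"
proof -
  have "N +>\<^bsub>M\<^esub> (r \<odot>\<^bsub>M\<^esub> y) = cls (r \<odot>\<^bsub>M\<^esub> x)" if y: "y \<in> cls x" for y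
  proof -
    have yM: "y \<in> carrier M" using y by (simp add: cls_def)
    have "L p (r \<odot>\<^bsub>M\<^esub> y) = L p (r \<odot>\<^bsub>M\<^esub> x)" if "p \<in> P" for p
      by (rule smult_cong[OF r yM x _ that]) (use y in \<open>simp add: cls_def\<close>)
    then show ?thesis
      using coset_eq_cls[OF smult_carrier[OF r yM]] cls_eq_iff[OF smult_carrier[OF r yM] smult_carrier[OF r x]]
      by simp
  qed
  then show ?thesis using cls_mem[OF x] by (auto simp: quotient_module_def)
qed

end

section \<open>Induced representations\<close>

text \<open>The functional \<alpha> \<otimes> \<beta> on the free abelian group, before passing to
  the tensor product.\<close>

definition tensor_functional ::
  "('s \<Rightarrow> complex) \<Rightarrow> ('m \<Rightarrow> complex) \<Rightarrow> (('s \<times> 'm) \<Rightarrow>\<^sub>0 int) \<Rightarrow> complex" where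
  "tensor_functional \<alpha> \<beta> c =
    (\<Sum>t\<in>keys c. of_int (lookup c t) * (\<alpha> (fst t) * \<beta> (snd t)))"

lemma tensor_functional_superset:
  assumes "finite A" "keys c \<subseteq> A"
  shows "tensor_functional \<alpha> \<beta> c = (\<Sum>t\<in>A. of_int (lookup c t) * (\<alpha> (fst t) * \<beta> (snd t)))"
  unfolding tensor_functional_def using assms
  by (intro sum.mono_neutral_left) (auto simp: in_keys_iff)

lemma tensor_functional_add:
  "tensor_functional \<alpha> \<beta> (c + d) = tensor_functional \<alpha> \<beta> c + tensor_functional \<alpha> \<beta> d"
proof -
  let ?A = "keys c \<union> keys d"
  have "keys (c + d) \<subseteq> ?A" by (rule keys_add)
  then show ?thesis
    by (simp add: tensor_functional_superset[of ?A] lookup_add algebra_simps sum.distrib)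
qed

lemma tensor_functional_zero [simp]: "tensor_functional \<alpha> \<beta> 0 = 0"
  by (simp add: tensor_functional_def)

lemma tensor_functional_uminus: "tensor_functional \<alpha> \<beta> (- c) = - tensor_functional \<alpha> \<beta> c"
  using tensor_functional_add[of \<alpha> \<beta> c "- c"] by (simp add: eq_neg_iff_add_eq_0 add.commute)

lemma tensor_functional_diff:
  "tensor_functional \<alpha> \<beta> (c - d) = tensor_functional \<alpha> \<beta> c - tensor_functional \<alpha> \<beta> d"
  using tensor_functional_add[of \<alpha> \<beta> c "- d"] by (simp add: tensor_functional_uminus)

lemma tensor_functional_sum: "tensor_functional \<alpha> \<beta> (\<Sum>i\<in>I. c i) = (\<Sum>i\<in>I. tensor_functional \<alpha> \<beta> (c i))"
  by (induction I rule: infinite_finite_induct) (auto simp: tensor_functional_add)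

lemma tensor_functional_single:
  "tensor_functional \<alpha> \<beta> (single (s, x) n) = of_int n * (\<alpha> s * \<beta> x)"
  by (cases "n = 0") (auto simp: tensor_functional_def)

locale induced_setup = add_group_pair G H + V: diagonalised H V J \<chi> f
  for G H :: "'g::ab_group_add set" and V :: "('g \<Rightarrow>\<^sub>0 complex, 'm) module" and J :: "'j set"
    and \<chi> :: "'j \<Rightarrow> 'g \<Rightarrow> complex" and f :: "'j \<Rightarrow> 'm \<Rightarrow> complex"
begin

abbreviation "Gens \<equiv> tensor_generators (group_alg G) V"
abbreviation "Rels \<equiv> tensor_relations (group_alg G) (group_alg H) V"

text \<open>Indexes an eigenbasis of the induced representation: by Frobenius reciprocity \<psi>
  occurs in the representation induced from \<chi> j exactly when it extends \<chi> j. The maps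
  \<open>F p\<close> are the coordinates.\<close>

definition J' :: "('j \<times> ('g \<Rightarrow> complex)) set" where
  "J' = (SIGMA j:J. char_exts G H (\<chi> j))"

definition F :: "'j \<times> ('g \<Rightarrow> complex) \<Rightarrow> ((('g \<Rightarrow>\<^sub>0 complex) \<times> 'm) \<Rightarrow>\<^sub>0 int) \<Rightarrow> complex" where
  "F p = tensor_functional (ev G (snd p)) (f (fst p))"

abbreviation t :: "('g \<Rightarrow>\<^sub>0 complex) \<Rightarrow> 'm \<Rightarrow> (('g \<Rightarrow>\<^sub>0 complex) \<times> 'm) \<Rightarrow>\<^sub>0 int" where
  "t s x \<equiv> single (s, x) 1"

lemma J'_D: "(j, \<psi>) \<in> J' \<Longrightarrow> j \<in> J \<and> \<psi> \<in> chars G \<and> (\<forall>h\<in>H. \<psi> h = \<chi> j h)"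
  by (auto simp: J'_def char_exts_def)

lemma finite_J': "finite J'"
  by (auto simp: J'_def V.finite_J)

lemma group_alg_mono: "r \<in> group_alg H \<Longrightarrow> r \<in> group_alg G"
  using H_subset by (auto simp: group_alg_def)

lemma ev_ext:
  assumes "(j, \<psi>) \<in> J'" "r \<in> group_alg H"
  shows "ev G \<psi> r = ev H (\<chi> j) r"
proof -
  have "ev G \<psi> r = (\<Sum>k\<in>H. lookup r k * \<psi> k)"
    unfolding ev_def using H_subset assms
    by (intro sum.mono_neutral_right) (auto simp: group_alg_iff)
  also have "\<dots> = ev H (\<chi> j) r"
    unfolding ev_def using J'_D[OF assms(1)] by (intro sum.cong) auto
  finally show ?thesis .
qed

section \<open>The relations of the tensor product as a common kernel\<close>

lemma Gens_simps [simp]: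
  "carrier Gens = {c. keys c \<subseteq> group_alg G \<times> carrier V}"
  "zero Gens = 0" "add Gens = (+)"
  by (simp_all add: tensor_generators_def)

lemma smult_Gens:
  "r \<odot>\<^bsub>Gens\<^esub> c = (\<Sum>t\<in>keys c.
      single (r * fst t, snd t) (lookup c t))"
  by (simp add: tensor_generators_def case_prod_beta)

lemma Rels_cases:
  assumes "c \<in> Rels"
  obtains (l_add) s s' x where "s \<in> group_alg G" "s' \<in> group_alg G" "x \<in> carrier V"
      "c = t (s + s') x - t s x - t s' x"
    | (r_add) s x x' where "s \<in> group_alg G" "x \<in> carrier V" "x' \<in> carrier V"
      "c = t s (x \<oplus>\<^bsub>V\<^esub> x') - t s x - t s x'"
    | (bal) s r x where "s \<in> group_alg G" "r \<in> group_alg H" "x \<in> carrier V"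
      "c = t (s * r) x - t s (r \<odot>\<^bsub>V\<^esub> x)"
  using assms unfolding tensor_relations_def Let_def
  by (elim UnE CollectE exE conjE) ((rule that(1); assumption) | (rule that(2); assumption) | (rule that(3); assumption))+

lemma t_carrier: "s \<in> group_alg G \<Longrightarrow> x \<in> carrier V \<Longrightarrow> t s x \<in> carrier Gens"
  by simp

lemma Gens_diff: "c \<in> carrier Gens \<Longrightarrow> d \<in> carrier Gens \<Longrightarrow> c - d \<in> carrier Gens"
  using keys_diff[of c d] by auto

lemma Gens_add: "c \<in> carrier Gens \<Longrightarrow> d \<in> carrier Gens \<Longrightarrow> c + d \<in> carrier Gens"
  using keys_add[of c d] by auto

lemma Gens_sum: "(\<And>i. i \<in> I \<Longrightarrow> c i \<in> carrier Gens) \<Longrightarrow> sum c I \<in> carrier Gens"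
proof (induction I rule: infinite_finite_induct)
  case (insert i I)
  then show ?case using Gens_add[of "c i" "sum c I"] by simp
qed simp_all

text \<open>The two additivity relations die for every character of \<open>G\<close>. The balancing
  relation is the one that requires \<psi> to extend \<chi> j.\<close>

lemma closure_subset_kernel:
  assumes "c \<in> group_closure Rels"
  shows "c \<in> carrier Gens \<and> (\<forall>p\<in>J'. F p c = 0)"
  using assms
proof induction
  case (base c)
  show ?case
  proof (cases "c = 0")
    case False
    with base have "c \<in> Rels" by simp
    then show ?thesis
    proof (cases rule: Rels_cases)
      case (l_add s s' x)
      have "c \<in> carrier Gens"
        unfolding l_add by (intro Gens_diff t_carrier) (use l_add in auto)
      moreover have "F p c = 0" for p
        unfolding l_add F_def by (simp add: tensor_functional_diff tensor_functional_single G.ev_add distrib_right)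
      ultimately show ?thesis by blast
    next
      case (r_add s x x')
      have "c \<in> carrier Gens"
        unfolding r_add by (intro Gens_diff t_carrier) (use r_add V.add_carrier in auto)
      moreover have "F p c = 0" if "p \<in> J'" for p
        using that r_add J'_D[of "fst p" "snd p"] unfolding r_add F_def
        by (simp add: tensor_functional_diff tensor_functional_single V.f_add distrib_left)
      ultimately show ?thesis by blast
    next
      case (bal s r x)
      note r' = group_alg_mono[OF bal(2)]
      have "c \<in> carrier Gens"
        unfolding bal using bal r' V.smult_carrier by (intro Gens_diff t_carrier) auto
      moreover have "F p c = 0" if "p \<in> J'" for p
        using that bal r' J'_D[of "fst p" "snd p"] ev_ext[of "fst p" "snd p" r] unfolding bal F_def
        by (simp add: tensor_functional_diff tensor_functional_single V.f_smult G.ev_mult)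
      ultimately show ?thesis by blast
    qed
  qed (simp add: F_def)
next
  case (diff c d)
  then show ?case using Gens_diff[of c d] by (auto simp: F_def tensor_functional_diff)
qed

definition eqv (infix "\<approx>" 50) where
  "c \<approx> d \<longleftrightarrow> c - d \<in> group_closure Rels"

lemma eqv_refl [simp]: "c \<approx> c"
  by (simp add: eqv_def)

lemma eqv_trans [trans]: "c \<approx> d \<Longrightarrow> d \<approx> e \<Longrightarrow> c \<approx> e"
  using group_closure_add[of "c - d" Rels "d - e"] by (simp add: eqv_def)

lemma eqv_diff: "c \<approx> d \<Longrightarrow> c' \<approx> d' \<Longrightarrow> c - c' \<approx> d - d'"
  using group_closure.diff[of "c - d" Rels "c' - d'"] by (simp add: eqv_def algebra_simps)

lemma eqv_add: "c \<approx> d \<Longrightarrow> c' \<approx> d' \<Longrightarrow> c + c' \<approx> d + d'"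
  using group_closure_add[of "c - d" Rels "c' - d'"] by (simp add: eqv_def algebra_simps)

lemma eqv_sum: "(\<And>i. i \<in> I \<Longrightarrow> c i \<approx> d i) \<Longrightarrow> sum c I \<approx> sum d I"
  by (induction I rule: infinite_finite_induct) (auto intro: eqv_add)

lemma eqv_sym: "c \<approx> d \<Longrightarrow> d \<approx> c"
  unfolding eqv_def by (metis group_closure_minus_iff minus_diff_eq)

lemma t_add_left:
  "s \<in> group_alg G \<Longrightarrow> s' \<in> group_alg G \<Longrightarrow> x \<in> carrier V \<Longrightarrow> t (s + s') x \<approx> t s x + t s' x"
  unfolding eqv_def
  by (rule group_closure.base) (auto simp: tensor_relations_def Let_def diff_diff_add[symmetric])

lemma t_add_right:
  "s \<in> group_alg G \<Longrightarrow> x \<in> carrier V \<Longrightarrow> x' \<in> carrier V \<Longrightarrow> t s (x \<oplus>\<^bsub>V\<^esub> x') \<approx> t s x + t s x'"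
  unfolding eqv_def
  by (rule group_closure.base) (auto simp: tensor_relations_def Let_def diff_diff_add[symmetric])

lemma t_balanced:
  "s \<in> group_alg G \<Longrightarrow> r \<in> group_alg H \<Longrightarrow> x \<in> carrier V \<Longrightarrow> t (s * r) x \<approx> t s (r \<odot>\<^bsub>V\<^esub> x)"
  unfolding eqv_def
  by (rule group_closure.base) (auto simp: tensor_relations_def Let_def)

lemma eqv_zero_if_double: "c \<approx> c + c \<Longrightarrow> c \<approx> 0"
  by (simp add: eqv_def)

lemma t_zero_left: "x \<in> carrier V \<Longrightarrow> t 0 x \<approx> 0"
  using t_add_left[of 0 0 x] by (intro eqv_zero_if_double) simp

lemma t_zero_right:
  assumes "s \<in> group_alg G"
  shows "t s \<zero>\<^bsub>V\<^esub> \<approx> 0"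
proof (rule eqv_zero_if_double)
  interpret abelian_monoid V by (rule V.abelian_monoid_V)
  show "t s \<zero>\<^bsub>V\<^esub> \<approx> t s \<zero>\<^bsub>V\<^esub> + t s \<zero>\<^bsub>V\<^esub>"
    using t_add_right[OF assms zero_closed zero_closed] by simp
qed

lemma t_sum_left:
  assumes x: "x \<in> carrier V" and "finite I" "\<And>i. i \<in> I \<Longrightarrow> s i \<in> group_alg G"
  shows "t (\<Sum>i\<in>I. s i) x \<approx> (\<Sum>i\<in>I. t (s i) x)"
  using assms(2,3)
proof (induction I)
  case empty
  then show ?case using t_zero_left[OF x] by simp
next
  case (insert i I)
  have "t (s i + (\<Sum>i\<in>I. s i)) x \<approx> t (s i) x + t (\<Sum>i\<in>I. s i) x"
    using insert x by (intro t_add_left) auto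
  also have "\<dots> \<approx> t (s i) x + (\<Sum>i\<in>I. t (s i) x)"
    using insert by (intro eqv_add) auto
  finally show ?case using insert by simp
qed

lemma t_sum_right:
  assumes s: "s \<in> group_alg G" and "finite I" "\<And>i. i \<in> I \<Longrightarrow> x i \<in> carrier V"
  shows "t s (\<Oplus>\<^bsub>V\<^esub>i\<in>I. x i) \<approx> (\<Sum>i\<in>I. t s (x i))"
  using assms(2,3)
proof (induction I)
  interpret abelian_monoid V by (rule V.abelian_monoid_V)
  {
    case empty
    then show ?case using t_zero_right[OF s] by simp
  next
    case (insert i I)
    have "(\<Oplus>\<^bsub>V\<^esub>i\<in>insert i I. x i) = x i \<oplus>\<^bsub>V\<^esub> (\<Oplus>\<^bsub>V\<^esub>i\<in>I. x i)"
      using insert by (intro finsum_insert) auto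
    moreover have "t s (x i \<oplus>\<^bsub>V\<^esub> (\<Oplus>\<^bsub>V\<^esub>i\<in>I. x i)) \<approx> t s (x i) + t s (\<Oplus>\<^bsub>V\<^esub>i\<in>I. x i)"
      using insert s by (intro t_add_right finsum_closed) auto
    moreover have "\<dots> \<approx> t s (x i) + (\<Sum>i\<in>I. t s (x i))"
      using insert by (intro eqv_add) auto
    ultimately show ?case using insert eqv_trans by simp
  }
qed

text \<open>The eigenbasis of \<open>V\<close> dual to the coordinates \<open>f\<close>.\<close>

definition basis :: "'j \<Rightarrow> 'm" where
  "basis j = (SOME x. x \<in> carrier V \<and> (\<forall>k\<in>J. f k x = (if k = j then 1 else 0)))"

lemma basis: "basis j \<in> carrier V" "k \<in> J \<Longrightarrow> f k (basis j) = (if k = j then 1 else 0)"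
proof -
  have "\<exists>x. x \<in> carrier V \<and> (\<forall>k\<in>J. f k x = (if k = j then 1 else 0))"
    using V.f_surj[of "\<lambda>k. if k = j then 1 else 0"] by blast
  from someI_ex[OF this] show "basis j \<in> carrier V" "k \<in> J \<Longrightarrow> f k (basis j) = (if k = j then 1 else 0)"
    unfolding basis_def by auto
qed

text \<open>Represents z times the basis tensor of the idempotent of \<psi> with
  \<open>basis j\<close>. The complex factor sits in the left entry because the free group has
  integer coefficients only; hence \<open>u p\<close> is additive in z only modulo the
  relations.\<close>

definition u :: "'j \<times> ('g \<Rightarrow> complex) \<Rightarrow> complex \<Rightarrow> (('g \<Rightarrow>\<^sub>0 complex) \<times> 'm) \<Rightarrow>\<^sub>0 int" where
  "u p z = t (scalar z * G.idem (snd p)) (basis (fst p))"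

lemma scalar_idem_mem [simp]: "scalar z * G.idem \<psi> \<in> group_alg G"
  by auto

lemma u_carrier: "u p z \<in> carrier Gens"
  unfolding u_def by (rule t_carrier) (simp_all add: basis)

lemma u_add: "u p (y + z) \<approx> u p y + u p z"
  unfolding u_def using t_add_left[OF scalar_idem_mem scalar_idem_mem basis(1)]
  by (simp add: single_add distrib_right)

lemma F_u:
  assumes "p \<in> J'" "q \<in> J'"
  shows "F p (u q z) = (if p = q then z else 0)"
  using assms J'_D[of "fst p" "snd p"] J'_D[of "fst q" "snd q"]
  by (auto simp: F_def u_def tensor_functional_single G.ev_mult G.ev_scalar G.ev_idem G.idem_mem basis prod_eq_iff)

text \<open>If \<psi> and \<chi> j differ at \<open>h\<close>, then r = (h - \<chi> j h)/(\<psi> h -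
  \<chi> j h) in the group algebra of \<open>H\<close> has value 1 at \<psi> and 0 at \<chi> j. So r
  is absorbed by the idempotent of \<psi> on the left, and after balancing it kills
  \<open>basis j\<close> on the right.\<close>

lemma u_vanishes:
  assumes j: "j \<in> J" and \<psi>: "\<psi> \<in> chars G" and "(j, \<psi>) \<notin> J'"
  shows "u (j, \<psi>) z \<approx> 0"
proof -
  obtain h where h: "h \<in> H" "\<psi> h \<noteq> \<chi> j h"
    using assms by (auto simp: J'_def char_exts_def)
  have hG: "h \<in> G" using h H_subset by auto
  define q where "q = 1 / (\<psi> h - \<chi> j h)"
  define r where "r = single h q - scalar (q * \<chi> j h)"
  have r: "r \<in> group_alg H" unfolding r_def using h by (intro H.A.diff_mem) auto
  have "ev H (\<chi> j) r = 0"
    using h V.chars[OF j] by (simp add: r_def H.ev_diff H.ev_single H.char_zero)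
  then have "r \<odot>\<^bsub>V\<^esub> basis j = \<zero>\<^bsub>V\<^esub>"
    using r basis V.smult_carrier V.zero_carrier
    by (intro V.f_inj) (auto simp: V.f_smult V.f_zero)
  moreover have "ev G \<psi> r = 1"
    using hG \<psi> h by (simp add: r_def G.ev_diff G.ev_single G.char_zero q_def diff_divide_distrib[symmetric])
  then have "r * G.idem \<psi> = G.idem \<psi>"
    using G.mult_idem[OF \<psi> group_alg_mono[OF r]] by simp
  then have "scalar z * G.idem \<psi> = (scalar z * G.idem \<psi>) * r"
    by (metis mult.assoc mult.commute)
  ultimately have "u (j, \<psi>) z \<approx> t (scalar z * G.idem \<psi>) \<zero>\<^bsub>V\<^esub>"
    using t_balanced[OF scalar_idem_mem r basis(1), of z \<psi> j] by (simp add: u_def)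
  also have "\<dots> \<approx> 0" by (rule t_zero_right) simp
  finally show ?thesis .
qed

text \<open>Expand \<open>x\<close> in the eigenbasis, move the scalars to the left factor and
  insert the sum of all idempotents of \<open>G\<close> there. Each idempotent turns
  \<open>s\<close> into a number, and the characters that do not extend \<chi> j contribute nothing
  by \<open>u_vanishes\<close>.\<close>

lemma t_normal_form:
  assumes s: "s \<in> group_alg G" and x: "x \<in> carrier V"
  shows "t s x \<approx> (\<Sum>p\<in>J'. u p (F p (t s x)))"
proof -
  have x_eq: "x = (\<Oplus>\<^bsub>V\<^esub>j\<in>J. scalar (f j x) \<odot>\<^bsub>V\<^esub> basis j)"
  proof (rule V.f_inj[OF x])
    show mem: "(\<Oplus>\<^bsub>V\<^esub>j\<in>J. scalar (f j x) \<odot>\<^bsub>V\<^esub> basis j) \<in> carrier V"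
      by (intro V.finsum_carrier V.smult_carrier basis) simp
    fix k assume k: "k \<in> J"
    have "f k (\<Oplus>\<^bsub>V\<^esub>j\<in>J. scalar (f j x) \<odot>\<^bsub>V\<^esub> basis j) = (\<Sum>j\<in>J. f j x * (if k = j then 1 else 0))"
      using k V.chars by (simp add: V.f_finsum V.finite_J V.smult_carrier V.f_smult basis H.ev_scalar)
    also have "\<dots> = f k x"
      using k V.finite_J by (simp add: if_distrib[of "\<lambda>y. _ * y"] cong: if_cong)
    finally show "f k x = f k (\<Oplus>\<^bsub>V\<^esub>j\<in>J. scalar (f j x) \<odot>\<^bsub>V\<^esub> basis j)" ..
  qed
  have "t s (\<Oplus>\<^bsub>V\<^esub>j\<in>J. scalar (f j x) \<odot>\<^bsub>V\<^esub> basis j) \<approx>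
      (\<Sum>j\<in>J. t s (scalar (f j x) \<odot>\<^bsub>V\<^esub> basis j))"
    by (rule t_sum_right[OF s V.finite_J]) (simp add: V.smult_carrier basis)
  then have "t s x \<approx> (\<Sum>j\<in>J. t s (scalar (f j x) \<odot>\<^bsub>V\<^esub> basis j))"
    by (simp only: x_eq[symmetric])
  also have "\<dots> \<approx> (\<Sum>j\<in>J. t (s * scalar (f j x)) (basis j))"
    using s by (intro eqv_sum eqv_sym[OF t_balanced]) (auto simp: basis)
  also have "\<dots> \<approx> (\<Sum>j\<in>J. \<Sum>\<psi>\<in>chars G. t (s * scalar (f j x) * G.idem \<psi>) (basis j))"
  proof (rule eqv_sum)
    fix j assume "j \<in> J"
    have "s * scalar (f j x) = (\<Sum>\<psi>\<in>chars G. s * scalar (f j x) * G.idem \<psi>)"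
      by (simp add: sum_distrib_left[symmetric] G.sum_idem)
    then show "t (s * scalar (f j x)) (basis j) \<approx> (\<Sum>\<psi>\<in>chars G. t (s * scalar (f j x) * G.idem \<psi>) (basis j))"
      using t_sum_left[OF basis(1) G.finite_chars, of "\<lambda>\<psi>. s * scalar (f j x) * G.idem \<psi>"] s by auto
  qed
  also have "\<dots> = (\<Sum>j\<in>J. \<Sum>\<psi>\<in>chars G. u (j, \<psi>) (ev G \<psi> s * f j x))"
  proof (intro sum.cong refl)
    fix j \<psi> assume \<psi>: "\<psi> \<in> chars G"
    have m: "s * scalar (f j x) \<in> group_alg G" using s by auto
    have "s * scalar (f j x) * G.idem \<psi> = scalar (ev G \<psi> s * f j x) * G.idem \<psi>"
      using G.mult_idem[OF \<psi> m] \<psi> s by (simp add: G.ev_mult G.ev_scalar)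
    then show "t (s * scalar (f j x) * G.idem \<psi>) (basis j) = u (j, \<psi>) (ev G \<psi> s * f j x)"
      by (simp add: u_def)
  qed
  also have "\<dots> = (\<Sum>p\<in>J \<times> chars G. u p (ev G (snd p) s * f (fst p) x))"
    by (simp add: sum.cartesian_product case_prod_beta)
  also have "\<dots> \<approx> (\<Sum>p\<in>J \<times> chars G. if p \<in> J' then u p (ev G (snd p) s * f (fst p) x) else 0)"
    by (intro eqv_sum) (auto intro: u_vanishes)
  also have "\<dots> = (\<Sum>p\<in>J'. u p (ev G (snd p) s * f (fst p) x))"
    using V.finite_J by (intro sum.mono_neutral_cong_right) (auto simp: J'_def char_exts_def)
  also have "\<dots> = (\<Sum>p\<in>J'. u p (F p (t s x)))"
    by (simp add: F_def tensor_functional_single)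
  finally show ?thesis .
qed

lemma u_zero: "u p 0 \<approx> 0"
  unfolding u_def using t_zero_left[OF basis(1)] by simp

lemma u_uminus: "u p (- z) \<approx> - u p z"
proof -
  have "u p 0 \<approx> u p (- z) + u p z" using u_add[of p "- z" z] by simp
  then have "u p (- z) + u p z \<approx> 0" by (rule eqv_trans[OF eqv_sym u_zero])
  from eqv_diff[OF this eqv_refl[of "u p z"]] show ?thesis by simp
qed

text \<open>Induction over the free abelian group by generators and differences. The right-hand side
  is additive in \<open>c\<close> only modulo the relations, which is why the difference step uses
  \<open>u_add\<close> and \<open>u_uminus\<close>.\<close>

lemma normal_form:
  assumes "c \<in> carrier Gens"
  shows "c \<approx> (\<Sum>p\<in>J'. u p (F p c))"
proof -
  have "keys c \<subseteq> group_alg G \<times> carrier V" using assms by simp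
  then show ?thesis
  proof (induction rule: frag_induction)
    case zero
    have "(\<Sum>p\<in>J'. u p (F p 0)) \<approx> (\<Sum>p\<in>J'. 0)"
      by (rule eqv_sum) (simp add: F_def u_zero)
    from eqv_sym[OF this] show ?case by simp
  next
    case (one x)
    then show ?case using t_normal_form[of "fst x" "snd x"] by auto
  next
    case (diff a b)
    have "a - b \<approx> (\<Sum>p\<in>J'. u p (F p a)) - (\<Sum>p\<in>J'. u p (F p b))"
      using diff by (rule eqv_diff)
    also have "\<dots> = (\<Sum>p\<in>J'. u p (F p a) + - u p (F p b))"
      by (simp add: sum_subtractf)
    also have "\<dots> \<approx> (\<Sum>p\<in>J'. u p (F p (a - b)))"
    proof (rule eqv_sum)
      fix p
      have "u p (F p a + - F p b) \<approx> u p (F p a) + u p (- F p b)" by (rule u_add)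
      also have "\<dots> \<approx> u p (F p a) + - u p (F p b)"
        by (intro eqv_add u_uminus) simp
      finally have "u p (F p (a - b)) \<approx> u p (F p a) + - u p (F p b)"
        by (simp add: F_def tensor_functional_diff)
      then show "u p (F p a) + - u p (F p b) \<approx> u p (F p (a - b))" by (rule eqv_sym)
    qed
    finally show ?case .
  qed
qed

text \<open>The upper bound for the tensor product: an element with vanishing coordinates has a
  normal form made of terms \<open>u p 0\<close>, which are congruent to 0. It is what makes
  \<open>kernel_quotient\<close> applicable.\<close>

lemma closure_eq_kernel: "group_closure Rels = {c \<in> carrier Gens. \<forall>p\<in>J'. F p c = 0}"
proof (intro equalityI subsetI)
  fix c assume "c \<in> group_closure Rels"
  then show "c \<in> {c \<in> carrier Gens. \<forall>p\<in>J'. F p c = 0}" using closure_subset_kernel by blast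
next
  fix c assume c: "c \<in> {c \<in> carrier Gens. \<forall>p\<in>J'. F p c = 0}"
  then have "c \<approx> (\<Sum>p\<in>J'. u p (F p c))" by (intro normal_form) simp
  also have "\<dots> \<approx> (\<Sum>p\<in>J'. 0)" by (rule eqv_sum) (use c u_zero in auto)
  finally show "c \<in> group_closure Rels" by (simp add: eqv_def)
qed

lemma smult_Gens_carrier:
  assumes "r \<in> group_alg G" "c \<in> carrier Gens"
  shows "r \<odot>\<^bsub>Gens\<^esub> c \<in> carrier Gens"
  unfolding smult_Gens
proof (rule Gens_sum)
  fix k assume "k \<in> keys c"
  then have "fst k \<in> group_alg G" "snd k \<in> carrier V" using assms by auto
  then show "single (r * fst k, snd k) (lookup c k) \<in> carrier Gens"
    using assms by auto
qed

lemma F_smult: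
  assumes p: "p \<in> J'" and r: "r \<in> group_alg G" and c: "c \<in> carrier Gens"
  shows "F p (r \<odot>\<^bsub>Gens\<^esub> c) = ev G (snd p) r * F p c"
proof -
  have \<psi>: "snd p \<in> chars G" using p J'_D[of "fst p" "snd p"] by simp
  have "fst k \<in> group_alg G" if "k \<in> keys c" for k using c that by auto
  then show ?thesis
    using r \<psi> unfolding smult_Gens F_def tensor_functional_sum tensor_functional_single
    by (simp add: tensor_functional_def[of _ _ c] sum_distrib_left G.ev_mult mult_ac)
qed

lemma Gens_abelian_group: "abelian_group Gens"
  by (rule abelian_group_of_type) (use Gens_add in auto)

sublocale Q: kernel_quotient Gens J' F "group_closure Rels" "group_alg G"
proof -
  interpret abelian_group Gens by (rule Gens_abelian_group)
  show "kernel_quotient Gens J' F (group_closure Rels) (group_alg G)"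
  proof
    show "F p (x \<oplus>\<^bsub>Gens\<^esub> y) = F p x + F p y" for p x y
      by (simp add: F_def tensor_functional_add)
  qed (use closure_eq_kernel smult_Gens_carrier F_smult in auto)
qed

lemma induced_diagonalised: "diagonalised G (induced_rep G H V) J' snd Q.lift"
proof -
  have Ind: "induced_rep G H V = Q.Quo" by (simp add: induced_rep_def extend_scalars_def)
  note Quo = Q.carrier_Quo
  show ?thesis
    unfolding Ind
  proof
    show "finite J'" by (rule finite_J')
    show "\<zero>\<^bsub>Q.Quo\<^esub> \<in> carrier Q.Quo" by (simp add: Q.zero_Quo Quo)
    fix X assume "X \<in> carrier Q.Quo"
    then obtain x where x: "x \<in> carrier Gens" "X = Q.cls x" unfolding Quo by blast
    show "a \<odot>\<^bsub>Q.Quo\<^esub> X \<in> carrier Q.Quo" if "a \<in> group_alg G" for a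
      unfolding x Q.smult_Quo[OF that x(1)] Quo using smult_Gens_carrier[OF that x(1)] by blast
    show "Q.lift p (a \<odot>\<^bsub>Q.Quo\<^esub> X) = ev G (snd p) a * Q.lift p X"
      if p: "p \<in> J'" and a: "a \<in> group_alg G" for p a
      unfolding x Q.smult_Quo[OF a x(1)]
      by (simp only: Q.lift_cls[OF p smult_Gens_carrier[OF a x(1)]] Q.lift_cls[OF p x(1)] F_smult[OF p a x(1)])
    fix Y assume "Y \<in> carrier Q.Quo"
    then obtain y where y: "y \<in> carrier Gens" "Y = Q.cls y" unfolding Quo by blast
    have xy: "x \<oplus>\<^bsub>Gens\<^esub> y \<in> carrier Gens" using Gens_add[OF x(1) y(1)] by simp
    show "X \<oplus>\<^bsub>Q.Quo\<^esub> Y \<in> carrier Q.Quo"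
      unfolding x y Q.add_Quo[OF x(1) y(1)] Quo using xy by blast
    show "Q.lift p (X \<oplus>\<^bsub>Q.Quo\<^esub> Y) = Q.lift p X + Q.lift p Y" if p: "p \<in> J'" for p
      unfolding x y Q.add_Quo[OF x(1) y(1)]
      by (simp only: Q.lift_cls[OF p xy] Q.lift_cls[OF p x(1)] Q.lift_cls[OF p y(1)] Q.L_add[OF p x(1) y(1)])
    assume "\<And>p. p \<in> J' \<Longrightarrow> Q.lift p X = Q.lift p Y"
    then show "X = Y"
      unfolding x y using Q.cls_eq_iff[OF x(1) y(1)] Q.lift_cls x(1) y(1) by auto
  next
    fix p assume p: "p \<in> J'"
    show "snd p \<in> chars G" using p J'_D[of "fst p" "snd p"] by simp
    show "Q.lift p \<zero>\<^bsub>Q.Quo\<^esub> = 0"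
      using Q.lift_cls[OF p, of 0] by (simp add: Q.zero_Quo F_def)
  next
    fix z
    define c where "c = (\<Sum>p\<in>J'. u p (z p))"
    have c: "c \<in> carrier Gens" unfolding c_def by (intro Gens_sum u_carrier)
    have "F q c = z q" if q: "q \<in> J'" for q
    proof -
      have "F q c = (\<Sum>p\<in>J'. F q (u p (z p)))" by (simp add: c_def F_def tensor_functional_sum)
      also have "\<dots> = (\<Sum>p\<in>J'. if q = p then z p else 0)"
        using q by (intro sum.cong) (auto simp: F_u)
      also have "\<dots> = z q" using q finite_J' by simp
      finally show ?thesis .
    qed
    then have "\<forall>p\<in>J'. Q.lift p (Q.cls c) = z p" using Q.lift_cls c by simp
    then show "\<exists>x\<in>carrier Q.Quo. \<forall>p\<in>J'. Q.lift p x = z p"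
      unfolding Quo using c by blast
  qed
qed

end

section \<open>Permutation-like modules\<close>

locale finite_action = finite_add_group K
  for K :: "'g::ab_group_add set" +
  fixes X :: "'x set" and \<sigma> :: "'g \<Rightarrow> 'x \<Rightarrow> 'x"
  assumes finite_X: "finite X"
    and act_zero: "x \<in> X \<Longrightarrow> \<sigma> 0 x = x"
    and act_add: "g \<in> K \<Longrightarrow> h \<in> K \<Longrightarrow> x \<in> X \<Longrightarrow> \<sigma> (g + h) x = \<sigma> g (\<sigma> h x)"
    and act_mem: "g \<in> K \<Longrightarrow> x \<in> X \<Longrightarrow> \<sigma> g x \<in> X"
begin

lemma act_uminus_left: "g \<in> K \<Longrightarrow> x \<in> X \<Longrightarrow> \<sigma> (- g) (\<sigma> g x) = x"
  using act_add[of "- g" g x] uminus_K[of g] by (simp add: act_zero)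

lemma act_uminus_right: "g \<in> K \<Longrightarrow> x \<in> X \<Longrightarrow> \<sigma> g (\<sigma> (- g) x) = x"
  using act_add[of g "- g" x] uminus_K[of g] by (simp add: act_zero)

lemma act_eq_iff: "g \<in> K \<Longrightarrow> x \<in> X \<Longrightarrow> y \<in> X \<Longrightarrow> \<sigma> g x = y \<longleftrightarrow> x = \<sigma> (- g) y"
  using act_uminus_left act_uminus_right by metis

lemma act_inj: "g \<in> K \<Longrightarrow> x \<in> X \<Longrightarrow> y \<in> X \<Longrightarrow> \<sigma> g x = \<sigma> g y \<longleftrightarrow> x = y"
  using act_uminus_left by metis

lemma bij_betw_act: "g \<in> K \<Longrightarrow> bij_betw (\<sigma> g) X X"
  by (rule bij_betw_byWitness[where f' = "\<sigma> (- g)"])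
    (auto simp: act_uminus_left act_uminus_right act_mem uminus_K)

lemma sum_act: "g \<in> K \<Longrightarrow> (\<Sum>x\<in>X. F (\<sigma> g x)) = (\<Sum>x\<in>X. F x)"
  by (rule sum.reindex_bij_betw[OF bij_betw_act])

lemma sum_K_translate: "g \<in> K \<Longrightarrow> (\<Sum>k\<in>K. F (g + k)) = (\<Sum>k\<in>K. F k)"
  by (rule sum.reindex_bij_betw[OF bij_betw_translate])

lemma sum_K_reflect:
  assumes "g \<in> K"
  shows "(\<Sum>k\<in>K. F (g - k)) = (\<Sum>k\<in>K. F k)"
proof -
  have "bij_betw (\<lambda>k. g - k) K K"
    by (rule bij_betw_byWitness[where f' = "\<lambda>k. g - k"]) (use assms in auto)
  then show ?thesis by (rule sum.reindex_bij_betw)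
qed

definition n where "n = card X"

definition enum :: "nat \<Rightarrow> 'x" where
  "enum = (SOME b. bij_betw b {..<n} X)"

lemma bij_betw_enum: "bij_betw enum {..<n} X"
proof -
  have "\<exists>b. bij_betw b {..<n} X"
    using ex_bij_betw_nat_finite[OF finite_X] by (simp add: n_def atLeast0LessThan)
  then show ?thesis unfolding enum_def by (rule someI_ex)
qed

lemma enum_mem: "r < n \<Longrightarrow> enum r \<in> X"
  using bij_betw_enum by (auto simp: bij_betw_def)

lemma enum_inj: "r < n \<Longrightarrow> s < n \<Longrightarrow> enum r = enum s \<longleftrightarrow> r = s"
  using bij_betw_enum by (auto simp: bij_betw_def inj_on_def)

lemma enum_surj: "x \<in> X \<Longrightarrow> \<exists>r<n. x = enum r"
  using bij_betw_imp_surj_on[OF bij_betw_enum] by (metis imageE lessThan_iff)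

lemma sum_enum: "(\<Sum>r<n. F (enum r)) = (\<Sum>x\<in>X. F x)"
  by (rule sum.reindex_bij_betw[OF bij_betw_enum])

definition avg :: "('g \<Rightarrow> complex) \<Rightarrow> 'g \<Rightarrow>\<^sub>0 complex" where
  "avg F = (\<Sum>k\<in>K. single k (F k / of_nat (card K)))"

lemma avg_mem [intro]: "avg F \<in> group_alg K"
  unfolding avg_def by (intro A.sum_mem single_mem)

lemma lookup_avg: "lookup (avg F) k = (if k \<in> K then F k / of_nat (card K) else 0)"
  by (simp add: avg_def lookup_sum lookup_single when_def)

lemma group_alg_eqI:
  "a \<in> group_alg K \<Longrightarrow> b \<in> group_alg K \<Longrightarrow>
    (\<And>k. k \<in> K \<Longrightarrow> lookup a k = lookup b k) \<Longrightarrow> a = b"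
  by (rule poly_mapping_eqI) (metis group_alg_iff)

lemma ev_avg: "ev K \<psi> (avg F) = (\<Sum>k\<in>K. F k * \<psi> k) / of_nat (card K)"
  by (simp add: ev_def lookup_avg sum_divide_distrib)

definition avg_mat :: "('x \<Rightarrow> 'x \<Rightarrow> complex) \<Rightarrow> ('g \<Rightarrow>\<^sub>0 complex) mat" where
  "avg_mat e = mat n n (\<lambda>(r, s). avg (\<lambda>k. e (\<sigma> k (enum r)) (enum s)))"

end

text \<open>
  \<open>M\<close> is presented as the image of the idempotent kernel \<open>e\<close> on functions on \<open>X\<close>, through the
  coordinate functionals \<open>L x\<close>. Averaging over \<open>K\<close> turns the complex-linear embedding into a
  \<open>\<complex>[K]\<close>-linear one.
\<close>

locale permutation_like = finite_action K X \<sigma>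
  for K :: "'g::ab_group_add set" and X :: "'x set" and \<sigma> +
  fixes M :: "('g \<Rightarrow>\<^sub>0 complex, 'm) module" and L :: "'x \<Rightarrow> 'm \<Rightarrow> complex" and e :: "'x \<Rightarrow> 'x \<Rightarrow> complex"
  assumes zero_carrier: "\<zero>\<^bsub>M\<^esub> \<in> carrier M"
    and add_carrier: "m \<in> carrier M \<Longrightarrow> m' \<in> carrier M \<Longrightarrow> m \<oplus>\<^bsub>M\<^esub> m' \<in> carrier M"
    and smult_carrier: "a \<in> group_alg K \<Longrightarrow> m \<in> carrier M \<Longrightarrow> a \<odot>\<^bsub>M\<^esub> m \<in> carrier M"
    and L_zero: "y \<in> X \<Longrightarrow> L y \<zero>\<^bsub>M\<^esub> = 0"
    and L_add: "y \<in> X \<Longrightarrow> m \<in> carrier M \<Longrightarrow> m' \<in> carrier M \<Longrightarrow> L y (m \<oplus>\<^bsub>M\<^esub> m') = L y m + L y m'"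
    and L_smult: "y \<in> X \<Longrightarrow> a \<in> group_alg K \<Longrightarrow> m \<in> carrier M \<Longrightarrow>
      L y (a \<odot>\<^bsub>M\<^esub> m) = (\<Sum>k\<in>K. lookup a k * L (\<sigma> (- k) y) m)"
    and L_inj: "m \<in> carrier M \<Longrightarrow> m' \<in> carrier M \<Longrightarrow> (\<And>y. y \<in> X \<Longrightarrow> L y m = L y m') \<Longrightarrow> m = m'"
    and e_equivariant: "k \<in> K \<Longrightarrow> x \<in> X \<Longrightarrow> y \<in> X \<Longrightarrow> e (\<sigma> k y) (\<sigma> k x) = e y x"
    and e_L: "m \<in> carrier M \<Longrightarrow> y \<in> X \<Longrightarrow> (\<Sum>x\<in>X. e y x * L x m) = L y m"
    and e_surj: "\<exists>m\<in>carrier M. \<forall>y\<in>X. L y m = (\<Sum>x\<in>X. e y x * z x)"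
begin

text \<open>A section of the \<complex>[K]-linear surjection from the free module onto
  \<open>M\<close> that sends the unit vector with index s to the point \<open>enum s\<close>,
  projected by \<open>e\<close>. The factor 1/|K| in \<open>avg\<close> makes it a section, and
  \<open>avg_mat e\<close> is the surjection followed by \<open>emb\<close>.\<close>

definition emb :: "'m \<Rightarrow> ('g \<Rightarrow>\<^sub>0 complex) vec" where
  "emb m = vec n (\<lambda>r. avg (\<lambda>k. L (\<sigma> k (enum r)) m))"

lemma emb_rvecs: "emb m \<in> rvecs (group_alg K) n"
  by (auto simp: emb_def rvecs_def)

text \<open>The sum over \<open>l\<close> is the coefficient at \<open>x\<close> of the complex
  chain represented by \<open>v\<close>: the term \<open>l\<close> in position s contributes to the
  point obtained from \<open>enum s\<close> by acting with \<open>l\<close>. The kernel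
  \<open>e\<close> then projects this chain.\<close>

lemma avg_mat_mult_vec:
  assumes v: "v \<in> rvecs (group_alg K) n" and r: "r < n" and k: "k \<in> K"
  shows "lookup ((avg_mat e *\<^sub>v v) $ r) k =
    (\<Sum>x\<in>X. e (\<sigma> k (enum r)) x *
      (\<Sum>l\<in>K. lookup (v $ (inv_into {..<n} enum (\<sigma> (- l) x))) l)) / of_nat (card K)"
proof -
  define w where "w x l = lookup (v $ inv_into {..<n} enum x) l" for x l
  have w_enum: "lookup (v $ s) l = w (enum s) l" if "s < n" for s l
    using bij_betw_enum that by (simp add: w_def bij_betw_def inv_into_f_f)
  let ?y = "enum r"
  have y: "?y \<in> X" by (rule enum_mem[OF r])
  have "lookup ((avg_mat e *\<^sub>v v) $ r) k =
      (\<Sum>s<n. lookup (avg (\<lambda>k. e (\<sigma> k ?y) (enum s)) * v $ s) k)"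
  proof -
    have "v \<in> carrier_vec n" using v by (simp add: rvecs_def)
    then have "(avg_mat e *\<^sub>v v) $ r = (\<Sum>s<n. avg (\<lambda>k. e (\<sigma> k ?y) (enum s)) * v $ s)"
      using r by (auto simp: avg_mat_def scalar_prod_def atLeast0LessThan intro!: sum.cong)
    then show ?thesis by (simp add: lookup_sum)
  qed
  also have "\<dots> = (\<Sum>s<n. \<Sum>g\<in>K. e (\<sigma> g ?y) (enum s) * w (enum s) (k - g) / of_nat (card K))"
    by (intro sum.cong) (auto simp: lookup_group_alg_mult[OF avg_mem] lookup_avg w_enum)
  also have "\<dots> = (\<Sum>x\<in>X. \<Sum>g\<in>K. e (\<sigma> g ?y) x * w x (k - g) / of_nat (card K))"
    by (rule sum_enum)
  \<comment> \<open>Substitute g = k - l so that the coefficient of \<open>v\<close> at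
    \<open>l\<close> appears. Moving \<open>x\<close> by \<open>- l\<close> and using equivariance
    then frees \<open>e\<close> from \<open>l\<close>.\<close>
  also have "\<dots> = (\<Sum>x\<in>X. \<Sum>l\<in>K. e (\<sigma> (k - l) ?y) x * w x (k - (k - l)) / of_nat (card K))"
    by (intro sum.cong refl sum_K_reflect[OF k, symmetric])
  also have "\<dots> = (\<Sum>l\<in>K. \<Sum>x\<in>X. e (\<sigma> (k - l) ?y) x * w x l / of_nat (card K))"
    by (subst sum.swap) simp
  also have "\<dots> = (\<Sum>l\<in>K. \<Sum>x\<in>X. e (\<sigma> k ?y) x * w (\<sigma> (- l) x) l / of_nat (card K))"
  proof (rule sum.cong[OF refl])
    fix l assume l: "l \<in> K"
    have "(\<Sum>x\<in>X. e (\<sigma> (k - l) ?y) x * w x l / of_nat (card K)) =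
        (\<Sum>x\<in>X. e (\<sigma> (k - l) ?y) (\<sigma> (- l) x) * w (\<sigma> (- l) x) l / of_nat (card K))"
      by (rule sum_act[OF uminus_K[OF l], symmetric])
    also have "\<dots> = (\<Sum>x\<in>X. e (\<sigma> k ?y) x * w (\<sigma> (- l) x) l / of_nat (card K))"
    proof (intro sum.cong refl)
      fix x assume x: "x \<in> X"
      have "\<sigma> (k - l) ?y = \<sigma> (- l) (\<sigma> k ?y)"
        using act_add[OF uminus_K[OF l] k y] by simp
      then have "e (\<sigma> (k - l) ?y) (\<sigma> (- l) x) = e (\<sigma> k ?y) x"
        using e_equivariant[OF uminus_K[OF l] x act_mem[OF k y]] by simp
      then show "e (\<sigma> (k - l) ?y) (\<sigma> (- l) x) * w (\<sigma> (- l) x) l / of_nat (card K) =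
          e (\<sigma> k ?y) x * w (\<sigma> (- l) x) l / of_nat (card K)" by simp
    qed
    finally show "(\<Sum>x\<in>X. e (\<sigma> (k - l) ?y) x * w x l / of_nat (card K)) =
        (\<Sum>x\<in>X. e (\<sigma> k ?y) x * w (\<sigma> (- l) x) l / of_nat (card K))" .
  qed
  also have "\<dots> = (\<Sum>x\<in>X. e (\<sigma> k ?y) x * (\<Sum>l\<in>K. w (\<sigma> (- l) x) l)) / of_nat (card K)"
    by (subst sum.swap) (simp add: sum_divide_distrib sum_distrib_left)
  finally show ?thesis by (simp add: w_def)
qed

lemma avg_mat_mem: "avg_mat e \<in> rmats (group_alg K) n n"
  by (auto simp: avg_mat_def rmats_def)

lemma avg_mat_mult_vec_eqI:
  assumes v: "v \<in> rvecs (group_alg K) n" and m: "m \<in> carrier M"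
    and eq: "\<And>y. y \<in> X \<Longrightarrow> L y m = (\<Sum>x\<in>X. e y x *
      (\<Sum>l\<in>K. lookup (v $ (inv_into {..<n} enum (\<sigma> (- l) x))) l))"
  shows "avg_mat e *\<^sub>v v = emb m"
proof (rule eq_vecI)
  fix r assume "r < dim_vec (emb m)"
  then have r: "r < n" by (simp add: emb_def)
  have "(avg_mat e *\<^sub>v v) \<in> rvecs (group_alg K) n"
    by (rule A.mult_mat_vec_mem[OF avg_mat_mem v])
  then show "(avg_mat e *\<^sub>v v) $ r = emb m $ r"
    using r eq[OF act_mem[OF _ enum_mem[OF r]]] avg_mat_mult_vec[OF v r]
    by (intro group_alg_eqI) (auto simp: rvecs_def emb_def lookup_avg)
qed (simp add: emb_def avg_mat_def)

sublocale projective_embedding "group_alg K" M n emb "avg_mat e"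
proof
  fix m assume m: "m \<in> carrier M"
  show "emb m \<in> rvecs (group_alg K) n" by (rule emb_rvecs)
  show "avg_mat e *\<^sub>v emb m = emb m"
  proof (rule avg_mat_mult_vec_eqI[OF emb_rvecs m])
    fix y assume y: "y \<in> X"
    \<comment> \<open>All |K| terms equal \<open>L x m / |K|\<close>, as the action of
      \<open>l\<close> undoes that of \<open>- l\<close>.\<close>
    have "(\<Sum>l\<in>K. lookup (emb m $ (inv_into {..<n} enum (\<sigma> (- l) x))) l) = L x m"
      if x: "x \<in> X" for x
    proof -
      have "lookup (emb m $ (inv_into {..<n} enum (\<sigma> (- l) x))) l = L x m / of_nat (card K)"
        if l: "l \<in> K" for l
      proof -
        have "\<sigma> (- l) x \<in> enum ` {..<n}"
          using act_mem[OF uminus_K[OF l] x] bij_betw_enum by (simp add: bij_betw_def)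
        then have "inv_into {..<n} enum (\<sigma> (- l) x) < n" "enum (inv_into {..<n} enum (\<sigma> (- l) x)) = \<sigma> (- l) x"
          using inv_into_into[of "\<sigma> (- l) x" enum "{..<n}"] by (auto simp: f_inv_into_f)
        then show ?thesis using l x by (simp add: emb_def lookup_avg act_uminus_right)
      qed
      then show ?thesis by simp
    qed
    then show "L y m = (\<Sum>x\<in>X. e y x *
        (\<Sum>l\<in>K. lookup (emb m $ (inv_into {..<n} enum (\<sigma> (- l) x))) l))"
      using e_L[OF m y] by simp
  qed
  show "emb (a \<odot>\<^bsub>M\<^esub> m) = a \<cdot>\<^sub>v emb m" if a: "a \<in> group_alg K" for a
  proof (rule eq_vecI)
    fix r assume "r < dim_vec (a \<cdot>\<^sub>v emb m)"
    then have r: "r < n" by (simp add: emb_def)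
    let ?y = "enum r"
    have y: "?y \<in> X" by (rule enum_mem[OF r])
    have "avg (\<lambda>k. L (\<sigma> k ?y) (a \<odot>\<^bsub>M\<^esub> m)) = a * avg (\<lambda>k. L (\<sigma> k ?y) m)"
    proof (rule group_alg_eqI)
      fix k assume k: "k \<in> K"
      have "L (\<sigma> (- g) (\<sigma> k ?y)) m = L (\<sigma> (k - g) ?y) m" if "g \<in> K" for g
        using act_add[OF uminus_K[OF that] k y] by simp
      then show "lookup (avg (\<lambda>k. L (\<sigma> k ?y) (a \<odot>\<^bsub>M\<^esub> m))) k =
          lookup (a * avg (\<lambda>k. L (\<sigma> k ?y) m)) k"
        using k L_smult[OF act_mem[OF k y] a m]
        by (simp add: lookup_group_alg_mult[OF a] lookup_avg diff_K sum_divide_distrib)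
    qed (use a in auto)
    then show "emb (a \<odot>\<^bsub>M\<^esub> m) $ r = (a \<cdot>\<^sub>v emb m) $ r"
      using r by (simp add: emb_def)
  qed (simp add: emb_def)
  fix m' assume m': "m' \<in> carrier M"
  show "emb (m \<oplus>\<^bsub>M\<^esub> m') = emb m + emb m'"
    using m m' enum_mem act_mem
    by (intro eq_vecI) (auto simp: emb_def avg_def L_add sum.distrib[symmetric] single_add[symmetric]
        add_divide_distrib intro!: sum.cong)
  assume eq: "emb m = emb m'"
  show "m = m'"
  proof (rule L_inj[OF m m'])
    fix y assume y: "y \<in> X"
    then obtain r where r: "r < n" "y = enum r" using enum_surj by blast
    have "emb m $ r = emb m' $ r" using eq by simp
    \<comment> \<open>The coefficient at the neutral element already determines
      \<open>L y m\<close>.\<close>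
    then have "lookup (avg (\<lambda>k. L (\<sigma> k y) m)) 0 = lookup (avg (\<lambda>k. L (\<sigma> k y) m')) 0"
      using r by (simp add: emb_def)
    then show "L y m = L y m'" using y by (simp add: lookup_avg act_zero)
  qed
next
  show "emb \<zero>\<^bsub>M\<^esub> = 0\<^sub>v n"
    using enum_mem act_mem by (intro eq_vecI) (auto simp: emb_def avg_def L_zero)
  show "avg_mat e \<in> rmats (group_alg K) n n" by (rule avg_mat_mem)
  fix v assume v: "v \<in> rvecs (group_alg K) n"
  obtain m where "m \<in> carrier M" "\<forall>y\<in>X. L y m = (\<Sum>x\<in>X. e y x *
      (\<Sum>l\<in>K. lookup (v $ (inv_into {..<n} enum (\<sigma> (- l) x))) l))"
    using e_surj[of "\<lambda>x. \<Sum>l\<in>K. lookup (v $ (inv_into {..<n} enum (\<sigma> (- l) x))) l"] by blast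
  then show "avg_mat e *\<^sub>v v \<in> emb ` carrier M"
    using avg_mat_mult_vec_eqI[OF v] by auto
qed (auto intro: zero_carrier add_carrier smult_carrier)

text \<open>The trace of \<open>avg_mat e\<close>. Its coefficient at \<open>k\<close> is the fixed
  point count of \<open>k\<close>, weighted by \<open>e\<close> and divided by |K|.\<close>

lemma hs_rank_eq: "hs_rank (group_alg K) M = avg (\<lambda>k. \<Sum>x\<in>X. e (\<sigma> k x) x)"
proof -
  have "hs_rank (group_alg K) M = (\<Sum>r<n. (1\<^sub>m n * avg_mat e) $$ (r, r))"
    unfolding hs_rank_def using emb_rvecs
    by (intro proj_trace_emb) (auto simp: rmats_def rvecs_def)
  also have "\<dots> = (\<Sum>r<n. avg (\<lambda>k. e (\<sigma> k (enum r)) (enum r)))"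
    using avg_mat_mem by (intro sum.cong) (auto simp: rmats_def avg_mat_def)
  also have "\<dots> = (\<Sum>x\<in>X. avg (\<lambda>k. e (\<sigma> k x) x))"
    by (rule sum_enum)
  also have "\<dots> = avg (\<lambda>k. \<Sum>x\<in>X. e (\<sigma> k x) x)"
    by (rule poly_mapping_eqI) (simp add: lookup_sum lookup_avg sum_divide_distrib)
  finally show ?thesis .
qed

end

section \<open>Projective modules of polynomials\<close>

definition polys_over :: "'r::comm_ring_1 set \<Rightarrow> 'r poly set" where
  "polys_over R = {p. \<forall>i. coeff p i \<in> R}"

lemma (in subring_set) polys_over_subring: "subring_set (polys_over R)"
proof
  show "1 \<in> polys_over R" by (auto simp: polys_over_def coeff_1)
qed (auto simp: polys_over_def coeff_mult intro!: sum_mem mult_mem add_mem uminus_mem)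

context projective_embedding
begin

definition emb_poly :: "(nat \<Rightarrow> 'm) \<Rightarrow> 'r poly vec" where
  "emb_poly F = vec n (\<lambda>r. Abs_poly (\<lambda>m. i (F m) $ r))"

lemma carrier_poly_module:
  "carrier (poly_module M) = {F. (\<forall>m. F m \<in> carrier M) \<and> finite {m. F m \<noteq> \<zero>\<^bsub>M\<^esub>}}"
  by (simp add: poly_module_def)

lemma coeff_emb_poly:
  assumes F: "F \<in> carrier (poly_module M)" and r: "r < n"
  shows "coeff (emb_poly F $ r) m = i (F m) $ r"
proof -
  obtain k where k: "\<And>m. F m \<noteq> \<zero>\<^bsub>M\<^esub> \<Longrightarrow> m \<le> k"
    using F by (auto simp: carrier_poly_module finite_nat_set_iff_bounded_le)
  have "coeff (Abs_poly (\<lambda>m. i (F m) $ r)) = (\<lambda>m. i (F m) $ r)"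
  proof (rule coeff_Abs_poly)
    fix m assume "k < m"
    then have "F m = \<zero>\<^bsub>M\<^esub>" using k[of m] by auto
    then show "i (F m) $ r = 0" using r by (simp add: emb_zero)
  qed
  then show ?thesis using r by (simp add: emb_poly_def)
qed

lemma emb_finsum:
  assumes "finite I" "\<And>j. j \<in> I \<Longrightarrow> x j \<in> carrier M" "r < n"
  shows "i (\<Oplus>\<^bsub>M\<^esub>j\<in>I. x j) $ r = (\<Sum>j\<in>I. i (x j) $ r)"
proof -
  interpret M: Module.module "ring_on R" M by (rule module_of_emb)
  show ?thesis
    using assms
    by (intro finsum_additive[OF M.abelian_monoid_axioms, of "\<lambda>x. i x $ r"])
      (auto simp: emb_add emb_zero carrier_vecD[OF emb_carrier_vec])
qed

lemma finsum_M_carrier: "(\<And>j. j \<in> I \<Longrightarrow> x j \<in> carrier M) \<Longrightarrow> (\<Oplus>\<^bsub>M\<^esub>j\<in>I. x j) \<in> carrier M"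
proof -
  interpret M: Module.module "ring_on R" M by (rule module_of_emb)
  show "(\<And>j. j \<in> I \<Longrightarrow> x j \<in> carrier M) \<Longrightarrow> (\<Oplus>\<^bsub>M\<^esub>j\<in>I. x j) \<in> carrier M"
    by (rule M.finsum_closed) auto
qed

text \<open>The finite support demanded by \<open>poly_module\<close> comes from a degree bound for
  the \<open>n\<close> coordinate polynomials.\<close>

lemma poly_module_memI:
  assumes "\<And>m. F m \<in> carrier M" and "\<And>m r. r < n \<Longrightarrow> i (F m) $ r = coeff (p r) m"
  shows "F \<in> carrier (poly_module M)"
proof -
  \<comment> \<open>Inserting 0 keeps the maximum meaningful for \<open>n = 0\<close>.\<close>
  define k where "k = Max (insert 0 ((\<lambda>r. degree (p r)) ` {..<n}))"
  have "F m = \<zero>\<^bsub>M\<^esub>" if "k < m" for m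
  proof (rule emb_inj)
    have "degree (p r) < m" if "r < n" for r
      using \<open>k < m\<close> that by (auto simp: k_def)
    then show "i (F m) = i \<zero>\<^bsub>M\<^esub>"
      using assms emb_carrier_vec[OF assms(1)] by (intro eq_vecI) (auto simp: emb_zero coeff_eq_0)
  qed (use assms zero_carrier in auto)
  then have "{m. F m \<noteq> \<zero>\<^bsub>M\<^esub>} \<subseteq> {..k}" by (force simp: not_less[symmetric])
  then show ?thesis
    using assms finite_subset[of _ "{..k}"] by (simp add: carrier_poly_module)
qed

lemma series_endo_M_carrier:
  assumes "\<And>j x. x \<in> carrier M \<Longrightarrow> \<Phi> j x \<in> carrier M" and "F \<in> carrier (poly_module M)"
  shows "series_endo M \<Phi> F m \<in> carrier M"
  unfolding series_endo_def using assms by (intro finsum_M_carrier) (auto simp: carrier_poly_module)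

text \<open>The convolution in \<open>series_endo\<close> becomes the Cauchy product in a
  matrix-vector product, where the coefficients of degree \<open>j\<close> in \<open>B\<close>
  represent \<open>\<Phi> j\<close>.\<close>

lemma emb_series_endo:
  assumes \<Phi>: "\<And>j x. x \<in> carrier M \<Longrightarrow> \<Phi> j x \<in> carrier M"
    and B: "B \<in> carrier_mat n n"
    and B_emb: "\<And>j x r. x \<in> carrier M \<Longrightarrow> r < n \<Longrightarrow>
      i (\<Phi> j x) $ r = (\<Sum>s<n. coeff (B $$ (r, s)) j * i x $ s)"
    and F: "F \<in> carrier (poly_module M)" and r: "r < n"
  shows "i (series_endo M \<Phi> F m) $ r = coeff ((B *\<^sub>v emb_poly F) $ r) m"
proof -
  have Fm: "F m \<in> carrier M" for m using F by (simp add: carrier_poly_module)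
  have "i (series_endo M \<Phi> F m) $ r =
      (\<Sum>j\<le>m. \<Sum>s<n. coeff (B $$ (r, s)) j * i (F (m - j)) $ s)"
    unfolding series_endo_def using Fm r \<Phi> by (simp add: emb_finsum B_emb)
  also have "\<dots> = (\<Sum>s<n. \<Sum>j\<le>m. coeff (B $$ (r, s)) j * coeff (emb_poly F $ s) (m - j))"
    by (subst sum.swap) (simp add: coeff_emb_poly[OF F])
  also have "\<dots> = coeff ((B *\<^sub>v emb_poly F) $ r) m"
    using B r by (simp add: scalar_prod_def emb_poly_def coeff_sum coeff_mult atLeast0LessThan)
  finally show ?thesis .
qed

lemma series_endo_mem:
  assumes "\<And>j x. x \<in> carrier M \<Longrightarrow> \<Phi> j x \<in> carrier M"
    and "B \<in> carrier_mat n n"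
    and "\<And>j x r. x \<in> carrier M \<Longrightarrow> r < n \<Longrightarrow>
      i (\<Phi> j x) $ r = (\<Sum>s<n. coeff (B $$ (r, s)) j * i x $ s)"
    and "F \<in> carrier (poly_module M)"
  shows "series_endo M \<Phi> F \<in> carrier (poly_module M)"
proof (rule poly_module_memI)
  show "series_endo M \<Phi> F m \<in> carrier M" for m
    by (rule series_endo_M_carrier[OF assms(1,4)])
qed (rule emb_series_endo[OF assms])

lemma emb_poly_series_endo:
  assumes "\<And>j x. x \<in> carrier M \<Longrightarrow> \<Phi> j x \<in> carrier M"
    and "B \<in> carrier_mat n n"
    and "\<And>j x r. x \<in> carrier M \<Longrightarrow> r < n \<Longrightarrow>
      i (\<Phi> j x) $ r = (\<Sum>s<n. coeff (B $$ (r, s)) j * i x $ s)"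
    and "F \<in> carrier (poly_module M)"
  shows "emb_poly (series_endo M \<Phi> F) = B *\<^sub>v emb_poly F"
proof (rule eq_vecI)
  fix r assume "r < dim_vec (B *\<^sub>v emb_poly F)"
  then have r: "r < n" using assms(2) by simp
  have mem: "series_endo M \<Phi> F \<in> carrier (poly_module M)" by (rule series_endo_mem[OF assms])
  show "emb_poly (series_endo M \<Phi> F) $ r = (B *\<^sub>v emb_poly F) $ r"
    by (rule poly_eqI) (simp only: coeff_emb_poly[OF mem r] emb_series_endo[OF assms r])
qed (use assms in \<open>simp add: emb_poly_def\<close>)

definition E_poly :: "'r poly mat" where
  "E_poly = map_mat (\<lambda>a. [:a:]) E"

lemma coeff_E_poly_mult:
  assumes v: "v \<in> rvecs (polys_over R) n" and r: "r < n"
  shows "coeff ((E_poly *\<^sub>v v) $ r) m = (E *\<^sub>v vec n (\<lambda>s. coeff (v $ s) m)) $ r"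
proof -
  have "v \<in> carrier_vec n" using v by (simp add: rvecs_def)
  then have "(E_poly *\<^sub>v v) $ r = (\<Sum>s<n. [:E $$ (r, s):] * v $ s)"
    using E_carrier r by (auto simp: E_poly_def scalar_prod_def atLeast0LessThan intro!: sum.cong)
  then show ?thesis
    using E_carrier r by (simp add: scalar_prod_def coeff_sum atLeast0LessThan)
qed

lemma smult_poly_module:
  assumes p: "p \<in> polys_over R" and F: "F \<in> carrier (poly_module M)"
  shows "p \<odot>\<^bsub>poly_module M\<^esub> F \<in> carrier (poly_module M)"
    and "emb_poly (p \<odot>\<^bsub>poly_module M\<^esub> F) = p \<cdot>\<^sub>v emb_poly F"
proof -
  \<comment> \<open>Multiplication by \<open>p\<close> is itself a \<open>series_endo\<close>,
    represented by the scalar matrix with entry \<open>p\<close>, so the facts just proved cover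
    it.\<close>
  define B where "B = mat n n (\<lambda>(r, s). if r = s then p else 0)"
  let ?\<Phi> = "\<lambda>j x. coeff p j \<odot>\<^bsub>M\<^esub> x"
  have pj: "coeff p j \<in> R" for j using p by (simp add: polys_over_def)
  have \<Phi>: "?\<Phi> j x \<in> carrier M" if "x \<in> carrier M" for j x
    using that pj by (simp add: smult_carrier)
  have B: "B \<in> carrier_mat n n" by (simp add: B_def)
  have B_emb: "i (?\<Phi> j x) $ r = (\<Sum>s<n. coeff (B $$ (r, s)) j * i x $ s)"
    if "x \<in> carrier M" "r < n" for j x r
  proof -
    have "(\<Sum>s<n. coeff (B $$ (r, s)) j * i x $ s) =
        (\<Sum>s<n. if s = r then coeff p j * i x $ r else 0)"
      using that by (intro sum.cong) (auto simp: B_def)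
    also have "\<dots> = i (?\<Phi> j x) $ r"
      using that emb_carrier_vec[OF that(1)] by (simp add: emb_smult pj)
    finally show ?thesis ..
  qed
  have eq: "p \<odot>\<^bsub>poly_module M\<^esub> F = series_endo M ?\<Phi> F" by (simp add: poly_module_def)
  show "p \<odot>\<^bsub>poly_module M\<^esub> F \<in> carrier (poly_module M)"
    unfolding eq by (rule series_endo_mem[OF \<Phi> B B_emb F])
  have "emb_poly (series_endo M ?\<Phi> F) = B *\<^sub>v emb_poly F"
    by (rule emb_poly_series_endo[OF \<Phi> B B_emb F])
  also have "\<dots> = p \<cdot>\<^sub>v emb_poly F"
  proof (rule eq_vecI)
    fix r assume "r < dim_vec (p \<cdot>\<^sub>v emb_poly F)"
    then have r: "r < n" by (simp add: emb_poly_def)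
    have "(B *\<^sub>v emb_poly F) $ r = (\<Sum>s<n. B $$ (r, s) * emb_poly F $ s)"
      using r by (simp add: B_def scalar_prod_def emb_poly_def atLeast0LessThan)
    also have "\<dots> = (\<Sum>s<n. if s = r then p * emb_poly F $ r else 0)"
      using r by (intro sum.cong) (auto simp: B_def)
    finally show "(B *\<^sub>v emb_poly F) $ r = (p \<cdot>\<^sub>v emb_poly F) $ r"
      using r by (simp add: emb_poly_def)
  qed (simp add: B_def emb_poly_def)
  finally show "emb_poly (p \<odot>\<^bsub>poly_module M\<^esub> F) = p \<cdot>\<^sub>v emb_poly F" unfolding eq .
qed

text \<open>Presentation by an idempotent survives extension of scalars from R to R[u]: everything
  is checked coefficient by coefficient, with the same \<open>E\<close> in each degree.\<close>

lemma poly_embedding: "projective_embedding (polys_over R) (poly_module M) n emb_poly E_poly"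
proof -
  interpret P: subring_set "polys_over R" by (rule polys_over_subring)
  have F_carrier: "F m \<in> carrier M" if "F \<in> carrier (poly_module M)" for F m
    using that by (simp add: carrier_poly_module)
  have emb_poly_mem: "emb_poly F \<in> rvecs (polys_over R) n" if F: "F \<in> carrier (poly_module M)" for F
    using coeff_emb_poly[OF F] emb_mem[OF F_carrier[OF F]]
    by (auto simp: rvecs_def polys_over_def) (simp add: emb_poly_def)
  have E_poly_eqI: "E_poly *\<^sub>v v = emb_poly F"
    if v: "v \<in> rvecs (polys_over R) n" and F: "F \<in> carrier (poly_module M)"
      and eq: "\<And>m. E *\<^sub>v vec n (\<lambda>s. coeff (v $ s) m) = i (F m)" for v F
  proof (rule eq_vecI)
    fix r assume "r < dim_vec (emb_poly F)"
    then have r: "r < n" by (simp add: emb_poly_def)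
    show "(E_poly *\<^sub>v v) $ r = emb_poly F $ r"
      by (rule poly_eqI) (simp only: coeff_E_poly_mult[OF v r] eq coeff_emb_poly[OF F r])
  qed (use E_carrier in \<open>simp add: E_poly_def emb_poly_def\<close>)
  show ?thesis
  proof
    show "\<zero>\<^bsub>poly_module M\<^esub> \<in> carrier (poly_module M)"
      by (simp add: poly_module_def zero_carrier)
    show "E_poly \<in> rmats (polys_over R) n n"
      using E_mem by (auto simp: E_poly_def rmats_def polys_over_def coeff_pCons split: nat.splits)
    show "emb_poly \<zero>\<^bsub>poly_module M\<^esub> = 0\<^sub>v n"
      by (intro eq_vecI) (auto simp: emb_poly_def poly_module_def emb_zero zero_poly_def)
  next
    fix F assume F: "F \<in> carrier (poly_module M)"
    show "emb_poly F \<in> rvecs (polys_over R) n" by (rule emb_poly_mem[OF F])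
    show "E_poly *\<^sub>v emb_poly F = emb_poly F"
    proof (rule E_poly_eqI[OF emb_poly_mem[OF F] F])
      fix m
      have "vec n (\<lambda>s. coeff (emb_poly F $ s) m) = i (F m)"
        using emb_carrier_vec[OF F_carrier[OF F, of m]] by (intro eq_vecI) (auto simp: coeff_emb_poly[OF F])
      then show "E *\<^sub>v vec n (\<lambda>s. coeff (emb_poly F $ s) m) = i (F m)"
        using E_emb F_carrier[OF F] by simp
    qed
    show "p \<odot>\<^bsub>poly_module M\<^esub> F \<in> carrier (poly_module M)" if "p \<in> polys_over R" for p
      by (rule smult_poly_module(1)[OF that F])
    show "emb_poly (p \<odot>\<^bsub>poly_module M\<^esub> F) = p \<cdot>\<^sub>v emb_poly F" if "p \<in> polys_over R" for p
      by (rule smult_poly_module(2)[OF that F])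
    fix F' assume F': "F' \<in> carrier (poly_module M)"
    have add_eq: "(F \<oplus>\<^bsub>poly_module M\<^esub> F') m = F m \<oplus>\<^bsub>M\<^esub> F' m" for m
      by (simp add: poly_module_def)
    have coeff_add_eq: "i ((F \<oplus>\<^bsub>poly_module M\<^esub> F') m) $ r =
        coeff (emb_poly F $ r + emb_poly F' $ r) m" if "r < n" for m r
      unfolding add_eq
      using emb_carrier_vec[OF F_carrier[OF F, of m]] emb_carrier_vec[OF F_carrier[OF F', of m]]
        F_carrier[OF F, of m] F_carrier[OF F', of m] that
      by (simp add: emb_add coeff_emb_poly[OF F] coeff_emb_poly[OF F'])
    show mem: "F \<oplus>\<^bsub>poly_module M\<^esub> F' \<in> carrier (poly_module M)"
      by (rule poly_module_memI[OF _ coeff_add_eq])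
        (simp_all add: add_eq add_carrier F_carrier[OF F] F_carrier[OF F'])
    show "emb_poly (F \<oplus>\<^bsub>poly_module M\<^esub> F') = emb_poly F + emb_poly F'"
    proof (rule eq_vecI)
      fix r assume "r < dim_vec (emb_poly F + emb_poly F')"
      then have r: "r < n" by (simp add: emb_poly_def)
      have "emb_poly (F \<oplus>\<^bsub>poly_module M\<^esub> F') $ r = emb_poly F $ r + emb_poly F' $ r"
        by (rule poly_eqI) (simp only: coeff_emb_poly[OF mem r] coeff_add_eq[OF r])
      then show "emb_poly (F \<oplus>\<^bsub>poly_module M\<^esub> F') $ r = (emb_poly F + emb_poly F') $ r"
        using r by (simp add: emb_poly_def)
    qed (simp add: emb_poly_def)
    assume eq: "emb_poly F = emb_poly F'"
    show "F = F'"
    proof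
      fix m
      have "i (F m) $ r = i (F' m) $ r" if "r < n" for r
        using coeff_emb_poly[OF F that, of m] coeff_emb_poly[OF F' that, of m] eq by simp
      then have "i (F m) = i (F' m)"
        using emb_carrier_vec[OF F_carrier[OF F, of m]] emb_carrier_vec[OF F_carrier[OF F', of m]]
        by (intro eq_vecI) auto
      then show "F m = F' m" using emb_inj F_carrier F F' by blast
    qed
  next
    fix v assume v: "v \<in> rvecs (polys_over R) n"
    \<comment> \<open>Preimages are chosen separately in each degree; the choice has finite support
      because its coordinates are the coefficients of the polynomial vector
      \<open>E_poly *\<^sub>v v\<close>.\<close>
    define F where "F m = (SOME x. x \<in> carrier M \<and> E *\<^sub>v vec n (\<lambda>s. coeff (v $ s) m) = i x)" for m
    have F: "F m \<in> carrier M \<and> E *\<^sub>v vec n (\<lambda>s. coeff (v $ s) m) = i (F m)" for m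
    proof -
      have "vec n (\<lambda>s. coeff (v $ s) m) \<in> rvecs R n"
        using v by (auto simp: rvecs_def polys_over_def)
      from E_image[OF this] have
        "\<exists>x. x \<in> carrier M \<and> E *\<^sub>v vec n (\<lambda>s. coeff (v $ s) m) = i x" by blast
      then show ?thesis unfolding F_def by (rule someI_ex)
    qed
    have mem: "F \<in> carrier (poly_module M)"
    proof (rule poly_module_memI)
      show "F m \<in> carrier M" for m using F by blast
      show "i (F m) $ r = coeff ((E_poly *\<^sub>v v) $ r) m" if "r < n" for m r
        unfolding coeff_E_poly_mult[OF v that] using F[of m] by simp
    qed
    have "E_poly *\<^sub>v v = emb_poly F" by (rule E_poly_eqI[OF v mem]) (use F in blast)
    with mem show "E_poly *\<^sub>v v \<in> emb_poly ` carrier (poly_module M)" by blast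
  qed
qed

lemma proj_det_series_endo:
  assumes \<Phi>: "\<And>j x. x \<in> carrier M \<Longrightarrow> \<Phi> j x \<in> carrier M"
    and B: "B \<in> rmats (polys_over R) n n"
    and B_emb: "\<And>j x r. x \<in> carrier M \<Longrightarrow> r < n \<Longrightarrow>
      i (\<Phi> j x) $ r = (\<Sum>s<n. coeff (B $$ (r, s)) j * i x $ s)"
  shows "proj_det (polys_over R) (poly_module M) (series_endo M \<Phi>) = det (1\<^sub>m n + (B - 1\<^sub>m n) * E_poly)"
proof -
  have B': "B \<in> carrier_mat n n" using B by (simp add: rmats_def)
  interpret P: projective_embedding "polys_over R" "poly_module M" n emb_poly E_poly
    by (rule poly_embedding)
  show ?thesis
  proof (rule P.proj_det_emb[OF _ B])
    show "series_endo M \<Phi> F \<in> carrier (poly_module M)" if "F \<in> carrier (poly_module M)" for F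
      by (rule series_endo_mem[OF \<Phi> B' B_emb that])
    show "B *\<^sub>v emb_poly F = emb_poly (series_endo M \<Phi> F)" if "F \<in> carrier (poly_module M)" for F
      by (rule emb_poly_series_endo[OF \<Phi> B' B_emb that, symmetric])
  qed
qed

end

section \<open>Chain modules of graphs\<close>

lemma finite_add_group_if_comm_group:
  assumes "comm_group (additive_group G)" and "finite G"
  shows "finite_add_group G"
proof -
  interpret comm_group "additive_group G" by fact
  show ?thesis
  proof
    show "0 \<in> G" using one_closed by (simp add: additive_group_def)
    show "g + h \<in> G" if "g \<in> G" "h \<in> G" for g h
      using m_closed[of g h] that by (simp add: additive_group_def)
    show "- g \<in> G" if "g \<in> G" for g
    proof -
      have "\<exists>h\<in>G. h + g = 0" using l_inv_ex[of g] that by (simp add: additive_group_def)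
      then show ?thesis by (metis add_eq_0_iff2)
    qed
  qed fact
qed

lemma add_group_pair_if_subgroup:
  assumes comm: "comm_group (additive_group G)" and fin: "finite G" and sub: "subgroup H (additive_group G)"
  shows "add_group_pair G H"
proof -
  interpret G: finite_add_group G by (rule finite_add_group_if_comm_group[OF comm fin])
  interpret grp: comm_group "additive_group G" by fact
  have HG: "H \<subseteq> G" using subgroup.subset[OF sub] by (simp add: additive_group_def)
  show ?thesis
  proof
    show "finite H" using HG fin finite_subset by auto
    show "0 \<in> H" using subgroup.one_closed[OF sub] by (simp add: additive_group_def)
    show "g + h \<in> H" if "g \<in> H" "h \<in> H" for g h
      using subgroup.m_closed[OF sub that] by (simp add: additive_group_def)
    show "- g \<in> H" if g: "g \<in> H" for g
    proof -
      have "inv\<^bsub>additive_group G\<^esub> g = - g"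
        using g HG by (intro grp.inv_equality) (auto simp: additive_group_def)
      then show ?thesis using subgroup.m_inv_closed[OF sub g] by simp
    qed
  qed fact
qed

lemma finite_action_if_group_action:
  assumes "finite_add_group K" and "finite X" and "group_action (additive_group K) X \<sigma>"
  shows "finite_action K X \<sigma>"
proof -
  interpret finite_add_group K by fact
  interpret act: group_action "additive_group K" X \<sigma> by fact
  show ?thesis
  proof
    show "\<sigma> 0 x = x" if "x \<in> X" for x
      using act.id_eq_one that by (metis additive_group_def monoid.select_convs(2) restrict_apply')
    show "\<sigma> (g + h) x = \<sigma> g (\<sigma> h x)" if "g \<in> K" "h \<in> K" "x \<in> X" for g h x
      using act.composition_rule[of x g h] that by (simp add: additive_group_def)
    show "\<sigma> g x \<in> X" if "g \<in> K" "x \<in> X" for g x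
      using act.element_image[of g x] that by (simp add: additive_group_def)
  qed fact
qed

lemma lookup_zero_outside: "keys c \<subseteq> X \<Longrightarrow> y \<notin> X \<Longrightarrow> lookup c y = 0"
  by (metis in_keys_iff subsetD)

section \<open>Permutation modules\<close>

context finite_action
begin

lemma perm_module_simps [simp]:
  "carrier (perm_module X \<sigma>) = {c. keys c \<subseteq> X}"
  "zero (perm_module X \<sigma>) = 0" "add (perm_module X \<sigma>) = (+)"
  by (simp_all add: perm_module_def)

lemma perm_smult_expand:
  assumes a: "a \<in> group_alg K" and c: "keys c \<subseteq> X"
  shows "a \<odot>\<^bsub>perm_module X \<sigma>\<^esub> c = (\<Sum>k\<in>K. \<Sum>x\<in>X.
    single (\<sigma> k x) (lookup a k * lookup c x))"
proof -
  have "(\<Sum>x\<in>keys c. single (\<sigma> k x) (lookup a k * lookup c x)) =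
      (\<Sum>x\<in>X. single (\<sigma> k x) (lookup a k * lookup c x))" for k
    using c finite_X by (intro sum.mono_neutral_left) (auto simp: in_keys_iff)
  then have "a \<odot>\<^bsub>perm_module X \<sigma>\<^esub> c = (\<Sum>k\<in>keys a. \<Sum>x\<in>X.
      single (\<sigma> k x) (lookup a k * lookup c x))"
    by (simp add: perm_module_def)
  also have "\<dots> = (\<Sum>k\<in>K. \<Sum>x\<in>X.
      single (\<sigma> k x) (lookup a k * lookup c x))"
    using a by (intro sum.mono_neutral_left) (auto simp: in_keys_iff group_alg_def)
  finally show ?thesis .
qed

lemma perm_smult_carrier:
  assumes a: "a \<in> group_alg K" and c: "keys c \<subseteq> X"
  shows "keys (a \<odot>\<^bsub>perm_module X \<sigma>\<^esub> c) \<subseteq> X"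
proof -
  have "lookup (a \<odot>\<^bsub>perm_module X \<sigma>\<^esub> c) y = 0" if "y \<notin> X" for y
    unfolding perm_smult_expand[OF assms] lookup_sum lookup_single
    using act_mem that by (intro sum.neutral ballI) (auto simp: when_def)
  then show ?thesis by (metis in_keys_iff subsetI)
qed

lemma lookup_perm_smult:
  assumes a: "a \<in> group_alg K" and c: "keys c \<subseteq> X" and y: "y \<in> X"
  shows "lookup (a \<odot>\<^bsub>perm_module X \<sigma>\<^esub> c) y =
    (\<Sum>k\<in>K. lookup a k * lookup c (\<sigma> (- k) y))"
  unfolding perm_smult_expand[OF a c] lookup_sum lookup_single
proof (rule sum.cong[OF refl])
  fix k assume k: "k \<in> K"
  have "(\<Sum>x\<in>X. lookup a k * lookup c x when \<sigma> k x = y) =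
      (\<Sum>x\<in>X. if x = \<sigma> (- k) y then lookup a k * lookup c (\<sigma> (- k) y) else 0)"
    using act_eq_iff[OF k _ y] by (intro sum.cong) (auto simp: when_def)
  also have "\<dots> = lookup a k * lookup c (\<sigma> (- k) y)"
    using act_mem[OF uminus_K[OF k] y] finite_X by simp
  finally show "(\<Sum>x\<in>X. lookup a k * lookup c x when \<sigma> k x = y) =
      lookup a k * lookup c (\<sigma> (- k) y)" .
qed

definition func :: "('x \<Rightarrow> complex) \<Rightarrow> 'x \<Rightarrow>\<^sub>0 complex" where
  "func z = (\<Sum>x\<in>X. single x (z x))"

lemma lookup_func: "lookup (func z) y = (if y \<in> X then z y else 0)"
  by (simp add: func_def lookup_sum lookup_single when_def finite_X)

lemma keys_func: "keys (func z) \<subseteq> X"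
  by (auto simp: in_keys_iff lookup_func split: if_splits)

abbreviation delta :: "'x \<Rightarrow> 'x \<Rightarrow> complex" where
  "delta \<equiv> \<lambda>y x. if x = y then 1 else 0"

lemma permutation_like_perm_module:
  "permutation_like K X \<sigma> (perm_module X \<sigma>) (\<lambda>x c. lookup c x) delta"
proof
  show "c = c'" if c: "c \<in> carrier (perm_module X \<sigma>)" "c' \<in> carrier (perm_module X \<sigma>)"
    and eq: "\<And>y. y \<in> X \<Longrightarrow> lookup c y = lookup c' y" for c c'
  proof (rule poly_mapping_eqI)
    fix y show "lookup c y = lookup c' y"
      using c eq lookup_zero_outside[of c X y] lookup_zero_outside[of c' X y] by (cases "y \<in> X") auto
  qed
  show "delta (\<sigma> k y) (\<sigma> k x) = delta y x" if "k \<in> K" "x \<in> X" "y \<in> X" for k x y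
    using act_inj[OF that] by simp
  show "(\<Sum>x\<in>X. delta y x * lookup c x) = lookup c y" if "y \<in> X" for y and c :: "'x \<Rightarrow>\<^sub>0 complex"
    using that finite_X by (simp add: if_distrib[of "\<lambda>t. t * _"] cong: if_cong)
  show "\<exists>c\<in>carrier (perm_module X \<sigma>). \<forall>y\<in>X. lookup c y = (\<Sum>x\<in>X. delta y x * z x)" for z
    using keys_func[of z] finite_X
    by (intro bexI[of _ "func z"]) (auto simp: lookup_func if_distrib[of "\<lambda>t. t * _"] cong: if_cong)
  show "c \<oplus>\<^bsub>perm_module X \<sigma>\<^esub> c' \<in> carrier (perm_module X \<sigma>)"
    if "c \<in> carrier (perm_module X \<sigma>)" "c' \<in> carrier (perm_module X \<sigma>)" for c c'
    using that keys_add[of c c'] by auto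
qed (auto simp: lookup_add lookup_perm_smult intro: perm_smult_carrier[THEN subsetD])

end

section \<open>Chains of a graph and the equivariant Euler characteristic\<close>

locale graph_action = finite_serre_graph Y + V: finite_action K "verts Y" \<sigma>V + E: finite_action K "edges Y" \<sigma>E
  for Y :: "('v, 'e) serre_graph" and K :: "'g::ab_group_add set"
    and \<sigma>V :: "'g \<Rightarrow> 'v \<Rightarrow> 'v" and \<sigma>E :: "'g \<Rightarrow> 'e \<Rightarrow> 'e" +
  assumes org_equivariant: "k \<in> K \<Longrightarrow> e \<in> edges Y \<Longrightarrow> org Y (\<sigma>E k e) = \<sigma>V k (org Y e)"
    and ter_equivariant: "k \<in> K \<Longrightarrow> e \<in> edges Y \<Longrightarrow> ter Y (\<sigma>E k e) = \<sigma>V k (ter Y e)"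
    and opp_equivariant: "k \<in> K \<Longrightarrow> e \<in> edges Y \<Longrightarrow> opp Y (\<sigma>E k e) = \<sigma>E k (opp Y e)"
    and no_inversion: "k \<in> K \<Longrightarrow> e \<in> edges Y \<Longrightarrow> \<sigma>E k e \<noteq> opp Y e"
begin

sublocale C0: permutation_like K "verts Y" \<sigma>V "chains0 Y \<sigma>V" "\<lambda>x c. lookup c x" V.delta
  unfolding chains0_def by (rule V.permutation_like_perm_module)

text \<open>Twice the antisymmetric part of a chain. These functionals cut out the orientation
  relations, so the module of 1-chains becomes the space of antisymmetric functions on all directed
  edges. No orientation is chosen, which keeps the description compatible with the action.\<close>

definition alt :: "'e \<Rightarrow> ('e \<Rightarrow>\<^sub>0 complex) \<Rightarrow> complex" where
  "alt e c = lookup c e - lookup c (opp Y e)"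

lemma lookup_orientation_relation:
  assumes e: "e \<in> edges Y"
  shows "lookup (\<Sum>e\<in>edges Y. single e (z e) + single (opp Y e) (z e)) e =
    z e + z (opp Y e)"
proof -
  have "opp Y e' = e \<longleftrightarrow> e' = opp Y e" if "e' \<in> edges Y" for e'
    using that e opp_opp by metis
  then have "(\<Sum>e'\<in>edges Y. (z e' when opp Y e' = e)) = (\<Sum>e'\<in>edges Y. if e' = opp Y e then z (opp Y e) else 0)"
    by (intro sum.cong) (auto simp: when_def)
  then show ?thesis
    using e finite_edges opp_closed
    by (simp add: lookup_sum lookup_add lookup_single sum.distrib when_def)
qed

lemma orientation_relations_eq:
  "orientation_relations Y = {c \<in> carrier (perm_module (edges Y) \<sigma>E). \<forall>e\<in>edges Y. alt e c = 0}"
proof (intro equalityI subsetI)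
  fix c assume "c \<in> orientation_relations Y"
  then obtain z where c: "c = (\<Sum>e\<in>edges Y. single e (z e) + single (opp Y e) (z e))"
    by (auto simp: orientation_relations_def)
  have "lookup c y = 0" if "y \<notin> edges Y" for y
    unfolding c lookup_sum using that opp_closed
    by (intro sum.neutral) (auto simp: lookup_add lookup_single when_def)
  moreover have "alt e c = 0" if "e \<in> edges Y" for e
    unfolding alt_def c using that opp_closed[OF that] opp_opp[OF that]
    by (simp only: lookup_orientation_relation) simp
  ultimately show "c \<in> {c \<in> carrier (perm_module (edges Y) \<sigma>E). \<forall>e\<in>edges Y. alt e c = 0}"
    by (auto simp: in_keys_iff)
next
  fix c assume c: "c \<in> {c \<in> carrier (perm_module (edges Y) \<sigma>E). \<forall>e\<in>edges Y. alt e c = 0}"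
  \<comment> \<open>An edge receives \<open>z\<close> from its own term and from that of its
    opposite; for a symmetric chain each supplies half of the coefficient.\<close>
  define z where "z e = lookup c e / 2" for e
  have "c = (\<Sum>e\<in>edges Y. single e (z e) + single (opp Y e) (z e))" (is "_ = ?s")
  proof (rule poly_mapping_eqI)
    fix y
    show "lookup c y = lookup ?s y"
    proof (cases "y \<in> edges Y")
      case True
      then show ?thesis
        unfolding lookup_orientation_relation[OF True] using c by (simp add: z_def alt_def)
    next
      case False
      then have "lookup ?s y = 0"
        unfolding lookup_sum using opp_closed
        by (intro sum.neutral) (auto simp: lookup_add lookup_single when_def)
      then show ?thesis using c False lookup_zero_outside[of c "edges Y" y] by auto
    qed
  qed
  then show "c \<in> orientation_relations Y" by (auto simp: orientation_relations_def)
qed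

lemma alt_smult:
  assumes "y \<in> edges Y" "a \<in> group_alg K" "keys c \<subseteq> edges Y"
  shows "alt y (a \<odot>\<^bsub>perm_module (edges Y) \<sigma>E\<^esub> c) =
    (\<Sum>k\<in>K. lookup a k * alt (\<sigma>E (- k) y) c)"
  using assms opp_closed V.uminus_K
  by (simp add: alt_def E.lookup_perm_smult opp_equivariant right_diff_distrib sum_subtractf)

sublocale Q: kernel_quotient "perm_module (edges Y) \<sigma>E" "edges Y" alt "orientation_relations Y" "group_alg K"
proof -
  interpret abelian_group "perm_module (edges Y) \<sigma>E"
    by (rule abelian_group_of_type) (auto dest: subsetD[OF keys_add])
  show "kernel_quotient (perm_module (edges Y) \<sigma>E) (edges Y) alt (orientation_relations Y) (group_alg K)"
  proof
    fix r x y p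
    assume "r \<in> group_alg K" "x \<in> carrier (perm_module (edges Y) \<sigma>E)"
      "y \<in> carrier (perm_module (edges Y) \<sigma>E)" "p \<in> edges Y"
      and eq: "\<And>p. p \<in> edges Y \<Longrightarrow> alt p x = alt p y"
    then show "alt p (r \<odot>\<^bsub>perm_module (edges Y) \<sigma>E\<^esub> x) = alt p (r \<odot>\<^bsub>perm_module (edges Y) \<sigma>E\<^esub> y)"
      using eq[OF E.act_mem[OF V.uminus_K]] by (simp add: alt_smult)
  qed (use orientation_relations_eq E.perm_smult_carrier in \<open>auto simp: alt_def lookup_add\<close>)
qed

lemma chains1_eq: "chains1 Y \<sigma>E = Q.Quo"
  by (simp add: chains1_def)

text \<open>The projection of functions on directed edges onto the antisymmetric ones; the
  denominator 2 makes it idempotent.\<close>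

definition alt_ker :: "'e \<Rightarrow> 'e \<Rightarrow> complex" where
  "alt_ker y x = ((if x = y then 1 else 0) - (if x = opp Y y then 1 else 0)) / 2"

lemma sum_alt_ker:
  assumes "y \<in> edges Y"
  shows "(\<Sum>x\<in>edges Y. alt_ker y x * z x) = (z y - z (opp Y y)) / 2"
proof -
  have "(\<Sum>x\<in>edges Y. alt_ker y x * z x) =
      (\<Sum>x\<in>edges Y. (if x = y then z y / 2 else 0) - (if x = opp Y y then z (opp Y y) / 2 else 0))"
    by (intro sum.cong) (auto simp: alt_ker_def)
  then show ?thesis
    using assms opp_closed[OF assms] finite_edges by (simp add: sum_subtractf diff_divide_distrib)
qed

lemma alt_opp: "e \<in> edges Y \<Longrightarrow> alt (opp Y e) c = - alt e c"
  by (simp add: alt_def opp_opp)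

sublocale C1: permutation_like K "edges Y" \<sigma>E "chains1 Y \<sigma>E" Q.lift alt_ker
  unfolding chains1_eq
proof
  note Quo = Q.carrier_Quo
  show "\<zero>\<^bsub>Q.Quo\<^esub> \<in> carrier Q.Quo" by (simp add: Q.zero_Quo Quo)
  fix C assume "C \<in> carrier Q.Quo"
  then obtain c where c: "c \<in> carrier (perm_module (edges Y) \<sigma>E)" "C = Q.cls c" unfolding Quo by blast
  have c': "keys c \<subseteq> edges Y" using c by simp
  show "a \<odot>\<^bsub>Q.Quo\<^esub> C \<in> carrier Q.Quo" if "a \<in> group_alg K" for a
    unfolding c Q.smult_Quo[OF that c(1)] Quo using Q.smult_carrier[OF that c(1)] by blast
  show "Q.lift y (a \<odot>\<^bsub>Q.Quo\<^esub> C) = (\<Sum>k\<in>K. lookup a k * Q.lift (\<sigma>E (- k) y) C)"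
    if y: "y \<in> edges Y" and a: "a \<in> group_alg K" for y a
    unfolding c Q.smult_Quo[OF a c(1)] Q.lift_cls[OF y Q.smult_carrier[OF a c(1)]] alt_smult[OF y a c']
    using Q.lift_cls[OF E.act_mem[OF V.uminus_K y] c(1)] by simp
  show "(\<Sum>x\<in>edges Y. alt_ker y x * Q.lift x C) = Q.lift y C" if y: "y \<in> edges Y" for y
    unfolding sum_alt_ker[OF y] c Q.lift_cls[OF y c(1)] Q.lift_cls[OF opp_closed[OF y] c(1)] alt_opp[OF y]
    by simp
  fix D assume "D \<in> carrier Q.Quo"
  then obtain d where d: "d \<in> carrier (perm_module (edges Y) \<sigma>E)" "D = Q.cls d" unfolding Quo by blast
  have cd: "c \<oplus>\<^bsub>perm_module (edges Y) \<sigma>E\<^esub> d \<in> carrier (perm_module (edges Y) \<sigma>E)"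
    using c d by (intro Q.a_closed)
  show "C \<oplus>\<^bsub>Q.Quo\<^esub> D \<in> carrier Q.Quo"
    unfolding c d Q.add_Quo[OF c(1) d(1)] Quo using cd by blast
  show "Q.lift y (C \<oplus>\<^bsub>Q.Quo\<^esub> D) = Q.lift y C + Q.lift y D" if y: "y \<in> edges Y" for y
    unfolding c d Q.add_Quo[OF c(1) d(1)] Q.lift_cls[OF y cd] Q.lift_cls[OF y c(1)] Q.lift_cls[OF y d(1)]
    by (rule Q.L_add[OF y c(1) d(1)])
  assume "\<And>y. y \<in> edges Y \<Longrightarrow> Q.lift y C = Q.lift y D"
  then show "C = D"
    unfolding c d using Q.cls_eq_iff[OF c(1) d(1)] Q.lift_cls c(1) d(1) by auto
next
  show "Q.lift y \<zero>\<^bsub>Q.Quo\<^esub> = 0" if "y \<in> edges Y" for y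
    using Q.lift_cls[OF that, of 0] by (simp add: Q.zero_Quo alt_def)
  show "alt_ker (\<sigma>E k y) (\<sigma>E k x) = alt_ker y x" if "k \<in> K" "x \<in> edges Y" "y \<in> edges Y" for k x y
    using that opp_closed by (simp add: alt_ker_def opp_equivariant E.act_inj)
  fix z
  \<comment> \<open>\<open>alt\<close> is a difference without the factor 1/2 of the projection, so
    that factor is put into the chain.\<close>
  let ?c = "E.func (\<lambda>x. z x / 2)"
  have c: "?c \<in> carrier (perm_module (edges Y) \<sigma>E)" using E.keys_func by simp
  have "Q.lift y (Q.cls ?c) = (\<Sum>x\<in>edges Y. alt_ker y x * z x)" if y: "y \<in> edges Y" for y
    unfolding sum_alt_ker[OF y] Q.lift_cls[OF y c] alt_def
    using y opp_closed[OF y] by (simp add: E.lookup_func diff_divide_distrib)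
  then show "\<exists>C\<in>carrier Q.Quo. \<forall>y\<in>edges Y. Q.lift y C = (\<Sum>x\<in>edges Y. alt_ker y x * z x)"
    unfolding Q.carrier_Quo using c by blast
qed

text \<open>The Lefschetz number of \<open>k\<close> on the graph: without inversion a fixed
  geometric edge has two fixed directed edges, hence the half.\<close>

definition lefschetz :: "'g \<Rightarrow> complex" where
  "lefschetz k = of_nat (card {x \<in> verts Y. \<sigma>V k x = x}) - of_nat (card {e \<in> edges Y. \<sigma>E k e = e}) / 2"

lemma euler_char_eq: "equiv_euler_char K Y \<sigma>V \<sigma>E = V.avg lefschetz"
proof -
  have V: "(\<Sum>x\<in>verts Y. V.delta (\<sigma>V k x) x) = of_nat (card {x \<in> verts Y. \<sigma>V k x = x})" for k
  proof -
    have "(\<Sum>x\<in>verts Y. V.delta (\<sigma>V k x) x) = (\<Sum>x\<in>verts Y. if \<sigma>V k x = x then 1 else 0)"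
      by (intro sum.cong) auto
    then show ?thesis using finite_verts by (simp add: sum.If_cases Int_def)
  qed
  have E: "(\<Sum>x\<in>edges Y. alt_ker (\<sigma>E k x) x) = of_nat (card {e \<in> edges Y. \<sigma>E k e = e}) / 2"
    if k: "k \<in> K" for k
  proof -
    \<comment> \<open>This is the use of acting without inversion: the negative part of
      \<open>alt_ker\<close> does not contribute to the trace.\<close>
    have "x \<noteq> opp Y (\<sigma>E k x)" if x: "x \<in> edges Y" for x
      using no_inversion[OF k x] opp_opp[OF E.act_mem[OF k x]] by auto
    then have "(\<Sum>x\<in>edges Y. alt_ker (\<sigma>E k x) x) = (\<Sum>x\<in>edges Y. if \<sigma>E k x = x then 1 / 2 else 0)"
      by (intro sum.cong) (auto simp: alt_ker_def)
    then show ?thesis using finite_edges by (simp add: sum.If_cases Int_def)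
  qed
  have avg_E: "E.avg (\<lambda>k. \<Sum>x\<in>edges Y. alt_ker (\<sigma>E k x) x) =
      V.avg (\<lambda>k. of_nat (card {e \<in> edges Y. \<sigma>E k e = e}) / 2)"
    unfolding V.avg_def E.avg_def by (intro sum.cong) (simp_all only: E)
  show ?thesis
    unfolding equiv_euler_char_def C0.hs_rank_eq C1.hs_rank_eq V avg_E
    by (intro poly_mapping_eqI) (simp add: lookup_minus V.lookup_avg lefschetz_def diff_divide_distrib)
qed

text \<open>Matrix entries, in row \<open>y\<close> and column \<open>x\<close>, of the coefficient
  of degree \<open>i\<close> in the Ihara operator. Complex numbers suffice, so the same entries
  serve every acting group.\<close>

definition beta :: "nat \<Rightarrow> 'v \<Rightarrow> 'v \<Rightarrow> complex" where
  "beta i y x =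
    (if i = 0 then (if x = y then 1 else 0)
     else if i = 1 then - of_nat (card {e \<in> edges Y. org Y e = x \<and> ter Y e = y})
     else if i = 2 then (if x = y then of_nat (valency Y x) - 1 else 0)
     else 0)"

lemma lookup_adjacency_op:
  assumes c: "keys c \<subseteq> verts Y"
  shows "lookup (adjacency_op Y c) y =
    (\<Sum>x\<in>verts Y. of_nat (card {e \<in> edges Y. org Y e = x \<and> ter Y e = y}) * lookup c x)"
proof -
  have "lookup (adjacency_op Y c) y =
      (\<Sum>x\<in>keys c. \<Sum>e\<in>{e \<in> edges Y. org Y e = x}. if ter Y e = y then lookup c x else 0)"
    by (simp add: adjacency_op_def lookup_sum lookup_single when_def)
  also have "\<dots> = (\<Sum>x\<in>keys c.
      of_nat (card {e \<in> edges Y. org Y e = x \<and> ter Y e = y}) * lookup c x)"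
    using finite_edges by (intro sum.cong) (auto simp: sum.If_cases Int_def conj_assoc)
  also have "\<dots> = (\<Sum>x\<in>verts Y. of_nat (card {e \<in> edges Y. org Y e = x \<and> ter Y e = y}) * lookup c x)"
    using c finite_verts by (intro sum.mono_neutral_left) (auto simp: in_keys_iff)
  finally show ?thesis .
qed

lemma lookup_valency_op:
  "lookup (valency_op Y c) y = of_nat (valency Y y) * lookup c y"
  by (auto simp: valency_op_def lookup_sum lookup_single when_def in_keys_iff)

lemma lookup_ihara_coeff:
  assumes c: "keys c \<subseteq> verts Y" and y: "y \<in> verts Y"
  shows "lookup (ihara_coeff Y i c) y = (\<Sum>x\<in>verts Y. beta i y x * lookup c x)"
  using y finite_verts
  by (auto simp: ihara_coeff_def beta_def lookup_adjacency_op[OF c] lookup_valency_op lookup_minus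
      sum_negf left_diff_distrib if_distrib[of "\<lambda>t. t * _"] cong: if_cong)

lemma ihara_coeff_carrier:
  assumes c: "keys c \<subseteq> verts Y"
  shows "keys (ihara_coeff Y i c) \<subseteq> verts Y"
proof -
  have "lookup (ihara_coeff Y i c) y = 0" if y: "y \<notin> verts Y" for y
  proof -
    have "{e \<in> edges Y. org Y e = x \<and> ter Y e = y} = {}" for x using y ter_closed by auto
    then have "lookup (adjacency_op Y c) y = 0"
      by (simp only: lookup_adjacency_op[OF c]) simp
    moreover have "lookup c y = 0" by (rule lookup_zero_outside[OF c y])
    ultimately show ?thesis
      by (auto simp: ihara_coeff_def lookup_valency_op lookup_minus)
  qed
  then show ?thesis by (metis in_keys_iff subsetI)
qed

lemma beta_equivariant:
  assumes k: "k \<in> K" and x: "x \<in> verts Y" and y: "y \<in> verts Y"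
  shows "beta i (\<sigma>V k y) (\<sigma>V k x) = beta i y x"
proof -
  have org: "org Y (\<sigma>E k e) = \<sigma>V k x' \<longleftrightarrow> org Y e = x'" if "e \<in> edges Y" "x' \<in> verts Y" for e x'
    using that k org_closed by (simp add: org_equivariant V.act_inj)
  have ter: "ter Y (\<sigma>E k e) = \<sigma>V k x' \<longleftrightarrow> ter Y e = x'" if "e \<in> edges Y" "x' \<in> verts Y" for e x'
    using that k ter_closed by (simp add: ter_equivariant V.act_inj)
  have image: "card {e \<in> edges Y. P e} = card {e \<in> edges Y. P (\<sigma>E k e)}" for P
  proof -
    have "bij_betw (\<sigma>E k) {e \<in> edges Y. P (\<sigma>E k e)} {e \<in> edges Y. P e}"
      by (rule bij_betw_byWitness[where f' = "\<sigma>E (- k)"])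
        (use k in \<open>auto simp: E.act_uminus_left E.act_uminus_right E.act_mem V.uminus_K\<close>)
    then show ?thesis by (metis bij_betw_same_card)
  qed
  have "{e \<in> edges Y. org Y (\<sigma>E k e) = \<sigma>V k x \<and> ter Y (\<sigma>E k e) = \<sigma>V k y} =
      {e \<in> edges Y. org Y e = x \<and> ter Y e = y}"
    using org[OF _ x] ter[OF _ y] by auto
  moreover have "{e \<in> edges Y. org Y (\<sigma>E k e) = \<sigma>V k x} = {e \<in> edges Y. org Y e = x}"
    using org[OF _ x] by auto
  ultimately show ?thesis
    using image[of "\<lambda>e. org Y e = \<sigma>V k x \<and> ter Y e = \<sigma>V k y"] image[of "\<lambda>e. org Y e = \<sigma>V k x"] k x y
    by (auto simp: beta_def V.act_inj valency_def)
qed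

end

section \<open>Evaluation of the equivariant functions at characters\<close>

lemma (in subring_set) det_mem:
  assumes "A \<in> rmats R n n"
  shows "det A \<in> R"
proof -
  have A: "A \<in> carrier_mat n n" using assms by (simp add: rmats_def)
  have "A $$ (i, p i) \<in> R" if "p permutes {0..<n}" "i < n" for p i
    using assms that permutes_in_image[OF that(1), of i] by (auto simp: rmats_def)
  then show ?thesis
    unfolding det_def'[OF A] by (intro sum_mem mult_mem prod_mem) (auto simp: sign_def)
qed

text \<open>Evaluation at a character is multiplicative on elements supported in the group, not on
  the whole type, so the homomorphism property is asked on \<open>R\<close> only; the Leibniz
  formula stays inside \<open>R\<close>.\<close>

lemma (in subring_set) det_hom_on:
  fixes h :: "'r \<Rightarrow> 's::comm_ring_1"
  assumes h_add: "\<And>a b. a \<in> R \<Longrightarrow> b \<in> R \<Longrightarrow> h (a + b) = h a + h b"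
    and h_mult: "\<And>a b. a \<in> R \<Longrightarrow> b \<in> R \<Longrightarrow> h (a * b) = h a * h b"
    and h_one: "h 1 = 1" and A: "A \<in> rmats R n n"
  shows "h (det A) = det (map_mat h A)"
proof -
  have h_zero: "h 0 = 0" using h_add[of 0 0] by simp
  have h_neg: "h (- 1) = - 1" using h_add[of 1 "- 1"] by (simp add: h_zero h_one eq_neg_iff_add_eq_0 add.commute uminus_mem)
  have h_sum: "h (sum f I) = (\<Sum>i\<in>I. h (f i))" if "\<And>i. i \<in> I \<Longrightarrow> f i \<in> R" for f and I :: "'i set"
    using that by (induction I rule: infinite_finite_induct) (auto simp: h_zero h_add sum_mem)
  have h_prod: "h (prod f I) = (\<Prod>i\<in>I. h (f i))" if "\<And>i. i \<in> I \<Longrightarrow> f i \<in> R" for f and I :: "'i set"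
    using that by (induction I rule: infinite_finite_induct) (auto simp: h_one h_mult prod_mem)
  have A': "A \<in> carrier_mat n n" using A by (simp add: rmats_def)
  have mem: "A $$ (i, p i) \<in> R" if "p permutes {0..<n}" "i < n" for p i
    using A that permutes_in_image[OF that(1), of i] by (auto simp: rmats_def)
  have sgn: "(signof p :: 'r) \<in> R" for p :: "nat \<Rightarrow> nat" by (auto simp: sign_def)
  have sgn_h: "h (signof p) = signof p" for p :: "nat \<Rightarrow> nat" by (simp add: sign_def h_one h_neg)
  have "h (det A) = (\<Sum>p | p permutes {0..<n}. h (signof p * (\<Prod>i = 0..<n. A $$ (i, p i))))"
    unfolding det_def'[OF A'] using mem sgn by (intro h_sum mult_mem prod_mem) auto
  also have "\<dots> = (\<Sum>p | p permutes {0..<n}. signof p * (\<Prod>i = 0..<n. h (A $$ (i, p i))))"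
  proof (rule sum.cong[OF refl])
    fix p :: "nat \<Rightarrow> nat" assume "p \<in> {p. p permutes {0..<n}}"
    then have A_p: "A $$ (i, p i) \<in> R" if "i \<in> {0..<n}" for i using mem that by simp
    show "h (signof p * (\<Prod>i = 0..<n. A $$ (i, p i))) = signof p * (\<Prod>i = 0..<n. h (A $$ (i, p i)))"
      by (simp only: h_mult[OF sgn prod_mem[OF A_p]] sgn_h h_prod[OF A_p])
  qed
  also have "\<dots> = det (map_mat h A)"
  proof -
    have "(\<Prod>i = 0..<n. h (A $$ (i, p i))) = (\<Prod>i = 0..<n. map_mat h A $$ (i, p i))"
      if "p permutes {0..<n}" for p
      using A' permutes_in_image[OF that] by (intro prod.cong) auto
    then show ?thesis
      unfolding det_def'[of "map_mat h A" n, OF map_carrier_mat[THEN iffD2, OF A']] by simp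
  qed
  finally show ?thesis .
qed

lemma mult_mat_entry:
  fixes A B :: "'a::comm_ring_1 mat"
  assumes "A \<in> carrier_mat n m" "B \<in> carrier_mat m l" "r < n" "s < l"
  shows "(A * B) $$ (r, s) = (\<Sum>t<m. A $$ (r, t) * B $$ (t, s))"
  using assms by (auto simp: scalar_prod_def atLeast0LessThan intro!: sum.cong)

text \<open>With \<open>F\<close> the sum of the remaining \<open>E q\<close>, one has (1 + N E)(1 +
  N F) = 1 + N (E + F): the cross term N E N F equals N N E F, which vanishes by
  orthogonality.\<close>

lemma det_one_plus_orthogonal_sum:
  fixes N :: "'a::comm_ring_1 mat" and E :: "'p \<Rightarrow> 'a mat"
  assumes N: "N \<in> carrier_mat n n" and "finite S" and E: "\<And>p. p \<in> S \<Longrightarrow> E p \<in> carrier_mat n n"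
    and comm: "\<And>p. p \<in> S \<Longrightarrow> E p * N = N * E p"
    and orth: "\<And>p q. p \<in> S \<Longrightarrow> q \<in> S \<Longrightarrow> p \<noteq> q \<Longrightarrow> E p * E q = 0\<^sub>m n n"
  shows "det (1\<^sub>m n + N * mat n n (\<lambda>rs. \<Sum>p\<in>S. E p $$ rs)) = (\<Prod>p\<in>S. det (1\<^sub>m n + N * E p))"
  using assms(2-)
proof (induction S)
  case empty
  have "mat n n (\<lambda>rs. \<Sum>p\<in>{}. E p $$ rs) = 0\<^sub>m n n" by auto
  then show ?case using N by simp
next
  case (insert p S)
  define F where "F = mat n n (\<lambda>rs. \<Sum>p\<in>S. E p $$ rs)"
  have F: "F \<in> carrier_mat n n" by (simp add: F_def)
  have Ep: "E p \<in> carrier_mat n n" using insert.prems by simp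
  have sum_eq: "mat n n (\<lambda>rs. \<Sum>p\<in>insert p S. E p $$ rs) = E p + F"
    using insert.hyps Ep by (intro eq_matI) (auto simp: F_def)
  have EF: "E p * F = 0\<^sub>m n n"
  proof (rule eq_matI)
    fix r s assume "r < dim_row (0\<^sub>m n n :: 'a mat)" "s < dim_col (0\<^sub>m n n :: 'a mat)"
    then have rs: "r < n" "s < n" by auto
    have "(E p * F) $$ (r, s) = (\<Sum>t<n. E p $$ (r, t) * (\<Sum>q\<in>S. E q $$ (t, s)))"
      using rs Ep F by (auto simp: scalar_prod_def F_def atLeast0LessThan intro!: sum.cong)
    also have "\<dots> = (\<Sum>q\<in>S. \<Sum>t<n. E p $$ (r, t) * E q $$ (t, s))"
      by (subst sum.swap) (simp add: sum_distrib_left)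
    also have "\<dots> = (\<Sum>q\<in>S. (E p * E q) $$ (r, s))"
    proof (rule sum.cong[OF refl])
      fix q assume "q \<in> S"
      then have "E q \<in> carrier_mat n n" using insert.prems by simp
      then show "(\<Sum>t<n. E p $$ (r, t) * E q $$ (t, s)) = (E p * E q) $$ (r, s)"
        using rs Ep by (auto simp: scalar_prod_def atLeast0LessThan intro!: sum.cong)
    qed
    also have "\<dots> = 0"
    proof (rule sum.neutral, rule ballI)
      fix q assume "q \<in> S"
      then have "E p * E q = 0\<^sub>m n n" using insert.hyps insert.prems(3)[of p q] by auto
      then show "(E p * E q) $$ (r, s) = 0" using rs by simp
    qed
    finally show "(E p * F) $$ (r, s) = 0\<^sub>m n n $$ (r, s)" using rs by simp
  qed (use Ep F in auto)
  have cross: "(N * E p) * (N * F) = 0\<^sub>m n n"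
  proof -
    have "(N * E p) * (N * F) = N * ((E p * N) * F)"
      using N Ep F assoc_mult_mat[of N n n "E p" n "N * F" n] assoc_mult_mat[of "E p" n n N n F n] by simp
    also have "E p * N = N * E p" using insert.prems by simp
    also have "N * E p * F = N * (E p * F)" using N Ep F by (simp add: assoc_mult_mat[of N n n "E p" n F n])
    finally show ?thesis using EF N by simp
  qed
  have "(1\<^sub>m n + N * E p) * (1\<^sub>m n + N * F) = 1\<^sub>m n + N * (E p + F)"
  proof -
    have NE: "N * E p \<in> carrier_mat n n" and NF: "N * F \<in> carrier_mat n n" using N Ep F by auto
    have "(1\<^sub>m n + N * E p) * (1\<^sub>m n + N * F) = 1\<^sub>m n * (1\<^sub>m n + N * F) + N * E p * (1\<^sub>m n + N * F)"
      using NE NF by (intro add_mult_distrib_mat[of _ n n _ _ n]) auto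
    also have "N * E p * (1\<^sub>m n + N * F) = N * E p * 1\<^sub>m n + N * E p * (N * F)"
      using NE NF by (intro mult_add_distrib_mat[of _ n n _ n]) auto
    also have "\<dots> = N * E p" unfolding right_mult_one_mat[OF NE] cross using NE by simp
    also have "1\<^sub>m n * (1\<^sub>m n + N * F) = 1\<^sub>m n + N * F"
      using NF by (intro left_mult_one_mat[of _ n n]) auto
    also have "1\<^sub>m n + N * F + N * E p = 1\<^sub>m n + (N * E p + N * F)"
      using N Ep F by (intro eq_matI) (auto simp: add_ac)
    also have "N * E p + N * F = N * (E p + F)"
      using N Ep F by (simp add: mult_add_distrib_mat[of N n n "E p" n F])
    finally show ?thesis .
  qed
  then have "det (1\<^sub>m n + N * (E p + F)) = det (1\<^sub>m n + N * E p) * det (1\<^sub>m n + N * F)"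
    using N Ep F by (metis add_carrier_mat det_mult mult_carrier_mat one_carrier_mat)
  moreover have "det (1\<^sub>m n + N * F) = (\<Prod>p\<in>S. det (1\<^sub>m n + N * E p))"
    unfolding F_def using insert.prems by (intro insert.IH) auto
  ultimately show ?case using insert.hyps sum_eq by simp
qed

section \<open>Characters on power series over the group algebra\<close>

context finite_add_group
begin

lemma group_alg_fps_subring: "subring_set (group_alg_fps K)"
proof
  show "1 \<in> group_alg_fps K" by (auto simp: group_alg_fps_def)
qed (auto simp: group_alg_fps_def fps_mult_nth intro!: A.sum_mem A.mult_mem A.add_mem A.uminus_mem)

sublocale AF: subring_set "group_alg_fps K" by (rule group_alg_fps_subring)

lemma evs_mult:
  assumes "\<psi> \<in> chars K" "F \<in> group_alg_fps K" "F' \<in> group_alg_fps K"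
  shows "evs K \<psi> (F * F') = evs K \<psi> F * evs K \<psi> F'"
  using assms by (auto simp: fps_eq_iff fps_mult_nth group_alg_fps_def ev_sum ev_mult)

lemma evs_one: "\<psi> \<in> chars K \<Longrightarrow> evs K \<psi> 1 = 1"
  by (simp add: fps_eq_iff ev_one)

lemma evs_power:
  assumes "\<psi> \<in> chars K" "F \<in> group_alg_fps K"
  shows "evs K \<psi> (F ^ m) = evs K \<psi> F ^ m"
  using assms by (induction m) (auto simp: evs_one evs_mult AF.power_mem)

lemma evs_uminus: "evs K \<psi> (- F) = - evs K \<psi> F"
  by (simp add: fps_eq_iff ev_uminus)

lemma scalar_fps_mem: "scalar_fps F \<in> group_alg_fps K"
  by (simp add: scalar_fps_def group_alg_fps_def)

lemma evs_scalar_fps: "\<psi> \<in> chars K \<Longrightarrow> evs K \<psi> (scalar_fps F) = F"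
  by (simp add: fps_eq_iff scalar_fps_def ev_scalar)

lemma evs_const: "evs K \<psi> (fps_const a) = fps_const (ev K \<psi> a)"
  by (simp add: fps_eq_iff)

lemma fps_const_mem: "a \<in> group_alg K \<Longrightarrow> fps_const a \<in> group_alg_fps K"
  by (auto simp: group_alg_fps_def)

lemma compose_mem:
  assumes "F \<in> group_alg_fps K" "F' \<in> group_alg_fps K"
  shows "fps_compose F F' \<in> group_alg_fps K"
  using assms AF.power_mem[OF assms(2)]
  by (auto simp: group_alg_fps_def fps_compose_nth intro!: A.sum_mem A.mult_mem)

lemma evs_compose:
  assumes "\<psi> \<in> chars K" "F \<in> group_alg_fps K" "F' \<in> group_alg_fps K"
  shows "evs K \<psi> (fps_compose F F') = fps_compose (evs K \<psi> F) (evs K \<psi> F')"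
proof -
  have "fps_nth (F' ^ i) n \<in> group_alg K" "fps_nth F i \<in> group_alg K" for i n
    using AF.power_mem[OF assms(3)] assms(2) by (auto simp: group_alg_fps_def)
  moreover have "ev K \<psi> (fps_nth (F' ^ i) n) = fps_nth (evs K \<psi> F' ^ i) n" for i n
    using evs_power[OF assms(1,3), of i] by (metis evs_nth)
  ultimately show ?thesis
    using assms by (simp add: fps_eq_iff fps_compose_nth ev_sum ev_mult)
qed

text \<open>The recursion for the inverse of a series with constant coefficient 1 uses only ring
  operations on the coefficients, so the inverse stays over the group algebra of \<open>K\<close>.
  Uniqueness of inverses identifies it with the one from \<open>ring_on\<close>, in terms of which
  \<theta> is defined.\<close>

lemma inv_group_alg_fps:
  assumes W: "W \<in> group_alg_fps K" and W0: "fps_nth W 0 = 1"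
  shows "inv\<^bsub>ring_on (group_alg_fps K)\<^esub> W \<in> group_alg_fps K"
    and "W * inv\<^bsub>ring_on (group_alg_fps K)\<^esub> W = 1"
proof -
  define Z where "Z = fps_right_inverse W 1"
  have WZ: "W * Z = 1" unfolding Z_def by (rule fps_right_inverse) (simp add: W0)
  have Wi: "fps_nth W i \<in> group_alg K" for i using W by (simp add: group_alg_fps_def)
  have "fps_right_inverse_constructor W 1 m \<in> group_alg K" for m
  proof (induction m rule: less_induct)
    case (less m)
    show ?case
    proof (cases "m = 0")
      case False
      then show ?thesis
        using less Wi
        by (subst fps_right_inverse_constructor_rec) (auto intro!: A.uminus_mem A.sum_mem A.mult_mem)
    qed auto
  qed
  then have Z: "Z \<in> group_alg_fps K" by (simp add: Z_def group_alg_fps_def)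
  have "inv\<^bsub>ring_on (group_alg_fps K)\<^esub> W = Z"
    unfolding m_inv_def
  proof (rule the_equality)
    show "Z \<in> carrier (ring_on (group_alg_fps K)) \<and>
        W \<otimes>\<^bsub>ring_on (group_alg_fps K)\<^esub> Z = \<one>\<^bsub>ring_on (group_alg_fps K)\<^esub> \<and>
        Z \<otimes>\<^bsub>ring_on (group_alg_fps K)\<^esub> W = \<one>\<^bsub>ring_on (group_alg_fps K)\<^esub>"
      using Z WZ by (simp add: mult.commute)
    fix Z' assume "Z' \<in> carrier (ring_on (group_alg_fps K)) \<and>
        W \<otimes>\<^bsub>ring_on (group_alg_fps K)\<^esub> Z' = \<one>\<^bsub>ring_on (group_alg_fps K)\<^esub> \<and>
        Z' \<otimes>\<^bsub>ring_on (group_alg_fps K)\<^esub> W = \<one>\<^bsub>ring_on (group_alg_fps K)\<^esub>"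
    then have Z': "W * Z' = 1" by simp
    have "Z' = (W * Z) * Z'" by (simp add: WZ)
    also have "\<dots> = (W * Z') * Z" by (simp only: mult_ac)
    finally show "Z' = Z" by (simp add: Z')
  qed
  with Z WZ show "inv\<^bsub>ring_on (group_alg_fps K)\<^esub> W \<in> group_alg_fps K"
    and "W * inv\<^bsub>ring_on (group_alg_fps K)\<^esub> W = 1" by simp_all
qed

end

text \<open>Moves the constant into the outer exponential, where sums of constants turn into
  products of series.\<close>

lemma fps_exp_compose_uminus_const:
  fixes c :: complex
  shows "fps_exp 1 oo (- fps_const c * L) = fps_exp (- c) oo L"
proof -
  have pow: "(- fps_const c * L) ^ i = fps_const ((- c) ^ i) * L ^ i" for i
    by (simp only: fps_const_neg power_mult_distrib fps_const_power)
  show ?thesis unfolding fps_eq_iff fps_compose_nth pow by simp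
qed

lemma fps_exp_sum:
  fixes c :: "'p \<Rightarrow> complex"
  assumes "finite S" and L: "fps_nth L 0 = 0"
  shows "fps_exp (\<Sum>p\<in>S. c p) oo L = (\<Prod>p\<in>S. fps_exp (c p) oo L)"
  using assms(1)
proof (induction S)
  case (insert p S)
  then show ?case by (simp add: fps_exp_add_mult fps_compose_mult_distrib[OF L])
qed simp

section \<open>Values of gamma, eta and theta at a character\<close>

context graph_action
begin

lemma euler_char_mem: "equiv_euler_char K Y \<sigma>V \<sigma>E \<in> group_alg K"
  unfolding euler_char_eq by (rule V.avg_mem)

lemma gamma_mem: "equiv_gamma K Y \<sigma>V \<sigma>E \<in> group_alg_fps K"
  unfolding equiv_gamma_def
  by (intro V.compose_mem V.scalar_fps_mem V.AF.mult_mem V.AF.uminus_mem V.fps_const_mem euler_char_mem)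

lemma evs_gamma:
  assumes \<psi>: "\<psi> \<in> chars K"
  shows "evs K \<psi> (equiv_gamma K Y \<sigma>V \<sigma>E) =
    fps_exp (- ((\<Sum>k\<in>K. lefschetz k * \<psi> k) / of_nat (card K))) oo (fps_ln 1 oo - (fps_X ^ 2))"
proof -
  have m: "- fps_const (equiv_euler_char K Y \<sigma>V \<sigma>E) \<in> group_alg_fps K"
    by (intro V.AF.uminus_mem V.fps_const_mem euler_char_mem)
  have "evs K \<psi> (equiv_gamma K Y \<sigma>V \<sigma>E) =
      fps_exp 1 oo (- fps_const (ev K \<psi> (equiv_euler_char K Y \<sigma>V \<sigma>E)) * (fps_ln 1 oo - (fps_X ^ 2)))"
    unfolding equiv_gamma_def
    using \<psi> m V.AF.mult_mem[OF m V.scalar_fps_mem]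
    by (simp only: V.evs_compose V.evs_mult V.scalar_fps_mem V.evs_scalar_fps V.evs_uminus V.evs_const)
  then show ?thesis
    unfolding fps_exp_compose_uminus_const euler_char_eq V.ev_avg .
qed

lemma gamma_nth_0: "fps_nth (equiv_gamma K Y \<sigma>V \<sigma>E) 0 = 1"
  by (simp add: equiv_gamma_def scalar_fps_def)

definition B_mat :: "('g \<Rightarrow>\<^sub>0 complex) poly mat" where
  "B_mat = mat V.n V.n (\<lambda>(r, s).
    [:scalar (beta 0 (V.enum r) (V.enum s)), scalar (beta 1 (V.enum r) (V.enum s)), scalar (beta 2 (V.enum r) (V.enum s)):])"

lemma coeff_B_mat:
  "r < V.n \<Longrightarrow> s < V.n \<Longrightarrow> coeff (B_mat $$ (r, s)) j = scalar (beta j (V.enum r) (V.enum s))"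
  by (auto simp: B_mat_def coeff_pCons beta_def numeral_2_eq_2 split: nat.splits)

lemma B_mat_carrier: "B_mat \<in> carrier_mat V.n V.n"
  by (simp add: B_mat_def)

lemma B_mat_mem: "B_mat \<in> rmats (polys_over (group_alg K)) V.n V.n"
  using B_mat_carrier by (auto simp: rmats_def polys_over_def coeff_B_mat)

lemma E_poly_carrier: "C0.E_poly \<in> carrier_mat V.n V.n"
  unfolding C0.E_poly_def using C0.E_carrier by simp

lemma E_poly_entry:
  assumes "t < V.n" "s < V.n"
  shows "C0.E_poly $$ (t, s) = [:V.avg (\<lambda>k. V.delta (\<sigma>V k (V.enum t)) (V.enum s)):]"
proof -
  have "C0.E_poly $$ (t, s) = [:V.avg_mat V.delta $$ (t, s):]"
    unfolding C0.E_poly_def using C0.E_carrier assms by simp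
  then show ?thesis using assms by (simp add: V.avg_mat_def)
qed

text \<open>A matrix of plain complex numbers represents the Ihara operator in the averaged
  coordinates because \<open>beta\<close> is equivariant. The idempotent factor accounts for chain
  modules that are projective but not free.\<close>

lemma eta_eq: "equiv_eta K Y \<sigma>V = det (1\<^sub>m V.n + (B_mat - 1\<^sub>m V.n) * C0.E_poly)"
proof -
  have polys: "group_alg_poly K = polys_over (group_alg K)"
    by (simp add: group_alg_poly_def polys_over_def)
  have carrier: "carrier (chains0 Y \<sigma>V) = {c. keys c \<subseteq> verts Y}"
    by (simp add: chains0_def)
  show ?thesis
    unfolding equiv_eta_def polys
  proof (rule C0.proj_det_series_endo)
    show "ihara_coeff Y j c \<in> carrier (chains0 Y \<sigma>V)" if "c \<in> carrier (chains0 Y \<sigma>V)" for j c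
      using that ihara_coeff_carrier by (simp add: carrier)
    show "B_mat \<in> rmats (polys_over (group_alg K)) V.n V.n" by (rule B_mat_mem)
    fix j c r assume c: "c \<in> carrier (chains0 Y \<sigma>V)" and r: "r < V.n"
    have c': "keys c \<subseteq> verts Y" using c by (simp add: carrier)
    let ?y = "V.enum r"
    have y: "?y \<in> verts Y" by (rule V.enum_mem[OF r])
    show "C0.emb (ihara_coeff Y j c) $ r =
        (\<Sum>s<V.n. coeff (B_mat $$ (r, s)) j * C0.emb c $ s)"
    proof (rule V.group_alg_eqI)
      show "C0.emb (ihara_coeff Y j c) $ r \<in> group_alg K" using r by (auto simp: C0.emb_def)
      show "(\<Sum>s<V.n. coeff (B_mat $$ (r, s)) j * C0.emb c $ s) \<in> group_alg K"
        using r by (intro V.A.sum_mem V.A.mult_mem) (auto simp: coeff_B_mat C0.emb_def)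
      fix k assume k: "k \<in> K"
      have "lookup (C0.emb (ihara_coeff Y j c) $ r) k =
          (\<Sum>x\<in>verts Y. beta j (\<sigma>V k ?y) x * lookup c x) / of_nat (card K)"
        using r k by (simp add: C0.emb_def V.lookup_avg lookup_ihara_coeff[OF c' V.act_mem[OF k y]])
      \<comment> \<open>Reindexing by \<open>k\<close> and using equivariance removes
        \<open>k\<close> from the matrix entry, so one matrix works for the coefficients at all
        \<open>k\<close>.\<close>
      also have "(\<Sum>x\<in>verts Y. beta j (\<sigma>V k ?y) x * lookup c x) =
          (\<Sum>x\<in>verts Y. beta j (\<sigma>V k ?y) (\<sigma>V k x) * lookup c (\<sigma>V k x))"
        by (rule V.sum_act[OF k, symmetric])
      also have "\<dots> = (\<Sum>x\<in>verts Y. beta j ?y x * lookup c (\<sigma>V k x))"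
        by (intro sum.cong) (auto simp: beta_equivariant[OF k _ y])
      also have "\<dots> = (\<Sum>s<V.n. beta j ?y (V.enum s) * lookup c (\<sigma>V k (V.enum s)))"
        by (rule V.sum_enum[symmetric])
      also have "\<dots> / of_nat (card K) =
          lookup (\<Sum>s<V.n. coeff (B_mat $$ (r, s)) j * C0.emb c $ s) k"
        using r k by (simp add: lookup_sum coeff_B_mat lookup_single_mult C0.emb_def V.lookup_avg sum_divide_distrib)
      finally show "lookup (C0.emb (ihara_coeff Y j c) $ r) k =
          lookup (\<Sum>s<V.n. coeff (B_mat $$ (r, s)) j * C0.emb c $ s) k" .
    qed
  qed
qed

lemma eta_matrix_mem:
  "1\<^sub>m V.n + (B_mat - 1\<^sub>m V.n) * C0.E_poly \<in> rmats (polys_over (group_alg K)) V.n V.n"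
proof -
  interpret P: projective_embedding "polys_over (group_alg K)" "poly_module (chains0 Y \<sigma>V)" V.n C0.emb_poly C0.E_poly
    by (rule C0.poly_embedding)
  show ?thesis
    by (intro P.one_mat_add_mem P.mult_mat_mem[OF P.minus_one_mat_mem P.E_mem] B_mat_mem)
qed

lemma eta_mem: "fps_of_poly (equiv_eta K Y \<sigma>V) \<in> group_alg_fps K"
proof -
  interpret P: subring_set "polys_over (group_alg K)" by (rule V.A.polys_over_subring)
  have "equiv_eta K Y \<sigma>V \<in> polys_over (group_alg K)"
    unfolding eta_eq by (rule P.det_mem[OF eta_matrix_mem])
  then show ?thesis by (simp add: polys_over_def group_alg_fps_def)
qed

text \<open>At u = 0 the Ihara operator is the identity and \<open>B_mat - 1\<close> vanishes.
  Together with \<open>gamma_nth_0\<close> this makes \<gamma>\<eta> invertible.\<close>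

lemma eta_nth_0: "coeff (equiv_eta K Y \<sigma>V) 0 = 1"
proof -
  \<comment> \<open>Taking the constant coefficient is a homomorphism on all polynomials, so
    \<open>det_hom_on\<close> is used with the full ring.\<close>
  interpret U: subring_set "UNIV :: ('g \<Rightarrow>\<^sub>0 complex) poly set" by unfold_locales auto
  have "coeff (equiv_eta K Y \<sigma>V) 0 =
      det (map_mat (\<lambda>p. coeff p 0) (1\<^sub>m V.n + (B_mat - 1\<^sub>m V.n) * C0.E_poly))"
    unfolding eta_eq using eta_matrix_mem
    by (intro U.det_hom_on) (auto simp: coeff_mult_0 rmats_def)
  also have "map_mat (\<lambda>p. coeff p 0) (1\<^sub>m V.n + (B_mat - 1\<^sub>m V.n) * C0.E_poly) = 1\<^sub>m V.n"
  proof (rule eq_matI)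
    fix r s assume "r < dim_row (1\<^sub>m V.n :: ('g \<Rightarrow>\<^sub>0 complex) mat)" "s < dim_col (1\<^sub>m V.n :: ('g \<Rightarrow>\<^sub>0 complex) mat)"
    then have rs: "r < V.n" "s < V.n" by auto
    have B: "coeff ((B_mat - 1\<^sub>m V.n) $$ (r, t)) 0 = 0" if "t < V.n" for t
      using rs that by (auto simp: coeff_B_mat beta_def V.enum_inj B_mat_def)
    have "((B_mat - 1\<^sub>m V.n) * C0.E_poly) $$ (r, s) =
        (\<Sum>t<V.n. (B_mat - 1\<^sub>m V.n) $$ (r, t) * C0.E_poly $$ (t, s))"
      by (rule mult_mat_entry[OF _ E_poly_carrier rs]) (use B_mat_carrier in auto)
    then have "coeff (((B_mat - 1\<^sub>m V.n) * C0.E_poly) $$ (r, s)) 0 = 0"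
      using B by (simp add: coeff_sum coeff_mult_0)
    moreover have "dim_row ((B_mat - 1\<^sub>m V.n) * C0.E_poly) = V.n" "dim_col ((B_mat - 1\<^sub>m V.n) * C0.E_poly) = V.n"
      using B_mat_carrier E_poly_carrier by auto
    ultimately show "map_mat (\<lambda>p. coeff p 0) (1\<^sub>m V.n + (B_mat - 1\<^sub>m V.n) * C0.E_poly) $$ (r, s) =
        1\<^sub>m V.n $$ (r, s)" using rs by (simp del: index_mult_mat)
  qed (use E_poly_carrier in auto)
  finally show ?thesis by simp
qed

definition N_mat :: "complex fps mat" where
  "N_mat = mat V.n V.n (\<lambda>(r, s). Abs_fps (\<lambda>j. beta j (V.enum r) (V.enum s)) - (if r = s then 1 else 0))"

text \<open>The kernel of the projection onto the \<psi>-isotypic chains: it maps c to the mean over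
  k of \<psi>(k) times the translate of c by -k. It is also the value at \<psi> of the idempotent
  matrix of the vertex chains.\<close>

definition P_ker :: "('g \<Rightarrow> complex) \<Rightarrow> 'v \<Rightarrow> 'v \<Rightarrow> complex" where
  "P_ker \<psi> y x = (\<Sum>k\<in>K. if \<sigma>V k y = x then \<psi> k else 0) / of_nat (card K)"

definition P_mat :: "('g \<Rightarrow> complex) \<Rightarrow> complex fps mat" where
  "P_mat \<psi> = mat V.n V.n (\<lambda>(r, s). fps_const (P_ker \<psi> (V.enum r) (V.enum s)))"

lemma N_mat_carrier: "N_mat \<in> carrier_mat V.n V.n"
  by (simp add: N_mat_def)

lemma P_mat_carrier: "P_mat \<psi> \<in> carrier_mat V.n V.n"
  by (simp add: P_mat_def)

text \<open>Evaluation is applied entrywise under the determinant of \<open>eta_eq\<close>. The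
  entries of \<open>B_mat\<close> are scalars, so their values do not depend on \<psi>; only the
  idempotent changes, into \<open>P_mat \<psi>\<close>.\<close>

lemma evs_eta:
  assumes \<psi>: "\<psi> \<in> chars K"
  shows "evs K \<psi> (fps_of_poly (equiv_eta K Y \<sigma>V)) = det (1\<^sub>m V.n + N_mat * P_mat \<psi>)"
proof -
  interpret P: subring_set "polys_over (group_alg K)" by (rule V.A.polys_over_subring)
  define h where "h p = evs K \<psi> (fps_of_poly p)" for p
  have fps_mem: "fps_of_poly p \<in> group_alg_fps K" if "p \<in> polys_over (group_alg K)" for p
    using that by (simp add: polys_over_def group_alg_fps_def)
  have h_add: "h (p + q) = h p + h q" for p q
    by (simp add: h_def fps_eq_iff V.ev_add)
  have h_mult: "h (p * q) = h p * h q" if "p \<in> polys_over (group_alg K)" "q \<in> polys_over (group_alg K)" for p q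
    using V.evs_mult[OF \<psi> fps_mem[OF that(1)] fps_mem[OF that(2)]] by (simp add: h_def fps_of_poly_mult)
  have h_one: "h 1 = 1" using V.evs_one[OF \<psi>] by (simp add: h_def)
  have h_zero: "h 0 = 0" using h_add[of 0 0] by simp
  have h_diff: "h (p - q) = h p - h q" for p q
    by (simp add: h_def fps_eq_iff V.ev_diff)
  have h_sum: "h (sum f I) = (\<Sum>i\<in>I. h (f i))" for f and I :: "nat set"
    by (induction I rule: infinite_finite_induct) (auto simp: h_zero h_add)
  note BI_mem = P.minus_one_mat_mem[OF B_mat_mem]
  have E_mem: "C0.E_poly $$ (t, s) \<in> polys_over (group_alg K)" if "t < V.n" "s < V.n" for t s
    unfolding E_poly_entry[OF that] by (auto simp: polys_over_def coeff_pCons split: nat.splits)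
  have h_E: "h (C0.E_poly $$ (t, s)) = P_mat \<psi> $$ (t, s)" if "t < V.n" "s < V.n" for t s
  proof -
    have "ev K \<psi> (V.avg (\<lambda>k. V.delta (\<sigma>V k (V.enum t)) (V.enum s))) = P_ker \<psi> (V.enum t) (V.enum s)"
      unfolding V.ev_avg P_ker_def by (intro arg_cong2[of _ _ _ _ "(/)"] sum.cong) auto
    then show ?thesis
      using that unfolding E_poly_entry[OF that] by (simp add: h_def fps_of_poly_const V.evs_const P_mat_def)
  qed
  have h_B: "h ((B_mat - 1\<^sub>m V.n) $$ (r, t)) = N_mat $$ (r, t)" if "r < V.n" "t < V.n" for r t
  proof -
    have "h (B_mat $$ (r, t)) = Abs_fps (\<lambda>j. beta j (V.enum r) (V.enum t))"
      using that \<psi> by (simp add: h_def fps_eq_iff coeff_B_mat V.ev_scalar)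
    moreover have "(B_mat - 1\<^sub>m V.n) $$ (r, t) = B_mat $$ (r, t) - (if r = t then 1 else 0)"
      using that by (simp add: B_mat_def)
    ultimately show ?thesis using that by (simp add: h_diff h_one h_zero N_mat_def)
  qed
  have "h (equiv_eta K Y \<sigma>V) = det (map_mat h (1\<^sub>m V.n + (B_mat - 1\<^sub>m V.n) * C0.E_poly))"
    unfolding eta_eq by (rule P.det_hom_on[OF h_add h_mult h_one eta_matrix_mem])
  also have "map_mat h (1\<^sub>m V.n + (B_mat - 1\<^sub>m V.n) * C0.E_poly) = 1\<^sub>m V.n + N_mat * P_mat \<psi>"
  proof (rule eq_matI)
    fix r s assume "r < dim_row (1\<^sub>m V.n + N_mat * P_mat \<psi>)" "s < dim_col (1\<^sub>m V.n + N_mat * P_mat \<psi>)"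
    then have rs: "r < V.n" "s < V.n" by (auto simp: N_mat_def P_mat_def)
    have 1: "((B_mat - 1\<^sub>m V.n) * C0.E_poly) $$ (r, s) =
        (\<Sum>t<V.n. (B_mat - 1\<^sub>m V.n) $$ (r, t) * C0.E_poly $$ (t, s))"
      by (rule mult_mat_entry[OF _ E_poly_carrier rs]) (use B_mat_carrier in auto)
    have 2: "(N_mat * P_mat \<psi>) $$ (r, s) = (\<Sum>t<V.n. N_mat $$ (r, t) * P_mat \<psi> $$ (t, s))"
      by (rule mult_mat_entry[OF N_mat_carrier P_mat_carrier rs])
    have "h ((B_mat - 1\<^sub>m V.n) $$ (r, t) * C0.E_poly $$ (t, s)) = N_mat $$ (r, t) * P_mat \<psi> $$ (t, s)"
      if t: "t < V.n" for t
    proof -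
      have "(B_mat - 1\<^sub>m V.n) $$ (r, t) \<in> polys_over (group_alg K)" using BI_mem rs t by (auto simp: rmats_def)
      then show ?thesis
        using h_mult[OF _ E_mem[OF t rs(2)]] h_B[OF rs(1) t] h_E[OF t rs(2)] by simp
    qed
    then have "h (((B_mat - 1\<^sub>m V.n) * C0.E_poly) $$ (r, s)) = (N_mat * P_mat \<psi>) $$ (r, s)"
      unfolding 1 2 h_sum by (intro sum.cong) auto
    moreover have "dim_row ((B_mat - 1\<^sub>m V.n) * C0.E_poly) = V.n" "dim_col ((B_mat - 1\<^sub>m V.n) * C0.E_poly) = V.n"
      "dim_row (N_mat * P_mat \<psi>) = V.n" "dim_col (N_mat * P_mat \<psi>) = V.n"
      using B_mat_carrier E_poly_carrier by (auto simp: N_mat_def P_mat_def)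
    ultimately show "map_mat h (1\<^sub>m V.n + (B_mat - 1\<^sub>m V.n) * C0.E_poly) $$ (r, s) =
        (1\<^sub>m V.n + N_mat * P_mat \<psi>) $$ (r, s)"
      using rs by (simp add: h_add h_one h_zero del: index_mult_mat)
  qed (use E_poly_carrier in \<open>auto simp: N_mat_def P_mat_def\<close>)
  finally show ?thesis by (simp add: h_def)
qed

lemma N_entry_equivariant:
  assumes "k \<in> K" "x \<in> verts Y" "y \<in> verts Y"
  shows "Abs_fps (\<lambda>j. beta j (\<sigma>V k y) (\<sigma>V k x)) - (if \<sigma>V k y = \<sigma>V k x then 1 else 0) =
    Abs_fps (\<lambda>j. beta j y x) - (if y = x then 1 else 0)"
  using assms by (simp add: beta_equivariant V.act_inj)

text \<open>\<open>P_mat \<psi>\<close> is a weighted mean of the permutation matrices of the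
  action, and each of them commutes with \<open>N_mat\<close> because \<open>beta\<close> is
  equivariant.\<close>

lemma P_mat_commute: "P_mat \<psi> * N_mat = N_mat * P_mat \<psi>"
proof (rule eq_matI)
  define \<nu> :: "'v \<Rightarrow> 'v \<Rightarrow> complex fps" where
    "\<nu> y x = Abs_fps (\<lambda>j. beta j y x) - (if y = x then 1 else 0)" for y x
  have \<nu>: "\<nu> (\<sigma>V k y) (\<sigma>V k x) = \<nu> y x" if "k \<in> K" "x \<in> verts Y" "y \<in> verts Y" for k x y
    unfolding \<nu>_def by (rule N_entry_equivariant[OF that])
  have N_entry: "N_mat $$ (r, s) = \<nu> (V.enum r) (V.enum s)" if "r < V.n" "s < V.n" for r s
    using that by (simp add: N_mat_def \<nu>_def V.enum_inj)
  have const: "fps_const (P_ker \<psi> y x) =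
      (\<Sum>k\<in>K. if \<sigma>V k y = x then fps_const (\<psi> k / of_nat (card K)) else 0)" for y x
  proof -
    have "P_ker \<psi> y x = (\<Sum>k\<in>K. if \<sigma>V k y = x then \<psi> k / of_nat (card K) else 0)"
      unfolding P_ker_def sum_divide_distrib by (intro sum.cong) auto
    then have "fps_const (P_ker \<psi> y x) = (\<Sum>k\<in>K. fps_const (if \<sigma>V k y = x then \<psi> k / of_nat (card K) else 0))"
      by (simp add: fps_eq_iff fps_sum_nth)
    also have "\<dots> = (\<Sum>k\<in>K. if \<sigma>V k y = x then fps_const (\<psi> k / of_nat (card K)) else 0)"
      by (intro sum.cong) auto
    finally show ?thesis .
  qed
  fix r s assume "r < dim_row (N_mat * P_mat \<psi>)" "s < dim_col (N_mat * P_mat \<psi>)"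
  then have rs: "r < V.n" "s < V.n" by (auto simp: N_mat_def P_mat_def)
  let ?y = "V.enum r" and ?x = "V.enum s"
  have y: "?y \<in> verts Y" and x: "?x \<in> verts Y" using V.enum_mem rs by auto
  have "(P_mat \<psi> * N_mat) $$ (r, s) = (\<Sum>t<V.n. P_mat \<psi> $$ (r, t) * N_mat $$ (t, s))"
    by (rule mult_mat_entry[OF P_mat_carrier N_mat_carrier rs])
  also have "\<dots> = (\<Sum>t<V.n. fps_const (P_ker \<psi> ?y (V.enum t)) * \<nu> (V.enum t) ?x)"
    using rs by (intro sum.cong) (auto simp: P_mat_def N_entry)
  also have "\<dots> = (\<Sum>z\<in>verts Y. fps_const (P_ker \<psi> ?y z) * \<nu> z ?x)"
    by (rule V.sum_enum)
  also have "\<dots> = (\<Sum>k\<in>K. \<Sum>z\<in>verts Y. (if z = \<sigma>V k ?y then fps_const (\<psi> k / of_nat (card K)) * \<nu> (\<sigma>V k ?y) ?x else 0))"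
    unfolding const sum_distrib_right by (subst sum.swap) (auto intro!: sum.cong)
  also have "\<dots> = (\<Sum>k\<in>K. fps_const (\<psi> k / of_nat (card K)) * \<nu> (\<sigma>V k ?y) ?x)"
    using V.act_mem[OF _ y] finite_verts by (intro sum.cong) auto
  also have "\<dots> = (\<Sum>k\<in>K. fps_const (\<psi> k / of_nat (card K)) * \<nu> ?y (\<sigma>V (- k) ?x))"
  proof (rule sum.cong[OF refl])
    fix k assume k: "k \<in> K"
    have "\<nu> (\<sigma>V k ?y) ?x = \<nu> (\<sigma>V k ?y) (\<sigma>V k (\<sigma>V (- k) ?x))"
      using V.act_uminus_right[OF k x] by simp
    then show "fps_const (\<psi> k / of_nat (card K)) * \<nu> (\<sigma>V k ?y) ?x =
        fps_const (\<psi> k / of_nat (card K)) * \<nu> ?y (\<sigma>V (- k) ?x)"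
      using \<nu>[OF k V.act_mem[OF V.uminus_K[OF k] x] y] by simp
  qed
  also have "\<dots> = (\<Sum>k\<in>K. \<Sum>z\<in>verts Y. (if z = \<sigma>V (- k) ?x then \<nu> ?y (\<sigma>V (- k) ?x) * fps_const (\<psi> k / of_nat (card K)) else 0))"
    using V.act_mem[OF V.uminus_K x] finite_verts by (intro sum.cong) auto
  also have "\<dots> = (\<Sum>z\<in>verts Y. \<nu> ?y z * fps_const (P_ker \<psi> z ?x))"
    unfolding const sum_distrib_left using V.act_eq_iff[OF _ _ x]
    by (subst sum.swap) (auto intro!: sum.cong)
  also have "\<dots> = (\<Sum>t<V.n. \<nu> ?y (V.enum t) * fps_const (P_ker \<psi> (V.enum t) ?x))"
    by (rule V.sum_enum[symmetric])
  also have "\<dots> = (\<Sum>t<V.n. N_mat $$ (r, t) * P_mat \<psi> $$ (t, s))"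
    using rs by (intro sum.cong) (auto simp: P_mat_def N_entry)
  also have "\<dots> = (N_mat * P_mat \<psi>) $$ (r, s)"
    by (rule mult_mat_entry[OF N_mat_carrier P_mat_carrier rs, symmetric])
  finally show "(P_mat \<psi> * N_mat) $$ (r, s) = (N_mat * P_mat \<psi>) $$ (r, s)" .
qed (auto simp: N_mat_def P_mat_def)

text \<open>Composing the two projections gives a double sum over the group. Substituting l = m - k
  separates the variables, and the factor depending on k is the pairing of two distinct
  characters.\<close>

lemma P_mat_orthogonal:
  assumes \<psi>: "\<psi> \<in> chars K" and \<phi>: "\<phi> \<in> chars K" and "\<psi> \<noteq> \<phi>"
  shows "P_mat \<psi> * P_mat \<phi> = 0\<^sub>m V.n V.n"
proof (rule eq_matI)
  fix r s assume "r < dim_row (0\<^sub>m V.n V.n :: complex fps mat)" "s < dim_col (0\<^sub>m V.n V.n :: complex fps mat)"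
  then have rs: "r < V.n" "s < V.n" by auto
  let ?y = "V.enum r" and ?x = "V.enum s"
  have y: "?y \<in> verts Y" using V.enum_mem rs by auto
  have "(\<Sum>z\<in>verts Y. P_ker \<psi> ?y z * P_ker \<phi> z ?x) =
      (\<Sum>z\<in>verts Y. \<Sum>k\<in>K. if z = \<sigma>V k ?y then \<psi> k / of_nat (card K) * P_ker \<phi> (\<sigma>V k ?y) ?x else 0)"
    unfolding P_ker_def[of \<psi>] sum_divide_distrib sum_distrib_right by (intro sum.cong) auto
  also have "\<dots> = (\<Sum>k\<in>K. \<psi> k / of_nat (card K) * P_ker \<phi> (\<sigma>V k ?y) ?x)"
    using V.act_mem[OF _ y] finite_verts by (subst sum.swap) (auto intro!: sum.cong)
  also have "\<dots> = (\<Sum>k\<in>K. \<Sum>m\<in>K. if \<sigma>V m ?y = ?x then \<psi> k * \<phi> (- k) * (\<phi> m / (of_nat (card K) * of_nat (card K))) else 0)"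
  proof (rule sum.cong[OF refl])
    fix k assume k: "k \<in> K"
    \<comment> \<open>Only the product of the two translations matters, so the sum is reindexed by
      it.\<close>
    have "(\<Sum>l\<in>K. if \<sigma>V l (\<sigma>V k ?y) = ?x then \<phi> l else 0) =
        (\<Sum>m\<in>K. if \<sigma>V (- k + m) (\<sigma>V k ?y) = ?x then \<phi> (- k + m) else 0)"
      by (rule V.sum_K_translate[OF V.uminus_K[OF k], symmetric])
    also have "\<dots> = (\<Sum>m\<in>K. if \<sigma>V m ?y = ?x then \<phi> (- k) * \<phi> m else 0)"
    proof (rule sum.cong[OF refl])
      fix m assume m: "m \<in> K"
      have "\<sigma>V (- k + m) (\<sigma>V k ?y) = \<sigma>V m ?y"
        using V.act_add[OF V.add_K[OF V.uminus_K[OF k] m] k y] by simp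
      then show "(if \<sigma>V (- k + m) (\<sigma>V k ?y) = ?x then \<phi> (- k + m) else 0) =
          (if \<sigma>V m ?y = ?x then \<phi> (- k) * \<phi> m else 0)"
        using V.char_mult[OF \<phi> V.uminus_K[OF k] m] by simp
    qed
    finally have P: "P_ker \<phi> (\<sigma>V k ?y) ?x =
        (\<Sum>m\<in>K. if \<sigma>V m ?y = ?x then \<phi> (- k) * \<phi> m else 0) / of_nat (card K)"
      by (simp add: P_ker_def)
    show "\<psi> k / of_nat (card K) * P_ker \<phi> (\<sigma>V k ?y) ?x =
        (\<Sum>m\<in>K. if \<sigma>V m ?y = ?x then \<psi> k * \<phi> (- k) * (\<phi> m / (of_nat (card K) * of_nat (card K))) else 0)"
      unfolding P sum_divide_distrib sum_distrib_left by (intro sum.cong) auto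
  qed
  also have "\<dots> = (\<Sum>m\<in>K. if \<sigma>V m ?y = ?x then (\<Sum>k\<in>K. \<psi> k * \<phi> (- k)) * (\<phi> m / (of_nat (card K) * of_nat (card K))) else 0)"
    by (subst sum.swap) (auto intro!: sum.cong simp: sum_distrib_right sum_divide_distrib)
  also have "\<dots> = 0" using V.char_orthogonality[OF \<psi> \<phi>] \<open>\<psi> \<noteq> \<phi>\<close> by simp
  finally have zero: "(\<Sum>z\<in>verts Y. P_ker \<psi> ?y z * P_ker \<phi> z ?x) = 0" .
  have "(P_mat \<psi> * P_mat \<phi>) $$ (r, s) =
      (\<Sum>t<V.n. fps_const (P_ker \<psi> ?y (V.enum t)) * fps_const (P_ker \<phi> (V.enum t) ?x))"
    unfolding mult_mat_entry[OF P_mat_carrier P_mat_carrier rs]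
    using rs by (intro sum.cong) (auto simp: P_mat_def)
  also have "\<dots> = (\<Sum>z\<in>verts Y. fps_const (P_ker \<psi> ?y z) * fps_const (P_ker \<phi> z ?x))"
    by (rule V.sum_enum)
  also have "\<dots> = fps_const (\<Sum>z\<in>verts Y. P_ker \<psi> ?y z * P_ker \<phi> z ?x)"
    by (simp add: fps_eq_iff fps_sum_nth)
  finally show "(P_mat \<psi> * P_mat \<phi>) $$ (r, s) = 0\<^sub>m V.n V.n $$ (r, s)"
    using zero rs by simp
qed (auto simp: P_mat_def)

lemma theta_mem: "equiv_theta K Y \<sigma>V \<sigma>E \<in> group_alg_fps K"
  and theta_inverse:
    "equiv_gamma K Y \<sigma>V \<sigma>E * fps_of_poly (equiv_eta K Y \<sigma>V) * equiv_theta K Y \<sigma>V \<sigma>E = 1"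
proof -
  let ?W = "equiv_gamma K Y \<sigma>V \<sigma>E * fps_of_poly (equiv_eta K Y \<sigma>V)"
  have W: "?W \<in> group_alg_fps K" using gamma_mem eta_mem by (rule V.AF.mult_mem)
  have W0: "fps_nth ?W 0 = 1" by (simp add: gamma_nth_0 eta_nth_0)
  show "equiv_theta K Y \<sigma>V \<sigma>E \<in> group_alg_fps K" "?W * equiv_theta K Y \<sigma>V \<sigma>E = 1"
    unfolding equiv_theta_def using V.inv_group_alg_fps[OF W W0] by simp_all
qed

lemma evs_theta:
  assumes "\<psi> \<in> chars K"
  shows "evs K \<psi> (equiv_gamma K Y \<sigma>V \<sigma>E) * evs K \<psi> (fps_of_poly (equiv_eta K Y \<sigma>V)) *
    evs K \<psi> (equiv_theta K Y \<sigma>V \<sigma>E) = 1"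
  using theta_inverse V.evs_one[OF assms] gamma_mem eta_mem theta_mem
  by (metis V.AF.mult_mem V.evs_mult[OF assms])

end

section \<open>Restriction to a subgroup\<close>

locale graph_action_pair = add_group_pair G H + GA: graph_action Y G \<sigma>V \<sigma>E
  for Y :: "('v, 'e) serre_graph" and G H :: "'g::ab_group_add set"
    and \<sigma>V :: "'g \<Rightarrow> 'v \<Rightarrow> 'v" and \<sigma>E :: "'g \<Rightarrow> 'e \<Rightarrow> 'e"
begin

lemma restricted: "graph_action Y H \<sigma>V \<sigma>E"
proof -
  have HG: "h \<in> G" if "h \<in> H" for h using that H_subset by auto
  interpret HV: finite_action H "verts Y" \<sigma>V
    by unfold_locales (auto simp: GA.finite_verts GA.V.act_zero GA.V.act_add GA.V.act_mem HG)
  interpret HE: finite_action H "edges Y" \<sigma>E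
    by unfold_locales (auto simp: GA.finite_edges GA.E.act_zero GA.E.act_add GA.E.act_mem HG)
  show ?thesis
    by unfold_locales
      (simp_all add: GA.org_equivariant GA.ter_equivariant GA.opp_equivariant GA.no_inversion HG)
qed

sublocale HA: graph_action Y H \<sigma>V \<sigma>E by (rule restricted)

lemma exts_chars: "\<psi> \<in> char_exts G H \<chi> \<Longrightarrow> \<psi> \<in> chars G"
  by (simp add: char_exts_def)

text \<open>The passage from \<open>G\<close> to \<open>H\<close>: the extensions cancel off
  \<open>H\<close>, and their number |G|/|H| changes the normalisation of the mean. For
  \<open>F\<close> the Lefschetz numbers it gives the formula for \<gamma>; for \<open>F\<close> the
  indicator of \<open>y\<close> being moved to \<open>x\<close> it adds up the projections.\<close>

lemma sum_exts_avg:
  assumes \<chi>: "\<chi> \<in> chars H"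
  shows "(\<Sum>\<psi>\<in>char_exts G H \<chi>. (\<Sum>g\<in>G. F g * \<psi> g) / of_nat (card G)) =
    (\<Sum>h\<in>H. F h * \<chi> h) / of_nat (card H)"
proof -
  have "(\<Sum>\<psi>\<in>char_exts G H \<chi>. (\<Sum>g\<in>G. F g * \<psi> g) / of_nat (card G)) =
      (\<Sum>g\<in>G. F g / of_nat (card G) * (\<Sum>\<psi>\<in>char_exts G H \<chi>. \<psi> g))"
    unfolding sum_divide_distrib sum_distrib_left by (subst sum.swap) simp
  also have "\<dots> = (\<Sum>g\<in>G. if g \<in> H then F g * \<chi> g / of_nat (card H) else 0)"
    by (intro sum.cong) (auto simp: sum_char_exts[OF \<chi>])
  also have "\<dots> = (\<Sum>h\<in>H. F h * \<chi> h / of_nat (card H))"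
    using H_subset by (intro sum.mono_neutral_cong_right) auto
  finally show ?thesis by (simp add: sum_divide_distrib)
qed

text \<open>
  The terms \<open>lefschetz\<close>, \<open>V.n\<close>, \<open>V.enum\<close>, \<open>beta\<close> and \<open>N_mat\<close> do not involve the acting group, so
  their \<open>GA\<close> and \<open>HA\<close> versions are the same.
\<close>

lemma prod_evs_gamma:
  assumes \<chi>: "\<chi> \<in> chars H"
  shows "(\<Prod>\<psi>\<in>char_exts G H \<chi>. evs G \<psi> (equiv_gamma G Y \<sigma>V \<sigma>E)) = evs H \<chi> (equiv_gamma H Y \<sigma>V \<sigma>E)"
proof -
  let ?L = "fps_ln 1 oo - (fps_X ^ 2) :: complex fps"
  have "(\<Prod>\<psi>\<in>char_exts G H \<chi>. evs G \<psi> (equiv_gamma G Y \<sigma>V \<sigma>E)) =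
      (\<Prod>\<psi>\<in>char_exts G H \<chi>. fps_exp (- ((\<Sum>g\<in>G. GA.lefschetz g * \<psi> g) / of_nat (card G))) oo ?L)"
    by (intro prod.cong) (auto simp: GA.evs_gamma exts_chars)
  also have "\<dots> = fps_exp (\<Sum>\<psi>\<in>char_exts G H \<chi>. - ((\<Sum>g\<in>G. GA.lefschetz g * \<psi> g) / of_nat (card G))) oo ?L"
    by (rule fps_exp_sum[symmetric]) auto
  also have "(\<Sum>\<psi>\<in>char_exts G H \<chi>. - ((\<Sum>g\<in>G. GA.lefschetz g * \<psi> g) / of_nat (card G))) =
      - ((\<Sum>h\<in>H. HA.lefschetz h * \<chi> h) / of_nat (card H))"
    unfolding sum_negf sum_exts_avg[OF \<chi>] by (simp add: GA.lefschetz_def HA.lefschetz_def)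
  also have "fps_exp \<dots> oo ?L = evs H \<chi> (equiv_gamma H Y \<sigma>V \<sigma>E)"
    by (rule HA.evs_gamma[OF \<chi>, symmetric])
  finally show ?thesis .
qed

lemma prod_evs_eta:
  assumes \<chi>: "\<chi> \<in> chars H"
  shows "(\<Prod>\<psi>\<in>char_exts G H \<chi>. evs G \<psi> (fps_of_poly (equiv_eta G Y \<sigma>V))) =
    evs H \<chi> (fps_of_poly (equiv_eta H Y \<sigma>V))"
proof -
  have P_sum: "(\<Sum>\<psi>\<in>char_exts G H \<chi>. GA.P_ker \<psi> y x) = HA.P_ker \<chi> y x" for y x
  proof -
    \<comment> \<open>Brings \<open>P_ker\<close> into the shape of \<open>sum_exts_avg\<close>,
      with the indicator as weight function.\<close>
    have G: "(if \<sigma>V g y = x then \<psi> g else 0) = (if \<sigma>V g y = x then 1 else 0) * \<psi> g" for g and \<psi> :: "'g \<Rightarrow> complex"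
      by simp
    show ?thesis
      unfolding GA.P_ker_def HA.P_ker_def G by (rule sum_exts_avg[OF \<chi>])
  qed
  have "(\<Prod>\<psi>\<in>char_exts G H \<chi>. evs G \<psi> (fps_of_poly (equiv_eta G Y \<sigma>V))) =
      (\<Prod>\<psi>\<in>char_exts G H \<chi>. det (1\<^sub>m GA.V.n + GA.N_mat * GA.P_mat \<psi>))"
    by (intro prod.cong) (auto simp: GA.evs_eta exts_chars)
  also have "\<dots> = det (1\<^sub>m GA.V.n + GA.N_mat * mat GA.V.n GA.V.n (\<lambda>rs. \<Sum>\<psi>\<in>char_exts G H \<chi>. GA.P_mat \<psi> $$ rs))"
    by (rule det_one_plus_orthogonal_sum[symmetric])
      (auto simp: GA.P_mat_commute GA.P_mat_orthogonal exts_chars, auto simp: GA.N_mat_def GA.P_mat_def)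
  also have "mat GA.V.n GA.V.n (\<lambda>rs. \<Sum>\<psi>\<in>char_exts G H \<chi>. GA.P_mat \<psi> $$ rs) = HA.P_mat \<chi>"
    by (intro eq_matI) (auto simp: GA.P_mat_def HA.P_mat_def P_sum[symmetric] fps_eq_iff fps_sum_nth)
  also have "det (1\<^sub>m GA.V.n + GA.N_mat * HA.P_mat \<chi>) = evs H \<chi> (fps_of_poly (equiv_eta H Y \<sigma>V))"
    by (rule HA.evs_eta[OF \<chi>, symmetric])
  finally show ?thesis .
qed

text \<open>Both sides are inverse to the same series, because the formulas for \<gamma> and \<eta>
  are known and \<theta> inverts their product at every character. In \<complex>[[u]] this common
  factor can be cancelled.\<close>

lemma prod_evs_theta:
  assumes \<chi>: "\<chi> \<in> chars H"
  shows "(\<Prod>\<psi>\<in>char_exts G H \<chi>. evs G \<psi> (equiv_theta G Y \<sigma>V \<sigma>E)) = evs H \<chi> (equiv_theta H Y \<sigma>V \<sigma>E)"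
proof -
  let ?g = "evs H \<chi> (equiv_gamma H Y \<sigma>V \<sigma>E)" and ?e = "evs H \<chi> (fps_of_poly (equiv_eta H Y \<sigma>V))"
  let ?p = "\<Prod>\<psi>\<in>char_exts G H \<chi>. evs G \<psi> (equiv_theta G Y \<sigma>V \<sigma>E)"
  have "?g * ?e * ?p = (\<Prod>\<psi>\<in>char_exts G H \<chi>. evs G \<psi> (equiv_gamma G Y \<sigma>V \<sigma>E) *
      evs G \<psi> (fps_of_poly (equiv_eta G Y \<sigma>V)) * evs G \<psi> (equiv_theta G Y \<sigma>V \<sigma>E))"
    unfolding prod.distrib prod_evs_gamma[OF \<chi>] prod_evs_eta[OF \<chi>] ..
  also have "\<dots> = 1"
    by (intro prod.neutral) (auto simp: GA.evs_theta exts_chars)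
  also have "\<dots> = ?g * ?e * evs H \<chi> (equiv_theta H Y \<sigma>V \<sigma>E)"
    by (rule HA.evs_theta[OF \<chi>, symmetric])
  finally show ?thesis
    using HA.evs_theta[OF \<chi>] by (metis mult_cancel_left mult_zero_left zero_neq_one)
qed

text \<open>Reduces each of the three equalities to a statement about single characters: the index
  set of the induced eigenbasis fibres over that of \<open>W\<close>, the fibre over j being the
  extensions of \<chi> j, so the product over it groups into products over extensions.\<close>

lemma sigma_rep_induced:
  assumes rep: "artin_rep H W"
    and F: "F \<in> group_alg_fps G" and F': "F' \<in> group_alg_fps H"
    and prod_eq: "\<And>\<chi>. \<chi> \<in> chars H \<Longrightarrow> (\<Prod>\<psi>\<in>char_exts G H \<chi>. evs G \<psi> F) = evs H \<chi> F'"
  shows "sigma_rep (induced_rep G H W) F = sigma_rep W F'"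
proof -
  from artin_rep_diagonalised[OF H.finite_add_group_axioms rep]
  obtain J :: "('a \<times> ('g \<Rightarrow> complex)) set" and \<chi> f where diag: "diagonalised H W J \<chi> f" by blast
  interpret W: diagonalised H W J \<chi> f by fact
  interpret I: induced_setup G H W J \<chi> f ..
  interpret IW: diagonalised G "induced_rep G H W" I.J' snd I.Q.lift by (rule I.induced_diagonalised)
  have "sigma_rep (induced_rep G H W) F = (\<Prod>p\<in>I.J'. evs G (snd p) F)"
    by (rule IW.sigma_rep_eq_prod[OF F])
  also have "\<dots> = (\<Prod>j\<in>J. \<Prod>\<psi>\<in>char_exts G H (\<chi> j). evs G \<psi> F)"
    unfolding I.J'_def using W.finite_J by (simp add: prod.Sigma case_prod_beta)
  also have "\<dots> = (\<Prod>j\<in>J. evs H (\<chi> j) F')"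
    using W.chars by (intro prod.cong) (auto simp: prod_eq)
  also have "\<dots> = sigma_rep W F'"
    by (rule W.sigma_rep_eq_prod[OF F', symmetric])
  finally show ?thesis .
qed

end

theorem theorem5p15:
  fixes Y :: "('v, 'e) serre_graph"
    and G H :: "'g::ab_group_add set"
    and \<sigma>V :: "'g \<Rightarrow> 'v \<Rightarrow> 'v" and \<sigma>E :: "'g \<Rightarrow> 'e \<Rightarrow> 'e"
    and V :: "('g \<Rightarrow>\<^sub>0 complex, 'm) module"
  assumes "comm_group (additive_group G)" and "finite G"
    and "action_without_inversion Y G \<sigma>V \<sigma>E"
    and "subgroup H (additive_group G)"
    and "artin_rep H V"
  shows "c_fun G Y \<sigma>V \<sigma>E (induced_rep G H V) = c_fun H Y \<sigma>V \<sigma>E V \<and>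
         h_fun G Y \<sigma>V (induced_rep G H V) = h_fun H Y \<sigma>V V \<and>
         L_fun G Y \<sigma>V \<sigma>E (induced_rep G H V) = L_fun H Y \<sigma>V \<sigma>E V"
proof -
  interpret act: action_without_inversion Y G \<sigma>V \<sigma>E by fact
  interpret add_group_pair G H using assms(1,2,4) by (rule add_group_pair_if_subgroup)
  interpret AV: finite_action G "verts Y" \<sigma>V
    by (rule finite_action_if_group_action[OF G.finite_add_group_axioms act.finite_verts act.action_verts])
  interpret AE: finite_action G "edges Y" \<sigma>E
    by (rule finite_action_if_group_action[OF G.finite_add_group_axioms act.finite_edges act.action_edges])
  interpret graph_action_pair Y G H \<sigma>V \<sigma>E
    by unfold_locales
      (auto simp: act.org_equivariant act.ter_equivariant act.opp_equivariant act.no_inversion)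
  show ?thesis
    unfolding c_fun_def h_fun_def L_fun_def
    using sigma_rep_induced[OF assms(5) GA.gamma_mem HA.gamma_mem prod_evs_gamma]
      sigma_rep_induced[OF assms(5) GA.eta_mem HA.eta_mem prod_evs_eta]
      sigma_rep_induced[OF assms(5) GA.theta_mem HA.theta_mem prod_evs_theta]
    by blast
qed

end
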